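(* Let $\mathfrak{F}$ be a $C^*$-algebra. The automorphism group $\mathrm{Aut}(\mathfrak{F})$ carries the structure of a real Banach-Lie group with Lie algebra given by the space $\mathscr{D}$ of symmetric bounded derivations on $\mathfrak{F}$, i.e. the space of all derivations $\delta\in\mathfrak{B}(\mathfrak{F})$ such that $(\delta(A))^*=\delta(A^* )$ for all $A\in\mathfrak{F}$.
   Context: $\mathrm{Aut}(\mathfrak{F})$ is the group of $*$-automorphisms of $\mathfrak{F}$, endowed with the norm topology as a subgroup of the invertible elements of the Banach algebra $\mathfrak{B}(\mathfrak{F})$ of bounded linear operators on $\mathfrak{F}$. A Banach-Lie group is a group with a smooth Banach manifold structure for which multiplication and inversion are smooth. $\mathscr{D}$ carries the commutator as Lie bracket and the operator norm. *)

theory Defs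
  imports "HOL-Analysis.Analysis" "HOL-Algebra.Group"
begin

section \<open>C*-algebras, *-automorphisms and symmetric derivations\<close>

text \<open>Complex C*-algebras, not necessarily unital.  Submultiplicativity of the norm and
  completeness come from \<open>real_normed_algebra\<close> and \<open>banach\<close>.\<close>

class cstar_algebra = real_normed_algebra + banach +
  fixes scaleC :: "complex \<Rightarrow> 'a \<Rightarrow> 'a"  (infixr "*\<^sub>C" 75)
    and adj :: "'a \<Rightarrow> 'a"
  assumes scaleC_add_right: "c *\<^sub>C (x + y) = c *\<^sub>C x + c *\<^sub>C y"
    and scaleC_add_left: "(c + d) *\<^sub>C x = c *\<^sub>C x + d *\<^sub>C x"
    and scaleC_scaleC: "c *\<^sub>C d *\<^sub>C x = (c * d) *\<^sub>C x"
    and scaleR_scaleC: "r *\<^sub>R x = complex_of_real r *\<^sub>C x"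
    and norm_scaleC: "norm (c *\<^sub>C x) = cmod c * norm x"
    and mult_scaleC_left: "(c *\<^sub>C x) * y = c *\<^sub>C (x * y)"
    and mult_scaleC_right: "x * (c *\<^sub>C y) = c *\<^sub>C (x * y)"
    and adj_adj: "adj (adj x) = x"
    and adj_add: "adj (x + y) = adj x + adj y"
    and adj_scaleC: "adj (c *\<^sub>C x) = cnj c *\<^sub>C adj x"
    and adj_mult: "adj (x * y) = adj y * adj x"
    and cstar_identity: "norm (adj x * x) = (norm x)\<^sup>2"

text \<open>The Banach algebra of bounded complex-linear operators sits inside the library type
  \<open>'a \<Rightarrow>\<^sub>L 'a\<close> of bounded real-linear operators; complex linearity is imposed
  separately below, and the operator norm is the same one.\<close>

definition star_automorphism :: "('a::cstar_algebra \<Rightarrow> 'a) \<Rightarrow> bool" where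
  "star_automorphism f \<longleftrightarrow> bij f
     \<and> (\<forall>x y. f (x + y) = f x + f y) \<and> (\<forall>c x. f (c *\<^sub>C x) = c *\<^sub>C f x)
     \<and> (\<forall>x y. f (x * y) = f x * f y) \<and> (\<forall>x. f (adj x) = adj (f x))"

definition Aut :: "('a::cstar_algebra \<Rightarrow>\<^sub>L 'a) monoid" where
  "Aut = \<lparr>carrier = {T. star_automorphism (blinfun_apply T)},
          mult = (o\<^sub>L), one = id_blinfun\<rparr>"

definition symmetric_derivations :: "('a::cstar_algebra \<Rightarrow>\<^sub>L 'a) set" where
  "symmetric_derivations = {\<delta> :: 'a \<Rightarrow>\<^sub>L 'a. (\<forall>c x. \<delta> (c *\<^sub>C x) = c *\<^sub>C \<delta> x)
     \<and> (\<forall>x y. \<delta> (x * y) = \<delta> x * y + x * \<delta> y)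
     \<and> (\<forall>x. adj (\<delta> x) = \<delta> (adj x))}"

definition commutator ::
    "('a::real_normed_vector \<Rightarrow>\<^sub>L 'a) \<Rightarrow> ('a \<Rightarrow>\<^sub>L 'a) \<Rightarrow> ('a \<Rightarrow>\<^sub>L 'a)" where
  "commutator S T = (S o\<^sub>L T) - (T o\<^sub>L S)"


subsection \<open>The symmetric derivations as a real Banach space\<close>

lemma scaleC_scaleR: "c *\<^sub>C r *\<^sub>R (x::'a::cstar_algebra) = r *\<^sub>R c *\<^sub>C x"
  by (simp add: scaleR_scaleC scaleC_scaleC mult.commute)

lemma scaleC_minus_right: "c *\<^sub>C (- (x::'a::cstar_algebra)) = - (c *\<^sub>C x)"
  using scaleC_scaleR[of c "-1" x] by simp

lemma adj_scaleR: "adj (r *\<^sub>R (x::'a::cstar_algebra)) = r *\<^sub>R adj x"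
  by (simp add: scaleR_scaleC adj_scaleC)

lemma norm_adj_le: "norm (x::'a::cstar_algebra) \<le> norm (adj x)"
proof (cases "x = 0")
  case False
  have "norm x * norm x \<le> norm (adj x) * norm x"
    using norm_mult_ineq[of "adj x" x] cstar_identity[of x] by (simp add: power2_eq_square)
  with False show ?thesis by simp
qed (simp)

lemma norm_adj: "norm (adj x) = norm (x::'a::cstar_algebra)"
  using norm_adj_le[of x] norm_adj_le[of "adj x"] by (simp add: adj_adj)

lemma bounded_linear_scaleC: "bounded_linear ((*\<^sub>C) c :: 'a::cstar_algebra \<Rightarrow> 'a)"
  by (rule bounded_linear_intro[where K = "cmod c"])
     (simp_all add: scaleC_add_right scaleC_scaleR norm_scaleC mult.commute)

lemma bounded_linear_adj: "bounded_linear (adj :: 'a::cstar_algebra \<Rightarrow> 'a)"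
  by (rule bounded_linear_intro[where K = 1])
     (simp_all add: adj_add adj_scaleR norm_adj)

lemma subspace_symmetric_derivations:
  "subspace (symmetric_derivations :: ('a::cstar_algebra \<Rightarrow>\<^sub>L 'a) set)"
  unfolding subspace_def symmetric_derivations_def
  using linear_0[OF bounded_linear.linear[OF bounded_linear_scaleC]]
    linear_0[OF bounded_linear.linear[OF bounded_linear_adj]]
  by (auto simp: blinfun.bilinear_simps scaleC_add_right scaleC_scaleR adj_add adj_scaleR
      algebra_simps)

lemma closed_symmetric_derivations:
  "closed (symmetric_derivations :: ('a::cstar_algebra \<Rightarrow>\<^sub>L 'a) set)"
proof -
  have ev: "continuous_on UNIV (\<lambda>\<delta>::'a \<Rightarrow>\<^sub>L 'a. \<delta> x)" for x
    by (intro continuous_intros)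
  have "closed {\<delta>::'a \<Rightarrow>\<^sub>L 'a. \<delta> (c *\<^sub>C x) = c *\<^sub>C \<delta> x}" for c x
    by (rule closed_Collect_eq[OF ev bounded_linear.continuous_on[OF bounded_linear_scaleC ev]])
  moreover have "closed {\<delta>::'a \<Rightarrow>\<^sub>L 'a. \<delta> (x * y) = \<delta> x * y + x * \<delta> y}" for x y
    by (rule closed_Collect_eq[OF ev]) (intro continuous_intros)
  moreover have "closed {\<delta>::'a \<Rightarrow>\<^sub>L 'a. adj (\<delta> x) = \<delta> (adj x)}" for x
    by (rule closed_Collect_eq[OF bounded_linear.continuous_on[OF bounded_linear_adj ev] ev])
  ultimately show ?thesis
    unfolding symmetric_derivations_def
    by (intro closed_Collect_conj closed_Collect_all)
qed

typedef (overloaded) 'a sym_deriv = "symmetric_derivations :: ('a::cstar_algebra \<Rightarrow>\<^sub>L 'a) set"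
  morphisms of_sym_deriv Sym_Deriv
  using subspace_0[OF subspace_symmetric_derivations] by blast

instantiation sym_deriv :: (cstar_algebra) real_normed_vector
begin

definition "0 = Sym_Deriv 0"
definition "x + y = Sym_Deriv (of_sym_deriv x + of_sym_deriv y)"
definition "x - y = Sym_Deriv (of_sym_deriv x - of_sym_deriv y)"
definition "- x = Sym_Deriv (- of_sym_deriv x)"
definition "r *\<^sub>R x = Sym_Deriv (r *\<^sub>R of_sym_deriv x)"
definition norm_sym_deriv_def: "norm x = norm (of_sym_deriv x)"
definition dist_sym_deriv_def: "dist (x::'a sym_deriv) y = norm (x - y)"
definition sgn_sym_deriv_def: "sgn x = inverse (norm x) *\<^sub>R (x::'a sym_deriv)"
definition uniformity_sym_deriv_def:
  "(uniformity :: ('a sym_deriv \<times> 'a sym_deriv) filter) =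
     (INF e\<in>{0<..}. principal {(x, y). dist x y < e})"
definition open_sym_deriv_def:
  "open (U :: 'a sym_deriv set) \<longleftrightarrow>
     (\<forall>x\<in>U. eventually (\<lambda>(x', y). x' = x \<longrightarrow> y \<in> U) uniformity)"

lemma of_sym_deriv_simps:
  "of_sym_deriv (0::'a sym_deriv) = 0"
  "of_sym_deriv (x + y) = of_sym_deriv x + of_sym_deriv (y::'a sym_deriv)"
  "of_sym_deriv (x - y) = of_sym_deriv x - of_sym_deriv (y::'a sym_deriv)"
  "of_sym_deriv (- x) = - of_sym_deriv (x::'a sym_deriv)"
  "of_sym_deriv (r *\<^sub>R x) = r *\<^sub>R of_sym_deriv (x::'a sym_deriv)"
  using of_sym_deriv[of x] of_sym_deriv[of y]
  by (simp_all add: zero_sym_deriv_def plus_sym_deriv_def minus_sym_deriv_def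
      uminus_sym_deriv_def scaleR_sym_deriv_def Sym_Deriv_inverse
      subspace_0 subspace_add subspace_diff subspace_neg subspace_scale
      subspace_symmetric_derivations)

instance
proof
  fix x y z :: "'a sym_deriv" and r s :: real and U :: "'a sym_deriv set"
  note inj = of_sym_deriv_inject[symmetric]
  show "x + y + z = x + (y + z)" "x + y = y + x" "0 + x = x" "- x + x = 0" "x - y = x + - y"
    by (simp_all only: inj of_sym_deriv_simps) (simp_all add: add_ac)
  show "r *\<^sub>R (x + y) = r *\<^sub>R x + r *\<^sub>R y" "(r + s) *\<^sub>R x = r *\<^sub>R x + s *\<^sub>R x"
    "r *\<^sub>R s *\<^sub>R x = (r * s) *\<^sub>R x" "1 *\<^sub>R x = x"
    by (simp_all only: inj of_sym_deriv_simps scaleR_add_left scaleR_add_right scaleR_scaleR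
        scaleR_one)
  show "norm x = 0 \<longleftrightarrow> x = 0" "norm (x + y) \<le> norm x + norm y" "norm (r *\<^sub>R x) = \<bar>r\<bar> * norm x"
    by (simp_all only: inj of_sym_deriv_simps norm_sym_deriv_def norm_eq_zero norm_triangle_ineq
        norm_scaleR)
qed (simp_all only: dist_sym_deriv_def sgn_sym_deriv_def uniformity_sym_deriv_def
       open_sym_deriv_def)

end

instance sym_deriv :: (cstar_algebra) banach
proof
  fix X :: "nat \<Rightarrow> 'a sym_deriv"
  assume "Cauchy X"
  then have "Cauchy (\<lambda>n. of_sym_deriv (X n))"
    unfolding Cauchy_def dist_norm norm_sym_deriv_def of_sym_deriv_simps .
  then obtain L where L: "(\<lambda>n. of_sym_deriv (X n)) \<longlonglongrightarrow> L"
    by (auto simp: Cauchy_convergent_iff convergent_def)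
  then have "L \<in> symmetric_derivations"
    by (rule closed_sequentially[OF closed_symmetric_derivations of_sym_deriv])
  then have "X \<longlonglongrightarrow> Sym_Deriv L"
    using L unfolding tendsto_iff dist_norm norm_sym_deriv_def of_sym_deriv_simps
    by (simp add: Sym_Deriv_inverse)
  then show "convergent X"
    by (auto simp: convergent_def)
qed


section \<open>Smooth maps between open subsets of Banach spaces\<close>

text \<open>A \<open>k\<close>-linear map is a function on lists, constrained only on lists of length \<open>k\<close>.\<close>

definition bounded_multilinear ::
    "nat \<Rightarrow> ('e::real_normed_vector list \<Rightarrow> 'f::real_normed_vector) \<Rightarrow> bool" where
  "bounded_multilinear k M \<longleftrightarrow>
     (\<forall>vs i. length vs = k \<longrightarrow> i < k \<longrightarrow> linear (\<lambda>u. M (vs[i := u])))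
     \<and> (\<exists>C. \<forall>vs. length vs = k \<longrightarrow> norm (M vs) \<le> C * prod_list (map norm vs))"

text \<open>Infinite Frechet differentiability: \<open>D k x\<close> is the \<open>k\<close>-th derivative at \<open>x\<close>, a bounded
  \<open>k\<close>-linear map, and the last clause says that \<open>D (Suc k) x\<close> is the Frechet derivative at \<open>x\<close>
  of \<open>y \<mapsto> D k y\<close> with respect to the operator norm on bounded \<open>k\<close>-linear maps.  The
  spaces of \<open>k\<close>-linear maps have different types as iterated \<open>\<Rightarrow>\<^sub>L\<close>, hence
  the uncurried form.\<close>

definition smooth_on :: "'e::real_normed_vector set \<Rightarrow> ('e \<Rightarrow> 'f::real_normed_vector) \<Rightarrow> bool" where
  "smooth_on U f \<longleftrightarrow> open U \<and>
     (\<exists>D :: nat \<Rightarrow> 'e \<Rightarrow> 'e list \<Rightarrow> 'f.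
        (\<forall>x\<in>U. D 0 x [] = f x) \<and>
        (\<forall>k. \<forall>x\<in>U. bounded_multilinear k (D k x)) \<and>
        (\<forall>k. \<forall>x\<in>U. \<forall>\<epsilon>>0. \<forall>\<^sub>F y in nhds x. \<forall>vs. length vs = k \<longrightarrow>
           norm (D k y vs - D k x vs - D (Suc k) x ((y - x) # vs))
             \<le> \<epsilon> * norm (y - x) * prod_list (map norm vs)))"


section \<open>Banach manifolds\<close>

text \<open>A chart is a pair of its domain and a coordinate map, the latter being relevant on the
  domain only.\<close>

type_synonym ('m, 'e) chart = "'m set \<times> ('m \<Rightarrow> 'e)"

definition local_rep :: "('m, 'e) chart \<Rightarrow> ('m \<Rightarrow> 'n) \<Rightarrow> ('n, 'f) chart \<Rightarrow> 'e \<Rightarrow> 'f" where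
  "local_rep c f d = snd d \<circ> f \<circ> inv_into (fst c) (snd c)"

definition banach_manifold :: "'m topology \<Rightarrow> ('m, 'e::banach) chart set \<Rightarrow> bool" where
  "banach_manifold X \<A> \<longleftrightarrow> Hausdorff_space X
     \<and> (\<Union>(fst ` \<A>)) = topspace X
     \<and> (\<forall>(U, \<phi>)\<in>\<A>. openin X U \<and> open (\<phi> ` U)
          \<and> homeomorphic_map (subtopology X U) (top_of_set (\<phi> ` U)) \<phi>)
     \<and> (\<forall>c\<in>\<A>. \<forall>d\<in>\<A>. smooth_on (snd c ` (fst c \<inter> fst d)) (local_rep c id d))"

definition smooth_map ::
    "'m topology \<Rightarrow> ('m, 'e::banach) chart set \<Rightarrow> 'n topology \<Rightarrow> ('n, 'f::banach) chart set
      \<Rightarrow> ('m \<Rightarrow> 'n) \<Rightarrow> bool" where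
  "smooth_map X \<A> Y \<B> f \<longleftrightarrow> continuous_map X Y f
     \<and> (\<forall>c\<in>\<A>. \<forall>d\<in>\<B>. smooth_on (snd c ` (fst c \<inter> f -` fst d)) (local_rep c f d))"

definition prod_atlas ::
    "('m, 'e) chart set \<Rightarrow> ('n, 'f) chart set \<Rightarrow> ('m \<times> 'n, 'e \<times> 'f) chart set" where
  "prod_atlas \<A> \<B> = {(fst c \<times> fst d, map_prod (snd c) (snd d)) | c d. c \<in> \<A> \<and> d \<in> \<B>}"

text \<open>A tangent vector at \<open>p\<close> is a class of pairs of a chart around \<open>p\<close> and a coordinate vector,
  two pairs being identified if the derivative of the change of charts maps one vector to the
  other.  Each class contains exactly one vector for every chart around \<open>p\<close>, so it is encoded as
  a function on charts, extended by 0 to the charts that do not contain \<open>p\<close>.  The predicate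
  \<open>tangent_related \<A> \<B> f p \<xi> \<eta>\<close> says that the tangent map of \<open>f\<close> at \<open>p\<close> sends \<open>\<xi>\<close> to \<open>\<eta>\<close>.\<close>

type_synonym ('m, 'e) tangent = "('m, 'e) chart \<Rightarrow> 'e"

definition tangent_related ::
    "('m, 'e::banach) chart set \<Rightarrow> ('n, 'f::banach) chart set \<Rightarrow> ('m \<Rightarrow> 'n) \<Rightarrow> 'm
      \<Rightarrow> ('m, 'e) tangent \<Rightarrow> ('n, 'f) tangent \<Rightarrow> bool" where
  "tangent_related \<A> \<B> f p \<xi> \<eta> \<longleftrightarrow>
     (\<forall>c\<in>\<A>. \<forall>d\<in>\<B>. p \<in> fst c \<longrightarrow> f p \<in> fst d \<longrightarrow>
        \<eta> d = frechet_derivative (local_rep c f d) (at (snd c p)) (\<xi> c))"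

definition tangent_space :: "('m, 'e::banach) chart set \<Rightarrow> 'm \<Rightarrow> ('m, 'e) tangent set" where
  "tangent_space \<A> p = {\<xi>. tangent_related \<A> \<A> id p \<xi> \<xi>
     \<and> (\<forall>c. \<not> (c \<in> \<A> \<and> p \<in> fst c) \<longrightarrow> \<xi> c = 0)}"

type_synonym ('m, 'e) vfield = "'m \<Rightarrow> ('m, 'e) tangent"

definition vfield_rep :: "('m, 'e) chart \<Rightarrow> ('m, 'e) vfield \<Rightarrow> 'e \<Rightarrow> 'e" where
  "vfield_rep c V = (\<lambda>x. V (inv_into (fst c) (snd c) x) c)"

text \<open>Outside the manifold the tangent space is \<open>{0}\<close>, so quantifying over all \<open>p\<close> only
  fixes irrelevant values.\<close>

definition smooth_vfields :: "('m, 'e::banach) chart set \<Rightarrow> ('m, 'e) vfield set" where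
  "smooth_vfields \<A> = {V. (\<forall>p. V p \<in> tangent_space \<A> p)
     \<and> (\<forall>c\<in>\<A>. smooth_on (snd c ` fst c) (vfield_rep c V))}"

definition vfield_bracket ::
    "('m, 'e::banach) chart set \<Rightarrow> ('m, 'e) vfield \<Rightarrow> ('m, 'e) vfield \<Rightarrow> ('m, 'e) vfield" where
  "vfield_bracket \<A> V W = (\<lambda>p c. if c \<in> \<A> \<and> p \<in> fst c
     then frechet_derivative (vfield_rep c W) (at (snd c p)) (V p c)
        - frechet_derivative (vfield_rep c V) (at (snd c p)) (W p c)
     else 0)"


section \<open>Banach-Lie groups and their Lie algebras\<close>

definition banach_lie_group ::
    "('m, 'r) monoid_scheme \<Rightarrow> 'm topology \<Rightarrow> ('m, 'e::banach) chart set \<Rightarrow> bool" where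
  "banach_lie_group G X \<A> \<longleftrightarrow> group G \<and> topspace X = carrier G \<and> banach_manifold X \<A>
     \<and> smooth_map (prod_topology X X) (prod_atlas \<A> \<A>) X \<A> (\<lambda>(g, h). g \<otimes>\<^bsub>G\<^esub> h)
     \<and> smooth_map X \<A> X \<A> (\<lambda>g. inv\<^bsub>G\<^esub> g)"

definition left_invariant_vfields ::
    "('m, 'r) monoid_scheme \<Rightarrow> ('m, 'e::banach) chart set \<Rightarrow> ('m, 'e) vfield set" where
  "left_invariant_vfields G \<A> = {V \<in> smooth_vfields \<A>.
     \<forall>g\<in>carrier G. \<forall>h\<in>carrier G.
       tangent_related \<A> \<A> (\<lambda>x. g \<otimes>\<^bsub>G\<^esub> x) h (V h) (V (g \<otimes>\<^bsub>G\<^esub> h))}"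

text \<open>\<open>\<Psi>\<close> is an isomorphism of topological Lie algebras from the Lie algebra of \<open>G\<close>, i.e. the
  left-invariant vector fields, onto \<open>L\<close> with the bracket \<open>br\<close>.  The topology on the Lie algebra
  of \<open>G\<close> is that of the tangent space at the identity, which is given by the norm of the
  coordinate vector in any chart around the identity; hence the last clause.\<close>

definition lie_algebra_iso ::
    "('m, 'r) monoid_scheme \<Rightarrow> ('m, 'e::banach) chart set \<Rightarrow> 'b::real_normed_vector set
      \<Rightarrow> ('b \<Rightarrow> 'b \<Rightarrow> 'b) \<Rightarrow> (('m, 'e) vfield \<Rightarrow> 'b) \<Rightarrow> bool" where
  "lie_algebra_iso G \<A> L br \<Psi> \<longleftrightarrow>
     bij_betw \<Psi> (left_invariant_vfields G \<A>) L
     \<and> (\<forall>V\<in>left_invariant_vfields G \<A>. \<forall>W\<in>left_invariant_vfields G \<A>.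
          \<Psi> (\<lambda>p c. V p c + W p c) = \<Psi> V + \<Psi> W
          \<and> \<Psi> (vfield_bracket \<A> V W) = br (\<Psi> V) (\<Psi> W))
     \<and> (\<forall>V\<in>left_invariant_vfields G \<A>. \<forall>r. \<Psi> (\<lambda>p c. r *\<^sub>R V p c) = r *\<^sub>R \<Psi> V)
     \<and> (\<forall>c\<in>\<A>. \<one>\<^bsub>G\<^esub> \<in> fst c \<longrightarrow>
          (\<exists>K. \<forall>V\<in>left_invariant_vfields G \<A>.
             norm (\<Psi> V) \<le> K * norm (V \<one>\<^bsub>G\<^esub> c) \<and> norm (V \<one>\<^bsub>G\<^esub> c) \<le> K * norm (\<Psi> V)))"

end

theory Submission imports Defs begin

text \<open>
  The exponential series maps a symmetric bounded derivation to an automorphism.  Conversely, an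
  automorphism close to the identity is the exponential of its logarithm, and this logarithm is a
  symmetric derivation.  So the exponential map identifies a ball in the Banach space of
  symmetric derivations with a neighbourhood of the identity, and left translates of its inverse
  are the charts of \<open>Aut\<close>.  In these charts the change of coordinates, the product
  and the inverse are all of the form \<open>log\<close> of a product of constant operators and
  exponentials, hence smooth.

  The heart of the matter is \<open>op_log_symmetric_derivation\<close>.  Complex linearity and
  compatibility with the involution say that \<open>T\<close> commutes with fixed real-linear
  operators; a power series in \<open>T\<close> then commutes with them, too.  Multiplicativity is the
  point: if \<open>T = exp D\<close> is multiplicative and \<open>D\<close> is small, then \<open>exp (D / 2)\<close> is
  multiplicative, because a square root of \<open>T\<close> near the identity that is not multiplicative
  would have a defect \<open>d\<close> with \<open>R (d x y) = - d (R x) (R y)\<close>, which is impossible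
  for \<open>R\<close> close to the identity unless \<open>d = 0\<close>
  (\<open>multiplicative_sqrt\<close>).  Iterating, \<open>exp (D / 2\<^sup>n)\<close> is multiplicative for all
  \<open>n\<close>, and differentiating along \<open>2\<^sup>-\<^sup>n \<rightarrow> 0\<close> shows that \<open>D\<close> is a derivation.  That
  inverses of automorphisms are bounded is the bounded inverse theorem, proved by Baire category.

  Smoothness needs a calculus of derivatives of all orders on Banach spaces.  A map is smooth iff
  it extends to a \<open>jet\<close>: a function of a point and a list of directions in which
  lengthening the list is differentiation, with local bounds.  The chain rule becomes
  the recursive form of the formula of Faa di Bruno (\<open>smooth_on_compose\<close>), and convergent
  power series of operators are smooth because their jets can be written down and bounded
  (\<open>jet_series_jet\<close>).

  As all charts are left translates of one another, a left-invariant field has the same coordinate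
  expression \<open>left_coord \<delta>\<close> in each of them, where \<open>\<delta>\<close> is its value at the identity.  The
  derivative of the exponential map turns \<open>left_coord \<delta>\<close> into the field \<open>T \<mapsto> T \<delta>\<close>.
  Differentiating this relation once more and antisymmetrising, the symmetric second derivative
  of the exponential map cancels, and what remains is that the bracket of fields is the
  commutator (\<open>left_coord_bracket\<close>).\<close>

section \<open>Jets: all derivatives of a smooth map\<close>

abbreviation norm_prod :: "'a::real_normed_vector list \<Rightarrow> real" where
  "norm_prod vs \<equiv> prod_list (map norm vs)"

lemma norm_prod_nonneg [simp]: "0 \<le> norm_prod vs"
  by (induction vs) auto

text \<open>\<open>D x vs\<close> is the iterated derivative at \<open>x\<close> in the directions \<open>vs\<close>, the order being the length
of \<open>vs\<close>.  Differentiability is asked for each fixed \<open>vs\<close> only; multilinearity and the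
estimate uniform in \<open>vs\<close> that \<open>smooth_on\<close> demands follow from it and the local bounds.
So a jet is what can be verified for an explicit formula.\<close>

definition jet :: "'e::real_normed_vector set \<Rightarrow> ('e \<Rightarrow> 'e list \<Rightarrow> 'f::real_normed_vector) \<Rightarrow> bool" where
  "jet U D \<longleftrightarrow> open U
     \<and> (\<forall>x\<in>U. \<forall>vs. ((\<lambda>y. D y vs) has_derivative (\<lambda>u. D x (u # vs))) (at x))
     \<and> (\<forall>x\<in>U. \<forall>k. \<exists>C. \<forall>\<^sub>F y in nhds x. \<forall>vs. length vs = k \<longrightarrow> norm (D y vs) \<le> C * norm_prod vs)"

lemma jet_open: "jet U D \<Longrightarrow> open U"
  by (simp add: jet_def)

lemma jet_has_derivative:
  "jet U D \<Longrightarrow> x \<in> U \<Longrightarrow> ((\<lambda>y. D y vs) has_derivative (\<lambda>u. D x (u # vs))) (at x)"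
  by (simp add: jet_def)

lemma jet_bound_eventually:
  assumes "jet U D" "x \<in> U"
  shows "\<exists>C\<ge>1. \<forall>\<^sub>F y in nhds x. \<forall>vs. length vs \<le> k \<longrightarrow> norm (D y vs) \<le> C * norm_prod vs"
proof (induction k)
  case 0
  obtain C where C: "\<forall>\<^sub>F y in nhds x. \<forall>vs. length vs = 0 \<longrightarrow> norm (D y vs) \<le> C * norm_prod vs"
    using assms unfolding jet_def by blast
  have "\<forall>\<^sub>F y in nhds x. \<forall>vs. length vs \<le> 0 \<longrightarrow> norm (D y vs) \<le> max 1 C * norm_prod vs"
    using C by eventually_elim auto
  then show ?case by (intro exI[of _ "max 1 C"]) simp
next
  case (Suc k)
  then obtain C where C: "C \<ge> 1" "\<forall>\<^sub>F y in nhds x. \<forall>vs. length vs \<le> k \<longrightarrow> norm (D y vs) \<le> C * norm_prod vs"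
    by blast
  obtain C' where C': "\<forall>\<^sub>F y in nhds x. \<forall>vs. length vs = Suc k \<longrightarrow> norm (D y vs) \<le> C' * norm_prod vs"
    using assms unfolding jet_def by blast
  have "\<forall>\<^sub>F y in nhds x. \<forall>vs. length vs \<le> Suc k \<longrightarrow> norm (D y vs) \<le> max C C' * norm_prod vs"
    using C(2) C'
  proof eventually_elim
    case (elim y)
    show ?case
    proof (intro allI impI)
      fix vs :: "'a list" assume "length vs \<le> Suc k"
      then have "norm (D y vs) \<le> C * norm_prod vs \<or> norm (D y vs) \<le> C' * norm_prod vs"
        using elim by (cases "length vs = Suc k") auto
      moreover have "C * norm_prod vs \<le> max C C' * norm_prod vs" "C' * norm_prod vs \<le> max C C' * norm_prod vs"
        by (auto intro!: mult_right_mono)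
      ultimately show "norm (D y vs) \<le> max C C' * norm_prod vs" by linarith
    qed
  qed
  then show ?case using C(1) by (intro exI[of _ "max C C'"]) auto
qed

lemma jet_bound:
  assumes "jet U D" "x \<in> U"
  obtains C d where "C \<ge> 1" "d > 0" "ball x d \<subseteq> U"
    "\<And>y vs. y \<in> ball x d \<Longrightarrow> length vs \<le> k \<Longrightarrow> norm (D y vs) \<le> C * norm_prod vs"
proof -
  obtain C where C: "C \<ge> 1" "\<forall>\<^sub>F y in nhds x. \<forall>vs. length vs \<le> k \<longrightarrow> norm (D y vs) \<le> C * norm_prod vs"
    using jet_bound_eventually[OF assms] by blast
  have "\<forall>\<^sub>F y in nhds x. y \<in> U"
    using assms by (auto simp: jet_def eventually_nhds)
  with C(2) have "\<forall>\<^sub>F y in nhds x. y \<in> U \<and> (\<forall>vs. length vs \<le> k \<longrightarrow> norm (D y vs) \<le> C * norm_prod vs)"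
    by eventually_elim auto
  then obtain d where "d > 0" "\<forall>y. dist y x < d \<longrightarrow> y \<in> U \<and> (\<forall>vs. length vs \<le> k \<longrightarrow> norm (D y vs) \<le> C * norm_prod vs)"
    unfolding eventually_nhds_metric by blast
  then show ?thesis
    by (intro that[of C d] C(1)) (auto simp: dist_commute)
qed

text \<open>A local bound of order \<open>k + 2\<close> makes the derivatives of order \<open>k + 1\<close> Lipschitz, uniformly in the
directions; the mean value theorem then bounds the remainder of order \<open>k\<close> quadratically.\<close>

lemma jet_uniform_derivative:
  fixes D :: "'e::real_normed_vector \<Rightarrow> 'e list \<Rightarrow> 'f::real_normed_vector"
  assumes D: "jet U D" and x: "x \<in> U" and e: "\<epsilon> > 0"
  shows "\<forall>\<^sub>F y in nhds x. \<forall>vs. length vs = k \<longrightarrow>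
    norm (D y vs - D x vs - D x ((y - x) # vs)) \<le> \<epsilon> * norm (y - x) * norm_prod vs"
proof -
  obtain C d where C: "C \<ge> 1" "d > 0" "ball x d \<subseteq> U"
    "\<And>y vs. y \<in> ball x d \<Longrightarrow> length vs \<le> k + 2 \<Longrightarrow> norm (D y vs) \<le> C * norm_prod vs"
    using jet_bound[OF D x, where k = "k + 2"] by blast
  define r where "r = min d (\<epsilon> / C)"
  have r: "r > 0" "r \<le> d" "C * r \<le> \<epsilon>"
    using C e by (auto simp: r_def min_def field_simps)
  have der: "((\<lambda>y. D y vs) has_derivative (\<lambda>u. D y (u # vs))) (at y within S)"
    if "y \<in> ball x d" for y vs S
    using jet_has_derivative[OF D, of y vs] that C(3) has_derivative_at_withinI by blast
  have "norm (D y vs - D x vs - D x ((y - x) # vs)) \<le> \<epsilon> * norm (y - x) * norm_prod vs"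
    if y: "y \<in> ball x r" and vs: "length vs = k" for y vs
  proof -
    have xr: "x \<in> ball x r" using r by simp
    have in_d: "z \<in> ball x d" if "z \<in> ball x r" for z using that r by auto
    have lip: "norm (D z (h # vs) - D x (h # vs)) \<le> (C * r * norm_prod vs) * norm h"
      if z: "z \<in> ball x r" for z h
    proof -
      have "norm (D z (h # vs) - D x (h # vs)) \<le> (C * norm_prod (h # vs)) * norm (z - x)"
      proof (rule differentiable_bound[where S = "ball x r"])
        fix w assume w: "w \<in> ball x r"
        show "((\<lambda>y. D y (h # vs)) has_derivative (\<lambda>u. D w (u # h # vs))) (at w within ball x r)"
          using der in_d w by blast
        show "onorm (\<lambda>u. D w (u # h # vs)) \<le> C * norm_prod (h # vs)"
        proof (rule onorm_bound)
          show "0 \<le> C * norm_prod (h # vs)" using C(1) by simp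
          show "norm (D w (u # h # vs)) \<le> C * norm_prod (h # vs) * norm u" for u
            using C(4)[of w "u # h # vs"] in_d[OF w] vs by (simp add: algebra_simps)
        qed
      qed (use z xr in auto)
      also have "\<dots> \<le> (C * norm_prod (h # vs)) * r"
        using z C(1) by (intro mult_left_mono) (auto simp: dist_norm norm_minus_commute)
      finally show ?thesis by (simp add: mult_ac)
    qed
    have "norm (D y vs - D x vs - D x ((y - x) # vs)) \<le> norm (y - x) * (C * r * norm_prod vs)"
    proof (rule differentiable_bound_linearization[where S = "ball x r"])
      fix t :: real assume t: "t \<in> {0..1}"
      show "x + t *\<^sub>R (y - x) \<in> ball x r"
        using y t mult_left_le_one_le[of "norm (y - x)" t]
        by (auto simp: dist_norm norm_minus_commute)
    next
      fix w assume w: "w \<in> ball x r"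
      show "((\<lambda>y. D y vs) has_derivative (\<lambda>u. D w (u # vs))) (at w within ball x r)"
        using der in_d w by blast
      show "onorm ((\<lambda>u. D w (u # vs)) - (\<lambda>u. D x (u # vs))) \<le> C * r * norm_prod vs"
      proof (rule onorm_bound)
        show "0 \<le> C * r * norm_prod vs" using C(1) r by simp
      qed (use lip[OF w] in auto)
    qed (use xr in auto)
    also have "\<dots> \<le> \<epsilon> * norm (y - x) * norm_prod vs"
      using mult_right_mono[OF r(3), of "norm (y - x) * norm_prod vs"] by (simp add: mult_ac)
    finally show ?thesis .
  qed
  then show ?thesis
    unfolding eventually_nhds_metric using r(1)
    by (intro exI[of _ r]) (auto simp: dist_commute)
qed

text \<open>In the first slot this is the linearity of a Frechet derivative.  An identity between jets that
holds on the open set \<open>U\<close> survives differentiation, which moves every slot up by one.\<close>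

lemma jet_slot_linear:
  assumes D: "jet U D"
  shows "x \<in> U \<Longrightarrow> i < length vs \<Longrightarrow> linear (\<lambda>u. D x (vs[i := u]))"
proof (induction vs arbitrary: x i)
  case (Cons v vs)
  show ?case
  proof (cases i)
    case 0
    then show ?thesis
      using has_derivative_linear[OF jet_has_derivative[OF D Cons.prems(1)]] by simp
  next
    case (Suc j)
    then have j: "j < length vs" using Cons.prems by simp
    note lin = Cons.IH[OF _ j]
    note der = jet_has_derivative[OF D Cons.prems(1)]
    have U: "open U" using D by (rule jet_open)
    show ?thesis unfolding Suc list_update.simps nat.case
    proof (rule linearI)
      fix a b
      have "((\<lambda>y. D y (vs[j := a]) + D y (vs[j := b])) has_derivative
          (\<lambda>u. D x (u # vs[j := a]) + D x (u # vs[j := b]))) (at x)"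
        by (intro has_derivative_add der)
      then have "((\<lambda>y. D y (vs[j := a + b])) has_derivative
          (\<lambda>u. D x (u # vs[j := a]) + D x (u # vs[j := b]))) (at x)"
        by (rule has_derivative_transform_within_open[OF _ U Cons.prems(1)])
          (simp add: linear_add[OF lin])
      from has_derivative_unique[OF der this]
      show "D x (v # vs[j := a + b]) = D x (v # vs[j := a]) + D x (v # vs[j := b])" by metis
    next
      fix c :: real and a
      have "((\<lambda>y. c *\<^sub>R D y (vs[j := a])) has_derivative (\<lambda>u. c *\<^sub>R D x (u # vs[j := a]))) (at x)"
        by (intro has_derivative_scaleR_right der)
      then have "((\<lambda>y. D y (vs[j := c *\<^sub>R a])) has_derivative (\<lambda>u. c *\<^sub>R D x (u # vs[j := a]))) (at x)"
        by (rule has_derivative_transform_within_open[OF _ U Cons.prems(1)])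
          (simp add: linear_scale[OF lin])
      from has_derivative_unique[OF der this]
      show "D x (v # vs[j := c *\<^sub>R a]) = c *\<^sub>R D x (v # vs[j := a])" by metis
    qed
  qed
qed simp

lemma jet_bounded_multilinear:
  assumes D: "jet U D" and x: "x \<in> U"
  shows "bounded_multilinear k (D x)"
proof -
  obtain C d where "d > 0" 
    "\<And>y vs. y \<in> ball x d \<Longrightarrow> length vs \<le> k \<Longrightarrow> norm (D y vs) \<le> C * norm_prod vs"
    using jet_bound[OF D x, where k = k] by metis
  then have "\<forall>vs. length vs = k \<longrightarrow> norm (D x vs) \<le> C * norm_prod vs" by simp
  then show ?thesis
    unfolding bounded_multilinear_def using jet_slot_linear[OF D x] by blast
qed

lemma jet_imp_smooth_on:
  assumes D: "jet U D" and f: "\<And>x. x \<in> U \<Longrightarrow> D x [] = f x"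
  shows "smooth_on U f"
  unfolding smooth_on_def
proof (intro conjI exI[of _ "\<lambda>k. D"] ballI allI impI)
  show "open U" using D by (rule jet_open)
qed (use f jet_bounded_multilinear[OF D] jet_uniform_derivative[OF D] in auto)

lemma bounded_multilinear_Cons:
  assumes "bounded_multilinear (Suc k) M"
  shows "bounded_multilinear k (\<lambda>vs. M (v # vs))"
proof -
  obtain C where C: "\<And>vs. length vs = Suc k \<Longrightarrow> norm (M vs) \<le> C * norm_prod vs"
    using assms unfolding bounded_multilinear_def by blast
  have "norm (M (v # vs)) \<le> (C * norm v) * norm_prod vs" if "length vs = k" for vs
    using C[of "v # vs"] that by (simp add: mult_ac)
  moreover have "linear (\<lambda>u. M (v # vs[i := u]))" if "length vs = k" "i < k" for vs i
  proof -
    have "linear (\<lambda>u. M ((v # vs)[Suc i := u]))"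
      using assms that unfolding bounded_multilinear_def
      by (metis Suc_less_eq length_Cons)
    then show ?thesis by simp
  qed
  ultimately show ?thesis
    unfolding bounded_multilinear_def by blast
qed

lemma bounded_multilinear_bound:
  assumes "bounded_multilinear k M"
  obtains C where "C \<ge> 0" "\<And>vs. length vs = k \<Longrightarrow> norm (M vs) \<le> C * norm_prod vs"
proof -
  obtain C where C: "\<And>vs. length vs = k \<Longrightarrow> norm (M vs) \<le> C * norm_prod vs"
    using assms unfolding bounded_multilinear_def by blast
  have "norm (M vs) \<le> max 0 C * norm_prod vs" if "length vs = k" for vs
    by (rule order_trans[OF C[OF that]]) (intro mult_right_mono, auto)
  then show ?thesis using that[of "max 0 C"] by auto
qed

lemma bounded_multilinear_linear_Cons:
  assumes "bounded_multilinear (Suc k) M" "length vs = k"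
  shows "linear (\<lambda>u. M (u # vs))"
proof -
  have "linear (\<lambda>u. M ((0 # vs)[0 := u]))"
    using assms unfolding bounded_multilinear_def by (metis length_Cons zero_less_Suc)
  then show ?thesis by simp
qed

lemma bounded_multilinear_bounded_linear_Cons:
  assumes M: "bounded_multilinear (Suc k) M" and vs: "length vs = k"
  shows "bounded_linear (\<lambda>u. M (u # vs))"
proof -
  obtain C where C: "C \<ge> 0" "\<And>vs. length vs = Suc k \<Longrightarrow> norm (M vs) \<le> C * norm_prod vs"
    using bounded_multilinear_bound[OF M] by blast
  show ?thesis
    unfolding bounded_linear_def bounded_linear_axioms_def
  proof (intro conjI bounded_multilinear_linear_Cons[OF M vs] exI[of _ "C * norm_prod vs"] allI)
    show "norm (M (u # vs)) \<le> norm u * (C * norm_prod vs)" for u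
      using C(2)[of "u # vs"] vs by (simp add: mult_ac)
  qed
qed

lemma bounded_multilinear_add:
  assumes "bounded_multilinear k M" "bounded_multilinear k M'"
  shows "bounded_multilinear k (\<lambda>vs. M vs + M' vs)"
proof -
  obtain C where C: "\<And>vs. length vs = k \<Longrightarrow> norm (M vs) \<le> C * norm_prod vs"
    using bounded_multilinear_bound[OF assms(1)] by blast
  obtain C' where C': "\<And>vs. length vs = k \<Longrightarrow> norm (M' vs) \<le> C' * norm_prod vs"
    using bounded_multilinear_bound[OF assms(2)] by blast
  have "norm (M vs + M' vs) \<le> (C + C') * norm_prod vs" if "length vs = k" for vs
    using C[OF that] C'[OF that] norm_triangle_ineq[of "M vs" "M' vs"]
    by (simp add: distrib_right)
  moreover have "linear (\<lambda>u. M (vs[i := u]) + M' (vs[i := u]))" if "length vs = k" "i < k" for vs i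
    using assms that unfolding bounded_multilinear_def by (simp add: linear_compose_add)
  ultimately show ?thesis unfolding bounded_multilinear_def by blast
qed

lemma smooth_on_imp_jet:
  assumes "smooth_on U f"
  obtains D where "jet U D" "\<And>x. x \<in> U \<Longrightarrow> D x [] = f x"
proof -
  obtain D where U: "open U" and D0: "\<And>x. x \<in> U \<Longrightarrow> D 0 x [] = f x"
    and ml: "\<And>k x. x \<in> U \<Longrightarrow> bounded_multilinear k (D k x)"
    and est: "\<And>k x \<epsilon>. x \<in> U \<Longrightarrow> \<epsilon> > 0 \<Longrightarrow> \<forall>\<^sub>F y in nhds x. \<forall>vs. length vs = k \<longrightarrow>
           norm (D k y vs - D k x vs - D (Suc k) x ((y - x) # vs))
             \<le> \<epsilon> * norm (y - x) * norm_prod vs"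
    using assms unfolding smooth_on_def by blast
  have "jet U (\<lambda>x vs. D (length vs) x vs)"
    unfolding jet_def
  proof (intro conjI ballI allI U)
    fix x vs assume x: "x \<in> U"
    show "((\<lambda>y. D (length vs) y vs) has_derivative (\<lambda>u. D (length (u # vs)) x (u # vs))) (at x)"
      unfolding has_derivative_at_alt
    proof (intro conjI allI impI)
      show "bounded_linear (\<lambda>u. D (length (u # vs)) x (u # vs))"
        using bounded_multilinear_bounded_linear_Cons[OF ml[OF x]] by auto
      fix e :: real assume e: "0 < e"
      define \<epsilon> where "\<epsilon> = e / (1 + norm_prod vs)"
      have np: "0 < 1 + norm_prod vs" using norm_prod_nonneg[of vs] by linarith
      have "\<epsilon> > 0" using e np by (simp add: \<epsilon>_def)
      from est[OF x this, of "length vs"] obtain d where d: "d > 0"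
        "\<And>y. dist y x < d \<Longrightarrow> norm (D (length vs) y vs - D (length vs) x vs - D (Suc (length vs)) x ((y - x) # vs))
             \<le> \<epsilon> * norm (y - x) * norm_prod vs"
        unfolding eventually_nhds_metric by blast
      have "\<epsilon> * norm_prod vs \<le> e"
        using e np by (simp add: \<epsilon>_def field_simps)
      then have "\<epsilon> * norm (y - x) * norm_prod vs \<le> e * norm (y - x)" for y
        using mult_right_mono[of "\<epsilon> * norm_prod vs" e "norm (y - x)"] by (simp add: mult_ac)
      then show "\<exists>d>0. \<forall>y. norm (y - x) < d \<longrightarrow> norm (D (length vs) y vs - D (length vs) x vs
          - D (length ((y - x) # vs)) x ((y - x) # vs)) \<le> e * norm (y - x)"
        using d by (intro exI[of _ d]) (auto simp: dist_norm intro: order_trans)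
    qed
  next
    fix x k assume x: "x \<in> U"
    obtain C where C: "C \<ge> 0" "\<And>vs. length vs = k \<Longrightarrow> norm (D k x vs) \<le> C * norm_prod vs"
      using bounded_multilinear_bound[OF ml[OF x]] by blast
    obtain C' where C': "C' \<ge> 0" "\<And>vs. length vs = Suc k \<Longrightarrow> norm (D (Suc k) x vs) \<le> C' * norm_prod vs"
      using bounded_multilinear_bound[OF ml[OF x]] by blast
    have "\<forall>\<^sub>F y in nhds x. dist y x < 1"
      unfolding eventually_nhds_metric by (intro exI[of _ 1]) auto
    then have "\<forall>\<^sub>F y in nhds x. \<forall>vs. length vs = k \<longrightarrow> norm (D k y vs) \<le> (1 + C' + C) * norm_prod vs"
      using est[OF x zero_less_one, of k]
    proof eventually_elim
      case (elim y)
      show ?case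
      proof (intro allI impI)
        fix vs :: "'a list" assume vs: "length vs = k"
        have yx: "norm (y - x) \<le> 1" using elim(1) by (simp add: dist_norm)
        let ?a = "D k y vs - D k x vs - D (Suc k) x ((y - x) # vs)"
        have "norm ?a \<le> norm (y - x) * norm_prod vs"
          using elim(2) vs by force
        also have "\<dots> \<le> norm_prod vs" using yx by (simp add: mult_left_le_one_le)
        finally have 1: "norm ?a \<le> norm_prod vs" .
        have "norm (D (Suc k) x ((y - x) # vs)) \<le> C' * (norm (y - x) * norm_prod vs)"
          using C'(2)[of "(y - x) # vs"] vs by simp
        also have "\<dots> \<le> C' * norm_prod vs"
          using yx C'(1) by (intro mult_left_mono) (simp_all add: mult_left_le_one_le)
        finally have 2: "norm (D (Suc k) x ((y - x) # vs)) \<le> C' * norm_prod vs" .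
        have "norm (D k y vs) = norm (?a + D k x vs + D (Suc k) x ((y - x) # vs))" by simp
        also have "\<dots> \<le> norm ?a + norm (D k x vs) + norm (D (Suc k) x ((y - x) # vs))"
          by (meson norm_triangle_le norm_triangle_ineq add_mono order_refl)
        finally show "norm (D k y vs) \<le> (1 + C' + C) * norm_prod vs"
          using 1 2 C(2)[OF vs] by (simp add: algebra_simps)
      qed
    qed
    then show "\<exists>C. \<forall>\<^sub>F y in nhds x. \<forall>vs. length vs = k \<longrightarrow> norm (D (length vs) y vs) \<le> C * norm_prod vs"
      by (intro exI[of _ "1 + C' + C"]) (auto elim: eventually_mono)
  qed
  then show ?thesis using that D0 by fastforce
qed

section \<open>Elementary smooth maps and the chain rule\<close>

lemma smooth_on_open: "smooth_on U f \<Longrightarrow> open U"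
  by (simp add: smooth_on_def)

lemma smooth_on_subset_cong:
  assumes "smooth_on U f" "open T" "T \<subseteq> U" "\<And>x. x \<in> T \<Longrightarrow> f x = g x"
  shows "smooth_on T g"
proof -
  obtain D where "jet U D" "\<And>x. x \<in> U \<Longrightarrow> D x [] = f x"
    using smooth_on_imp_jet[OF assms(1)] by blast
  then have "jet T D" "\<And>x. x \<in> T \<Longrightarrow> D x [] = g x"
    using assms by (auto simp: jet_def subset_iff)
  then show ?thesis by (rule jet_imp_smooth_on)
qed

lemma smooth_on_differentiable:
  assumes "smooth_on U f" "x \<in> U"
  shows "f differentiable (at x)"
proof -
  obtain D where D: "jet U D" "\<And>x. x \<in> U \<Longrightarrow> D x [] = f x"
    using smooth_on_imp_jet[OF assms(1)] by blast
  have "(f has_derivative (\<lambda>u. D x [u])) (at x)"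
    using has_derivative_transform_within_open[OF jet_has_derivative[OF D(1) assms(2), of "[]"]
        smooth_on_open[OF assms(1)] assms(2) D(2)] .
  then show ?thesis by (auto simp: differentiable_def)
qed

lemma smooth_on_has_derivative:
  assumes "smooth_on U f" "x \<in> U"
  shows "(f has_derivative frechet_derivative f (at x)) (at x)"
  using smooth_on_differentiable[OF assms] frechet_derivative_works by blast

lemma smooth_on_continuous_on:
  assumes "smooth_on U f"
  shows "continuous_on U f"
  using has_derivative_continuous[OF smooth_on_has_derivative[OF assms]]
  by (simp add: continuous_at_imp_continuous_on)

text \<open>The jet of a directional derivative is the given jet with the direction appended to every list.\<close>

lemma smooth_on_directional:
  assumes "smooth_on U f"
  shows "smooth_on U (\<lambda>x. frechet_derivative f (at x) w)"
proof -
  obtain D where D: "jet U D" "\<And>x. x \<in> U \<Longrightarrow> D x [] = f x"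
    using smooth_on_imp_jet[OF assms] by blast
  have "jet U (\<lambda>x vs. D x (vs @ [w]))"
    unfolding jet_def
  proof (intro conjI ballI allI)
    fix x k assume x: "x \<in> U"
    show "((\<lambda>y. D y (vs @ [w])) has_derivative (\<lambda>u. D x ((u # vs) @ [w]))) (at x)" for vs
      using jet_has_derivative[OF D(1) x, of "vs @ [w]"] by simp
    obtain C where C: "\<forall>\<^sub>F y in nhds x. \<forall>vs. length vs = Suc k \<longrightarrow> norm (D y vs) \<le> C * norm_prod vs"
      using D(1) x unfolding jet_def by blast
    then have "\<forall>\<^sub>F y in nhds x. \<forall>vs. length vs = k \<longrightarrow> norm (D y (vs @ [w])) \<le> (C * norm w) * norm_prod vs"
    proof eventually_elim
      case (elim y)
      show ?case
      proof (intro allI impI)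
        fix vs :: "'a list" assume "length vs = k"
        then show "norm (D y (vs @ [w])) \<le> (C * norm w) * norm_prod vs"
          using elim[rule_format, of "vs @ [w]"] by (simp add: mult_ac)
      qed
    qed
    then show "\<exists>C. \<forall>\<^sub>F y in nhds x. \<forall>vs. length vs = k \<longrightarrow> norm (D y (vs @ [w])) \<le> C * norm_prod vs"
      by blast
  qed (use D(1) in \<open>auto dest: jet_open\<close>)
  then show ?thesis
  proof (rule jet_imp_smooth_on)
    fix x assume x: "x \<in> U"
    have "(f has_derivative (\<lambda>u. D x [u])) (at x)"
      using has_derivative_transform_within_open[OF jet_has_derivative[OF D(1) x, of "[]"]
          smooth_on_open[OF assms] x D(2)] .
    then have "(\<lambda>u. D x [u]) = frechet_derivative f (at x)" by (rule frechet_derivative_at)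
    then show "D x ([] @ [w]) = frechet_derivative f (at x) w" by (metis append_Nil)
  qed
qed

lemma smooth_on_const: "open U \<Longrightarrow> smooth_on U (\<lambda>x. c)"
proof (rule jet_imp_smooth_on[where D = "\<lambda>x vs. if vs = [] then c else 0"])
  assume "open U"
  moreover have "norm (if vs = [] then c else 0) \<le> norm c * norm_prod vs" for vs :: "'a list"
    by (cases vs) auto
  ultimately show "jet U (\<lambda>x vs. if vs = [] then c else 0)"
    unfolding jet_def by (auto intro!: exI[of _ "norm c"])
qed simp

lemma smooth_on_linear:
  assumes U: "open U" and L: "bounded_linear L"
  shows "smooth_on U L"
proof (rule jet_imp_smooth_on[where D = "\<lambda>x vs. case vs of [] \<Rightarrow> L x | [u] \<Rightarrow> L u | _ \<Rightarrow> 0"])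
  interpret bounded_linear L by fact
  let ?D = "\<lambda>x vs. case vs of [] \<Rightarrow> L x | [u] \<Rightarrow> L u | _ \<Rightarrow> 0"
  obtain K where K: "0 < K" "\<And>x. norm (L x) \<le> norm x * K" using pos_bounded by blast
  show "jet U ?D" unfolding jet_def
  proof (intro conjI ballI allI U)
    fix x and vs :: "'a list"
    consider "vs = []" | u us where "vs = u # us" by (cases vs)
    then show "((\<lambda>y. ?D y vs) has_derivative (\<lambda>u. ?D x (u # vs))) (at x)"
    proof cases
      case 1
      then show ?thesis by (simp add: bounded_linear_imp_has_derivative L)
    next
      case 2
      then show ?thesis by (cases us) auto
    qed
  next
    fix x :: 'a and k :: nat
    have "\<forall>\<^sub>F y in nhds x. dist y x < 1"
      unfolding eventually_nhds_metric by (intro exI[of _ 1]) auto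
    then have "\<forall>\<^sub>F y in nhds x. \<forall>vs. length vs = k \<longrightarrow> norm (?D y vs) \<le> K * (norm x + 1) * norm_prod vs"
    proof eventually_elim
      case (elim y)
      have y: "norm y \<le> norm x + 1"
        using elim norm_triangle_ineq2[of y x] by (simp add: dist_norm)
      show ?case
      proof (intro allI impI)
        fix vs :: "'a list"
        have "norm (L y) \<le> K * (norm x + 1)"
          using order_trans[OF K(2)[of y] mult_right_mono[OF y, of K]] K(1) by (simp add: mult.commute[of _ K])
        moreover have "norm (L u) \<le> K * (norm x + 1) * norm u" for u
          using order_trans[OF K(2)[of u] mult_left_mono[of 1 "norm x + 1" "norm u * K", simplified]] K(1)
          by (simp add: mult_ac)
        ultimately show "norm (?D y vs) \<le> K * (norm x + 1) * norm_prod vs"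
          using K(1) by (auto split: list.split)
      qed
    qed
    then show "\<exists>C. \<forall>\<^sub>F y in nhds x. \<forall>vs. length vs = k \<longrightarrow> norm (?D y vs) \<le> C * norm_prod vs"
      by blast
  qed
qed simp

lemma smooth_on_bilinear:
  fixes B :: "'e::real_normed_vector \<Rightarrow> 'f::real_normed_vector \<Rightarrow> 'g::real_normed_vector"
  assumes B: "bounded_bilinear B"
  shows "smooth_on UNIV (\<lambda>p. B (fst p) (snd p))"
proof -
  interpret bounded_bilinear B by fact
  define D where "D = (\<lambda>p vs. case vs of [] \<Rightarrow> B (fst p) (snd p)
    | [u] \<Rightarrow> B (fst u) (snd p) + B (fst p) (snd u)
    | [u, v] \<Rightarrow> B (fst u) (snd v) + B (fst v) (snd u)
    | _ \<Rightarrow> 0)"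
  have Ds: "D p [] = B (fst p) (snd p)" "D p [u] = B (fst u) (snd p) + B (fst p) (snd u)"
    "D p [u, v] = B (fst u) (snd v) + B (fst v) (snd u)" "D p (u # v # w # ws) = 0" for p u v w ws
    by (simp_all add: D_def)
  obtain K where K: "0 < K" "\<And>x y. norm (B x y) \<le> norm x * norm y * K"
    using pos_bounded by blast
  have B2: "norm (B (fst u) (snd v)) \<le> K * norm u * norm v" for u v
  proof -
    have "norm (fst u) * norm (snd v) * K \<le> norm u * norm v * K"
      using K(1) norm_fst_le[of "fst u" "snd u"] norm_snd_le[of "snd v" "fst v"] by (intro mult_mono) auto
    then show ?thesis using K(2)[of "fst u" "snd v"] by (simp add: mult_ac)
  qed
  have "jet UNIV D" unfolding jet_def
  proof (intro conjI ballI allI)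
    fix x and vs :: "('e \<times> 'f) list"
    consider "vs = []" | u where "vs = [u]" | u v where "vs = [u,v]" | u v w ws where "vs = u#v#w#ws"
      by (metis neq_Nil_conv)
    then show "((\<lambda>y. D y vs) has_derivative (\<lambda>u. D x (u # vs))) (at x)"
    proof cases
      case 1
      show ?thesis unfolding 1 Ds
        by (rule has_derivative_eq_rhs[OF FDERIV[OF has_derivative_fst[OF has_derivative_ident] has_derivative_snd[OF has_derivative_ident]]])
          (simp add: add.commute)
    next
      case (2 w)
      show ?thesis unfolding 2 Ds
        by (rule has_derivative_eq_rhs[OF has_derivative_add[OF 
           bounded_linear.has_derivative[OF bounded_linear_right has_derivative_snd[OF has_derivative_ident]] 
            bounded_linear.has_derivative[OF bounded_linear_left has_derivative_fst[OF has_derivative_ident]]]])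
          (simp add: add.commute)
    next
      case 3 
      show ?thesis unfolding 3 Ds by simp
    next
      case 4
      show ?thesis unfolding 4 Ds by simp
    qed
  next
    fix x :: "'e \<times> 'f" and k :: nat
    define R where "R = norm x + 1"
    have R1: "R \<ge> 1" by (simp add: R_def)
    have R2: "1 \<le> R * R" "R \<le> R * R" using R1 mult_mono[OF R1 R1] mult_mono[OF R1, of R R] by auto
    have "\<forall>\<^sub>F y in nhds x. dist y x < 1"
      unfolding eventually_nhds_metric by (intro exI[of _ 1]) auto
    then have "\<forall>\<^sub>F y in nhds x. \<forall>vs. length vs = k \<longrightarrow> norm (D y vs) \<le> (2 * K * (R * R)) * norm_prod vs"
    proof eventually_elim
      case (elim y)
      have y: "norm y \<le> R"
        using elim norm_triangle_ineq2[of y x] by (simp add: dist_norm R_def)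
      have 0: "norm (D y []) \<le> 2 * K * (R * R)"
      proof -
        have "norm y * norm y \<le> R * R" by (intro mult_mono y) (use R1 in auto)
        then have "K * (norm y * norm y) \<le> K * (2 * (R * R))" using R2 K(1) by (intro mult_left_mono) auto
        then show ?thesis using B2[of y y] by (simp add: Ds mult_ac)
      qed
      have 1: "norm (D y [u]) \<le> 2 * K * (R * R) * norm u" for u
      proof -
        have "norm (D y [u]) \<le> 2 * K * norm y * norm u"
          using norm_triangle_ineq[of "B (fst u) (snd y)" "B (fst y) (snd u)"] B2[of u y] B2[of y u]
          by (simp add: Ds mult_ac)
        also have "\<dots> \<le> 2 * K * (R * R) * norm u"
          using y R2 K(1) by (intro mult_right_mono mult_left_mono) auto
        finally show ?thesis .
      qed
      have 2: "norm (D y [u, v]) \<le> 2 * K * (R * R) * (norm u * norm v)" for u v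
      proof -
        have "norm (D y [u, v]) \<le> 2 * K * 1 * (norm u * norm v)"
          using norm_triangle_ineq[of "B (fst u) (snd v)" "B (fst v) (snd u)"] B2[of u v] B2[of v u]
          by (simp add: Ds mult_ac)
        also have "\<dots> \<le> 2 * K * (R * R) * (norm u * norm v)"
          using R2 K(1) by (intro mult_right_mono mult_left_mono) auto
        finally show ?thesis .
      qed
      show ?case
      proof (intro allI impI)
        fix vs :: "('e \<times> 'f) list"
        consider "vs = []" | u where "vs = [u]" | u v where "vs = [u,v]" | u v w ws where "vs = u#v#w#ws"
          by (metis neq_Nil_conv)
        then show "norm (D y vs) \<le> (2 * K * (R * R)) * norm_prod vs"
          by cases (use 0 1 2 K(1) R2 in \<open>auto simp: Ds\<close>)
      qed
    qed
    then show "\<exists>C. \<forall>\<^sub>F y in nhds x. \<forall>vs. length vs = k \<longrightarrow> norm (D y vs) \<le> C * norm_prod vs"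
      by blast
  qed auto
  then show ?thesis
    by (rule jet_imp_smooth_on) (simp add: Ds)
qed

lemma smooth_on_Pair:
  assumes f: "smooth_on U f" and g: "smooth_on U g"
  shows "smooth_on U (\<lambda>x. (f x, g x))"
proof -
  obtain D where D: "jet U D" "\<And>x. x \<in> U \<Longrightarrow> D x [] = f x"
    using smooth_on_imp_jet[OF f] by blast
  obtain E where E: "jet U E" "\<And>x. x \<in> U \<Longrightarrow> E x [] = g x"
    using smooth_on_imp_jet[OF g] by blast
  have "jet U (\<lambda>x vs. (D x vs, E x vs))"
    unfolding jet_def
  proof (intro conjI ballI allI)
    fix x k assume x: "x \<in> U"
    show "((\<lambda>y. (D y vs, E y vs)) has_derivative (\<lambda>u. (D x (u # vs), E x (u # vs)))) (at x)" for vs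
      by (intro has_derivative_Pair jet_has_derivative[OF D(1) x] jet_has_derivative[OF E(1) x])
    obtain C where C: "\<forall>\<^sub>F y in nhds x. \<forall>vs. length vs = k \<longrightarrow> norm (D y vs) \<le> C * norm_prod vs"
      using D(1) x unfolding jet_def by blast
    obtain C' where C': "\<forall>\<^sub>F y in nhds x. \<forall>vs. length vs = k \<longrightarrow> norm (E y vs) \<le> C' * norm_prod vs"
      using E(1) x unfolding jet_def by blast
    from C C' have "\<forall>\<^sub>F y in nhds x. \<forall>vs. length vs = k \<longrightarrow> norm (D y vs, E y vs) \<le> (C + C') * norm_prod vs"
    proof eventually_elim
      case (elim y)
      then show ?case
        by (smt (verit) distrib_right norm_Pair_le)
    qed
    then show "\<exists>C. \<forall>\<^sub>F y in nhds x. \<forall>vs. length vs = k \<longrightarrow> norm (D y vs, E y vs) \<le> C * norm_prod vs"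
      by blast
  qed (use D(1) in \<open>auto dest: jet_open\<close>)
  then show ?thesis by (rule jet_imp_smooth_on) (simp add: D E)
qed

text \<open>The partitions of a list into blocks index the terms of an iterated derivative of a composite
\<open>g \<circ> f\<close>: a block collects the directions in which one factor \<open>f\<close> is differentiated, the number
of blocks is the order of the derivative of \<open>g\<close>.  A further differentiation in the direction \<open>v\<close>
either hits \<open>g\<close>, which opens the block \<open>[v]\<close>, or it hits one of the factors, which adds
\<open>v\<close> to its block.\<close>

fun parts :: "'a list \<Rightarrow> 'a list list list" where
  "parts [] = [[]]"
| "parts (v # vs) =
     concat (map (\<lambda>P. ([v] # P) # map (\<lambda>i. P[i := v # P ! i]) [0..<length P]) (parts vs))"

lemma prod_list_update:
  fixes xs :: "'a::comm_monoid_mult list"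
  shows "i < length xs \<Longrightarrow> prod_list (xs[i := c * xs ! i]) = c * prod_list xs"
proof (induction xs arbitrary: i)
  case (Cons a xs)
  then show ?case by (cases i) (auto simp: mult_ac)
qed simp

lemma parts_props:
  assumes "P \<in> set (parts vs)"
  shows "length P \<le> length vs \<and> (\<forall>B\<in>set P. length B \<le> length vs)
    \<and> prod_list (map norm_prod P) = norm_prod vs"
  using assms
proof (induction vs arbitrary: P)
  case (Cons v vs)
  then have "\<exists>Q\<in>set (parts vs). P = [v] # Q \<or> (\<exists>i<length Q. P = Q[i := v # Q ! i])"
    by (simp add: image_iff) (metis atLeastLessThan_iff)
  then obtain Q where Q: "Q \<in> set (parts vs)"
    and P: "P = [v] # Q \<or> (\<exists>i<length Q. P = Q[i := v # Q ! i])" by blast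
  note IH = Cons.IH[OF Q]
  from P show ?case
  proof
    assume "P = [v] # Q"
    then show ?thesis using IH by auto
  next
    assume "\<exists>i<length Q. P = Q[i := v # Q ! i]"
    then obtain i where i: "i < length Q" "P = Q[i := v # Q ! i]" by blast
    have "set P \<subseteq> insert (v # Q ! i) (set Q)" using i by (simp add: set_update_subset_insert)
    moreover have "Q ! i \<in> set Q" using i by simp
    ultimately have "\<forall>B\<in>set P. length B \<le> length (v # vs)" using IH by force
    moreover have "prod_list (map norm_prod P) = norm v * prod_list (map norm_prod Q)"
      using prod_list_update[of i "map norm_prod Q" "norm v"] i by (simp add: map_update)
    ultimately show ?thesis using IH i by auto
  qed
qed simp

lemma length_parts_le: "length (parts (vs::'a::real_normed_vector list)) \<le> fact (length vs)"
proof (induction vs)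
  case (Cons v vs)
  have "length (parts (v # vs)) = (\<Sum>P\<leftarrow>parts vs. Suc (length P))"
    by (simp add: length_concat comp_def)
  also have "\<dots> \<le> (\<Sum>P\<leftarrow>parts vs. Suc (length vs))"
    by (intro sum_list_mono) (simp add: parts_props)
  also have "\<dots> = Suc (length vs) * length (parts vs)"
    by (simp add: sum_list_triv)
  also have "\<dots> \<le> Suc (length vs) * fact (length vs)"
    using Cons by (intro mult_left_mono) auto
  finally show ?case by simp
qed simp

text \<open>The product rule for \<open>N y (h\<^sub>1 y, \<dots>, h\<^sub>m y)\<close>, where the multilinear map depends on \<open>y\<close>, too.  This
dependence is what makes the induction on \<open>m\<close> work: inserting \<open>h\<^sub>1 y\<close> into the first slot
leaves a family of \<open>(m - 1)\<close>-linear maps of the same kind.\<close>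

lemma bounded_multilinear_product_rule:
  fixes N :: "'e::real_normed_vector \<Rightarrow> 'f::real_normed_vector list \<Rightarrow> 'g::real_normed_vector"
    and N' :: "'e \<Rightarrow> 'f list \<Rightarrow> 'g"
  assumes "\<And>B. B \<in> set P \<Longrightarrow> (h B has_derivative h' B) (at x)"
    and "bounded_multilinear (length P) (N x)"
    and "\<And>u. bounded_multilinear (length P) (N' u)"
    and "\<And>vs. length vs = length P \<Longrightarrow> linear (\<lambda>u. N' u vs)"
    and "\<exists>C. \<forall>u vs. length vs = length P \<longrightarrow> norm (N' u vs) \<le> C * norm u * norm_prod vs"
    and "\<And>\<epsilon>. \<epsilon> > 0 \<Longrightarrow> \<forall>\<^sub>F y in nhds x. \<forall>vs. length vs = length P \<longrightarrow>
      norm (N y vs - N x vs - N' (y - x) vs) \<le> \<epsilon> * norm (y - x) * norm_prod vs"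
  shows "((\<lambda>y. N y (map (\<lambda>B. h B y) P)) has_derivative
     (\<lambda>u. N' u (map (\<lambda>B. h B x) P)
       + (\<Sum>i<length P. N x ((map (\<lambda>B. h B x) P)[i := h' (P ! i) u])))) (at x)"
  using assms
proof (induction P arbitrary: N N')
  case Nil
  from Nil.prems(5) obtain C where C: "\<And>u. norm (N' u []) \<le> C * norm u" by auto
  have bl: "bounded_linear (\<lambda>u. N' u [])"
    unfolding bounded_linear_def bounded_linear_axioms_def
    using Nil.prems(4)[of "[]"] C by (auto simp: mult.commute)
  have "((\<lambda>y. N y []) has_derivative (\<lambda>u. N' u [])) (at x)"
    unfolding has_derivative_at_alt
  proof (intro conjI bl allI impI)
    fix e :: real assume "e > 0"
    from Nil.prems(6)[OF this] show "\<exists>d>0. \<forall>y. norm (y - x) < d \<longrightarrow> norm (N y [] - N x [] - N' (y - x) []) \<le> e * norm (y - x)"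
      by (auto simp: eventually_nhds_metric dist_norm)
  qed
  then show ?case by simp
next
  case (Cons B P)
  let ?m = "length P"
  \<comment> \<open>The family with the first argument inserted, and its derivative.\<close>
  define M where "M = (\<lambda>y ws. N y (h B y # ws))"
  define M' where "M' = (\<lambda>u ws. N' u (h B x # ws) + N x (h' B u # ws))"
  have hB: "(h B has_derivative h' B) (at x)" using Cons.prems(1) by simp
  have blh: "bounded_linear (h' B)" using hB by (rule has_derivative_bounded_linear)
  obtain K where K: "K > 0" "\<And>u. norm (h' B u) \<le> K * norm u"
    using bounded_linear.pos_bounded[OF blh] by (metis mult.commute)
  obtain C where C: "C \<ge> 0" "\<And>vs. length vs = Suc ?m \<Longrightarrow> norm (N x vs) \<le> C * norm_prod vs"
    using bounded_multilinear_bound[OF Cons.prems(2)] by auto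
  obtain C0 where C0: "\<And>u vs. length vs = Suc ?m \<Longrightarrow> norm (N' u vs) \<le> C0 * norm u * norm_prod vs"
    using Cons.prems(5) by auto
  define C' where "C' = max 0 C0"
  have C': "C' \<ge> 0" "\<And>u vs. length vs = Suc ?m \<Longrightarrow> norm (N' u vs) \<le> C' * norm u * norm_prod vs"
  proof -
    fix u :: 'e and vs :: "'f list" assume "length vs = Suc ?m"
    then have "norm (N' u vs) \<le> C0 * norm u * norm_prod vs" by (rule C0)
    also have "\<dots> \<le> C' * norm u * norm_prod vs"
      by (intro mult_right_mono) (auto simp: C'_def)
    finally show "norm (N' u vs) \<le> C' * norm u * norm_prod vs" .
  qed (simp add: C'_def)
  have N1: "bounded_multilinear (Suc ?m) (N x)" and N2: "\<And>u. bounded_multilinear (Suc ?m) (N' u)"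
    using Cons.prems(2,3) by auto
  have "((\<lambda>y. M y (map (\<lambda>B. h B y) P)) has_derivative
     (\<lambda>u. M' u (map (\<lambda>B. h B x) P)
       + (\<Sum>i<length P. M x ((map (\<lambda>B. h B x) P)[i := h' (P ! i) u])))) (at x)"
  proof (rule Cons.IH)
    show "(h b has_derivative h' b) (at x)" if "b \<in> set P" for b
      using Cons.prems(1) that by simp
    show "bounded_multilinear ?m (M x)"
      unfolding M_def by (rule bounded_multilinear_Cons[OF N1])
    show "bounded_multilinear ?m (M' u)" for u
      unfolding M'_def by (intro bounded_multilinear_add bounded_multilinear_Cons N1 N2)
    show "linear (\<lambda>u. M' u vs)" if vs: "length vs = ?m" for vs
    proof -
      have "linear (\<lambda>u. N' u (h B x # vs))" using Cons.prems(4)[of "h B x # vs"] vs by simp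
      moreover have "linear (\<lambda>u. N x (h' B u # vs))"
        using linear_compose[OF bounded_linear.linear[OF blh] bounded_multilinear_linear_Cons[OF N1 vs]]
        by (simp add: comp_def)
      ultimately show ?thesis unfolding M'_def by (rule linear_compose_add)
    qed
    show "\<exists>C. \<forall>u vs. length vs = ?m \<longrightarrow> norm (M' u vs) \<le> C * norm u * norm_prod vs"
    proof (intro exI allI impI)
      fix u and vs :: "'f list" assume vs: "length vs = ?m"
      have "norm (N x (h' B u # vs)) \<le> C * (K * norm u * norm_prod vs)"
        using C(2)[of "h' B u # vs"] vs mult_left_mono[OF mult_right_mono[OF K(2)[of u] norm_prod_nonneg[of vs]] C(1)]
        by simp
      moreover have "norm (N' u (h B x # vs)) \<le> C' * norm u * (norm (h B x) * norm_prod vs)"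
        using C'(2)[of "h B x # vs" u] vs by simp
      ultimately show "norm (M' u vs) \<le> (C' * norm (h B x) + C * K) * norm u * norm_prod vs"
        unfolding M'_def
        using norm_triangle_ineq[of "N' u (h B x # vs)" "N x (h' B u # vs)"] by (simp add: algebra_simps)
    qed
    fix \<epsilon> :: real assume \<epsilon>: "\<epsilon> > 0"
    \<comment> \<open>The three summands bound the contributions of the remainder of \<open>N\<close>, of the increment of
        \<open>h B\<close> inside \<open>N'\<close>, and of the remainder of \<open>h B\<close>.\<close>
    define S where "S = (norm (h B x) + 1) + C' + C"
    have S: "S > 0" using C(1) C'(1) norm_ge_zero[of "h B x"] unfolding S_def by linarith
    define e where "e = min 1 (\<epsilon> / S)"
    have e: "e > 0" "e \<le> 1" "e * S \<le> \<epsilon>" using \<epsilon> S by (auto simp: e_def min_def field_simps)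
    have "\<forall>\<^sub>F y in nhds x. norm (h B y - h B x - h' B (y - x)) \<le> e * norm (y - x)"
      using hB e(1) unfolding has_derivative_at_alt eventually_nhds_metric by (auto simp: dist_norm)
    moreover have "\<forall>\<^sub>F y in nhds x. norm (h B y - h B x) \<le> e"
    proof -
      have "isCont (h B) x" using hB by (rule has_derivative_continuous)
      then have "\<forall>\<^sub>F y in nhds x. dist (h B y) (h B x) < e"
        unfolding continuous_at eventually_nhds_metric LIM_def using e(1)
        by (metis dist_self)
      then show ?thesis by eventually_elim (simp add: dist_norm)
    qed
    moreover have "\<forall>\<^sub>F y in nhds x. \<forall>vs. length vs = Suc ?m \<longrightarrow>
      norm (N y vs - N x vs - N' (y - x) vs) \<le> e * norm (y - x) * norm_prod vs"
      using Cons.prems(6)[OF e(1)] by simp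
    ultimately show "\<forall>\<^sub>F y in nhds x. \<forall>vs. length vs = ?m \<longrightarrow>
      norm (M y vs - M x vs - M' (y - x) vs) \<le> \<epsilon> * norm (y - x) * norm_prod vs"
    proof eventually_elim
      case (elim y)
      show ?case
      proof (intro allI impI)
        fix vs :: "'f list" assume vs: "length vs = ?m"
        let ?u = "y - x" and ?p = "norm_prod vs" and ?w = "h B y"
        have lin1: "linear (\<lambda>v. N x (v # vs))" by (rule bounded_multilinear_linear_Cons[OF N1 vs])
        have lin2: "linear (\<lambda>v. N' ?u (v # vs))" by (rule bounded_multilinear_linear_Cons[OF N2 vs])
        let ?a = "N y (?w # vs) - N x (?w # vs) - N' ?u (?w # vs)"
        let ?b = "N' ?u ((?w - h B x) # vs)" and ?c = "N x ((?w - h B x - h' B ?u) # vs)"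
        have eq: "M y vs - M x vs - M' ?u vs = ?a + ?b + ?c"
          unfolding M_def M'_def linear_diff[OF lin1] linear_diff[OF lin2] by simp
        have w: "norm ?w \<le> norm (h B x) + 1"
          using elim(2) e(2) norm_triangle_ineq2[of ?w "h B x"] by linarith
        have "norm ?a \<le> e * norm ?u * (norm ?w * ?p)"
          using elim(3) vs by (metis (no_types, lifting) length_Cons list.simps(9) prod_list.Cons)
        also have "\<dots> \<le> e * norm ?u * ((norm (h B x) + 1) * ?p)"
          using w e(1) by (intro mult_left_mono mult_right_mono) auto
        finally have a: "norm ?a \<le> e * norm ?u * ((norm (h B x) + 1) * ?p)" .
        have "norm ?b \<le> C' * norm ?u * (norm (?w - h B x) * ?p)"
          using C'(2)[of "(?w - h B x) # vs" ?u] vs by simp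
        also have "\<dots> \<le> C' * norm ?u * (e * ?p)"
          using elim(2) C'(1) by (intro mult_left_mono mult_right_mono) auto
        finally have b: "norm ?b \<le> C' * norm ?u * (e * ?p)" .
        have "norm ?c \<le> C * (norm (?w - h B x - h' B ?u) * ?p)"
          using C(2)[of "(?w - h B x - h' B ?u) # vs"] vs by simp
        also have "\<dots> \<le> C * ((e * norm ?u) * ?p)"
          using elim(1) C(1) by (intro mult_left_mono mult_right_mono) auto
        finally have c: "norm ?c \<le> C * ((e * norm ?u) * ?p)" .
        have "norm (?a + ?b + ?c) \<le> norm ?a + norm ?b + norm ?c"
          by (meson norm_triangle_le norm_triangle_ineq add_mono order_refl)
        also have "\<dots> \<le> (e * S) * (norm ?u * ?p)"
          using a b c by (simp add: S_def algebra_simps)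
        also have "\<dots> \<le> \<epsilon> * (norm ?u * ?p)" using e(3) by (intro mult_right_mono) auto
        finally show "norm (M y vs - M x vs - M' ?u vs) \<le> \<epsilon> * norm ?u * ?p"
          unfolding eq by (simp add: mult_ac)
      qed
    qed
  qed
  then show ?case
    by (simp add: M_def M'_def sum.lessThan_Suc_shift add_ac del: sum.lessThan_Suc)
qed

lemma has_derivative_sum_list:
  assumes "\<And>P. P \<in> set Ps \<Longrightarrow> (F P has_derivative F' P) (at x)"
  shows "((\<lambda>y. \<Sum>P\<leftarrow>Ps. F P y) has_derivative (\<lambda>u. \<Sum>P\<leftarrow>Ps. F' P u)) (at x)"
  using assms by (induction Ps) (auto intro!: has_derivative_add)

lemma sum_list_concat_map: "sum_list (map f (concat xss)) = (\<Sum>xs\<leftarrow>xss. sum_list (map f xs))"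
  by (induction xss) auto

text \<open>The case of the product rule in which the multilinear map is a derivative of a smooth map, taken
at a moving point.\<close>

lemma jet_multilinear_chain:
  fixes G :: "'f::real_normed_vector \<Rightarrow> 'f list \<Rightarrow> 'g::real_normed_vector"
    and z :: "'e::real_normed_vector \<Rightarrow> 'f"
  assumes G: "jet T G" and zT: "z x \<in> T" and z: "(z has_derivative z') (at x)"
    and h: "\<And>B. B \<in> set P \<Longrightarrow> (h B has_derivative h' B) (at x)"
  shows "((\<lambda>y. G (z y) (map (\<lambda>B. h B y) P)) has_derivative
     (\<lambda>u. G (z x) (z' u # map (\<lambda>B. h B x) P)
       + (\<Sum>i<length P. G (z x) ((map (\<lambda>B. h B x) P)[i := h' (P ! i) u])))) (at x)"
proof -
  let ?m = "length P"
  obtain K where K: "K > 0" "\<And>u. norm (z' u) \<le> K * norm u"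
    using bounded_linear.pos_bounded[OF has_derivative_bounded_linear[OF z]] by (metis mult.commute)
  note ml = jet_bounded_multilinear[OF G zT]
  obtain C where C: "C \<ge> 0" "\<And>vs. length vs = Suc ?m \<Longrightarrow> norm (G (z x) vs) \<le> C * norm_prod vs"
    using bounded_multilinear_bound[OF ml] by blast
  show ?thesis
  proof (rule bounded_multilinear_product_rule[where N = "\<lambda>y. G (z y)" and N' = "\<lambda>u ws. G (z x) (z' u # ws)"])
    show "(h B has_derivative h' B) (at x)" if "B \<in> set P" for B by (rule h[OF that])
    show "bounded_multilinear ?m (G (z x))" by (rule ml)
    show "bounded_multilinear ?m (\<lambda>ws. G (z x) (z' u # ws))" for u
      by (rule bounded_multilinear_Cons[OF ml])
    show "linear (\<lambda>u. G (z x) (z' u # vs))" if "length vs = ?m" for vs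
      using linear_compose[OF has_derivative_linear[OF z] bounded_multilinear_linear_Cons[OF ml that]]
      by (simp add: comp_def)
    show "\<exists>C. \<forall>u vs. length vs = ?m \<longrightarrow> norm (G (z x) (z' u # vs)) \<le> C * norm u * norm_prod vs"
    proof (intro exI allI impI)
      fix u and vs :: "'f list" assume "length vs = ?m"
      then have "norm (G (z x) (z' u # vs)) \<le> C * (norm (z' u) * norm_prod vs)"
        using C(2)[of "z' u # vs"] by simp
      also have "\<dots> \<le> C * ((K * norm u) * norm_prod vs)"
        using C(1) K(2) by (intro mult_left_mono mult_right_mono) auto
      finally show "norm (G (z x) (z' u # vs)) \<le> (C * K) * norm u * norm_prod vs" by (simp add: mult_ac)
    qed
    fix \<epsilon> :: real assume \<epsilon>: "\<epsilon> > 0"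
    define S where "S = (K + 1) + C"
    have S: "S > 0" using C(1) K(1) unfolding S_def by linarith
    define e where "e = min 1 (\<epsilon> / S)"
    have e: "e > 0" "e \<le> 1" "e * S \<le> \<epsilon>" using \<epsilon> S by (auto simp: e_def min_def field_simps)
    have 1: "\<forall>\<^sub>F y in nhds x. norm (z y - z x - z' (y - x)) \<le> e * norm (y - x)"
      using z e(1) unfolding has_derivative_at_alt eventually_nhds_metric by (auto simp: dist_norm)
    have "filterlim (\<lambda>y. z y) (nhds (z x)) (nhds x)"
      using has_derivative_continuous[OF z] by (simp add: continuous_at tendsto_nhds_iff)
    from eventually_compose_filterlim[OF jet_uniform_derivative[OF G zT e(1), of ?m] this]
    have 2: "\<forall>\<^sub>F y in nhds x. \<forall>vs. length vs = ?m \<longrightarrow>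
      norm (G (z y) vs - G (z x) vs - G (z x) ((z y - z x) # vs)) \<le> e * norm (z y - z x) * norm_prod vs" .
    from 1 2 show "\<forall>\<^sub>F y in nhds x. \<forall>vs. length vs = ?m \<longrightarrow>
      norm (G (z y) vs - G (z x) vs - G (z x) (z' (y - x) # vs)) \<le> \<epsilon> * norm (y - x) * norm_prod vs"
    proof eventually_elim
      case (elim y)
      show ?case
      proof (intro allI impI)
        fix vs :: "'f list" assume vs: "length vs = ?m"
        let ?u = "y - x" and ?p = "norm_prod vs" and ?r = "z y - z x - z' (y - x)"
        have lin: "linear (\<lambda>v. G (z x) (v # vs))" by (rule bounded_multilinear_linear_Cons[OF ml vs])
        let ?a = "G (z y) vs - G (z x) vs - G (z x) ((z y - z x) # vs)"
        have eq: "G (z y) vs - G (z x) vs - G (z x) (z' (y - x) # vs) = ?a + G (z x) (?r # vs)"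
          unfolding linear_diff[OF lin] by simp
        have "norm (z y - z x) \<le> norm ?r + norm (z' ?u)"
          using norm_triangle_ineq[of ?r "z' ?u"] by simp
        also have "\<dots> \<le> (K + 1) * norm ?u"
          using elim(1) K(2)[of ?u] mult_right_mono[OF e(2), of "norm ?u"] by (simp add: algebra_simps)
        finally have zd: "norm (z y - z x) \<le> (K + 1) * norm ?u" .
        have "norm ?a \<le> e * norm (z y - z x) * ?p" using elim(2) vs by blast
        also have "\<dots> \<le> e * ((K + 1) * norm ?u) * ?p"
          using zd e(1) by (intro mult_left_mono mult_right_mono) auto
        finally have a: "norm ?a \<le> e * ((K + 1) * norm ?u) * ?p" .
        have "norm (G (z x) (?r # vs)) \<le> C * (norm ?r * ?p)" using C(2)[of "?r # vs"] vs by simp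
        also have "\<dots> \<le> C * ((e * norm ?u) * ?p)"
          using elim(1) C(1) by (intro mult_left_mono mult_right_mono) auto
        finally have b: "norm (G (z x) (?r # vs)) \<le> C * ((e * norm ?u) * ?p)" .
        have "norm (?a + G (z x) (?r # vs)) \<le> norm ?a + norm (G (z x) (?r # vs))" by (rule norm_triangle_ineq)
        also have "\<dots> \<le> (e * S) * (norm ?u * ?p)" using a b by (simp add: S_def algebra_simps)
        also have "\<dots> \<le> \<epsilon> * (norm ?u * ?p)" using e(3) by (intro mult_right_mono) auto
        finally show "norm (G (z y) vs - G (z x) vs - G (z x) (z' (y - x) # vs)) \<le> \<epsilon> * norm ?u * ?p"
          unfolding eq by (simp add: mult_ac)
      qed
    qed
  qed
qed

lemma norm_sum_list_le: "norm (\<Sum>x\<leftarrow>xs. f x) \<le> (\<Sum>x\<leftarrow>xs. norm (f x))"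
  by (induction xs) (auto intro: norm_triangle_le)

text \<open>The formula of Faa di Bruno: the jet of \<open>g \<circ> f\<close> is the sum over \<open>parts vs\<close>.  Its derivative is
given by the product rule, and the recursion of \<open>parts\<close> was made to match it.  The local bounds
follow from those of \<open>f\<close> and \<open>g\<close> because the number of partitions depends on the order
only up to a bound, and the norms of the blocks multiply to the norm of the list.\<close>

lemma smooth_on_compose:
  fixes f :: "'e::real_normed_vector \<Rightarrow> 'f::real_normed_vector" and g :: "'f \<Rightarrow> 'g::real_normed_vector"
  assumes g: "smooth_on T g" and f: "smooth_on U f" and fU: "f ` U \<subseteq> T"
  shows "smooth_on U (\<lambda>x. g (f x))"
proof -
  obtain F where F: "jet U F" "\<And>x. x \<in> U \<Longrightarrow> F x [] = f x"
    using smooth_on_imp_jet[OF f] by blast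
  obtain G where G: "jet T G" "\<And>x. x \<in> T \<Longrightarrow> G x [] = g x"
    using smooth_on_imp_jet[OF g] by blast
  define t where "t = (\<lambda>x P. G (F x []) (map (F x) P))"
  define H where "H = (\<lambda>x vs. \<Sum>P\<leftarrow>parts vs. t x P)"
  have FT: "F x [] \<in> T" if "x \<in> U" for x using that F(2) fU by auto
  have tder: "((\<lambda>y. t y P) has_derivative
      (\<lambda>u. t x ([u] # P) + (\<Sum>i<length P. t x (P[i := u # P ! i])))) (at x)" if x: "x \<in> U" for x P
  proof -
    note z = FT[OF x]
    show ?thesis
      using jet_multilinear_chain[where h = "\<lambda>B y. F y B" and h' = "\<lambda>B u. F x (u # B)" and P = P,
          OF G(1) z jet_has_derivative[OF F(1) x] jet_has_derivative[OF F(1) x]]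
      unfolding t_def by (simp add: map_update)
  qed
  have "jet U H" unfolding jet_def
  proof (intro conjI ballI allI)
    show "open U" using F(1) by (rule jet_open)
    fix x assume x: "x \<in> U"
    fix vs
    have "H x (u # vs) = (\<Sum>P\<leftarrow>parts vs. t x ([u] # P) + (\<Sum>i<length P. t x (P[i := u # P ! i])))" for u
      by (simp add: H_def sum_list_concat_map comp_def interv_sum_list_conv_sum_set_nat atLeast0LessThan)
    then show "((\<lambda>y. H y vs) has_derivative (\<lambda>u. H x (u # vs))) (at x)"
      using has_derivative_sum_list[of "parts vs" "\<lambda>P y. t y P" "\<lambda>P u. t x ([u] # P) + (\<Sum>i<length P. t x (P[i := u # P ! i]))" x]
      tder[OF x] by (simp add: H_def)
  next
    fix x k assume x: "x \<in> U"
    obtain Cf where Cf: "Cf \<ge> 1" "\<forall>\<^sub>F y in nhds x. \<forall>vs. length vs \<le> k \<longrightarrow> norm (F y vs) \<le> Cf * norm_prod vs"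
      using jet_bound_eventually[OF F(1) x] by blast
    obtain Cg where Cg: "Cg \<ge> 1" "\<forall>\<^sub>F z in nhds (F x []). \<forall>vs. length vs \<le> k \<longrightarrow> norm (G z vs) \<le> Cg * norm_prod vs"
      using jet_bound_eventually[OF G(1) FT[OF x]] by blast
    have "filterlim (\<lambda>y. F y []) (nhds (F x [])) (nhds x)"
      using has_derivative_continuous[OF jet_has_derivative[OF F(1) x]]
      by (simp add: continuous_at tendsto_nhds_iff)
    from eventually_compose_filterlim[OF Cg(2) this] Cf(2)
    have "\<forall>\<^sub>F y in nhds x. \<forall>vs. length vs = k \<longrightarrow> norm (H y vs) \<le> (fact k * (Cg * Cf ^ k)) * norm_prod vs"
    proof eventually_elim
      case (elim y)
      show ?case
      proof (intro allI impI)
        fix vs :: "'e list" assume vs: "length vs = k"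
        have tb: "norm (t y P) \<le> Cg * Cf ^ k * norm_prod vs" if P: "P \<in> set (parts vs)" for P
        proof -
          note pp = parts_props[OF P]
          have "norm_prod (map (F y) Q) \<le> Cf ^ length Q * prod_list (map norm_prod Q)"
            if "\<forall>B\<in>set Q. length B \<le> k" for Q
            using that
          proof (induction Q)
            case (Cons B Q)
            have "norm (F y B) * norm_prod (map (F y) Q) \<le> (Cf * norm_prod B) * (Cf ^ length Q * prod_list (map norm_prod Q))"
              using Cons Cf(1) elim(2) norm_prod_nonneg[of "map (F y) Q"]
              by (intro mult_mono) auto
            then show ?case by (simp add: mult_ac)
          qed simp
          then have "norm_prod (map (F y) P) \<le> Cf ^ length P * norm_prod vs"
            using pp vs by metis
          also have "\<dots> \<le> Cf ^ k * norm_prod vs"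
            using pp vs Cf(1) by (intro mult_right_mono power_increasing) auto
          finally have "norm_prod (map (F y) P) \<le> Cf ^ k * norm_prod vs" .
          moreover have "norm (t y P) \<le> Cg * norm_prod (map (F y) P)"
            using elim(1)[rule_format, of "map (F y) P"] pp vs by (simp add: t_def)
          ultimately show ?thesis
            using order_trans[OF _ mult_left_mono[of "norm_prod (map (F y) P)" "Cf ^ k * norm_prod vs" Cg]] Cg(1)
            by (simp add: mult_ac)
        qed
        have nn: "0 \<le> Cg * Cf ^ k * norm_prod vs" using Cg(1) Cf(1) by simp
        have "norm (H y vs) \<le> (\<Sum>P\<leftarrow>parts vs. norm (t y P))"
          unfolding H_def by (rule norm_sum_list_le)
        also have "\<dots> \<le> (\<Sum>P\<leftarrow>parts vs. Cg * Cf ^ k * norm_prod vs)"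
          using tb by (intro sum_list_mono)
        also have "\<dots> = of_nat (length (parts vs)) * (Cg * Cf ^ k * norm_prod vs)"
          by (simp add: sum_list_triv)
        also have "\<dots> \<le> fact k * (Cg * Cf ^ k * norm_prod vs)"
        proof (rule mult_right_mono[OF _ nn])
          have "real (length (parts vs)) \<le> real (fact k)"
            using length_parts_le[of vs] vs by (metis of_nat_le_iff)
          then show "real (length (parts vs)) \<le> fact k" by simp
        qed
        finally show "norm (H y vs) \<le> (fact k * (Cg * Cf ^ k)) * norm_prod vs" by (simp add: mult_ac)
      qed
    qed
    then show "\<exists>C. \<forall>\<^sub>F y in nhds x. \<forall>vs. length vs = k \<longrightarrow> norm (H y vs) \<le> C * norm_prod vs" by blast
  qed
  then show ?thesis
  proof (rule jet_imp_smooth_on)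
    fix x assume "x \<in> U"
    then show "H x [] = g (f x)" using F(2) G(2) fU by (auto simp: H_def t_def)
  qed
qed

section \<open>Power series of bounded operators\<close>

interpretation oL: bounded_bilinear "(o\<^sub>L)"
  by (rule bounded_bilinear_blinfun_compose)

lemma oL_assoc: "(X o\<^sub>L Y) o\<^sub>L Z = X o\<^sub>L (Y o\<^sub>L Z)"
  by (rule blinfun_eqI) simp

lemma oL_id [simp]: "X o\<^sub>L id_blinfun = X" "id_blinfun o\<^sub>L X = X"
  by (auto intro: blinfun_eqI)

definition remove_at :: "nat \<Rightarrow> 'a list \<Rightarrow> 'a list" where
  "remove_at i vs = take i vs @ drop (Suc i) vs"

lemma remove_at_Cons [simp]:
  "remove_at 0 (v # vs) = vs" "remove_at (Suc i) (v # vs) = v # remove_at i vs"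
  by (simp_all add: remove_at_def)

lemma length_remove_at: "i < length vs \<Longrightarrow> length (remove_at i vs) = length vs - 1"
  by (simp add: remove_at_def)

lemma norm_prod_remove_at:
  "i < length vs \<Longrightarrow> norm (vs ! i) * norm_prod (remove_at i vs) = norm_prod vs"
proof (induction vs arbitrary: i)
  case (Cons v vs)
  then show ?case by (cases i) (auto simp: mult_ac)
qed simp

text \<open>The jet of \<open>X \<mapsto> X\<^sup>n\<close>: the sum of all words of length \<open>n\<close> in which each direction occurs once and
all other letters are \<open>X\<close>.  The recursion splits off the first letter of the word.\<close>

fun pow_jet :: "nat \<Rightarrow> ('a::real_normed_vector \<Rightarrow>\<^sub>L 'a) \<Rightarrow> ('a \<Rightarrow>\<^sub>L 'a) list \<Rightarrow> ('a \<Rightarrow>\<^sub>L 'a)" where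
  "pow_jet 0 X vs = (if vs = [] then id_blinfun else 0)"
| "pow_jet (Suc n) X vs =
     (X o\<^sub>L pow_jet n X vs) + (\<Sum>i<length vs. (vs ! i) o\<^sub>L pow_jet n X (remove_at i vs))"

lemma pow_jet_has_derivative:
  "((\<lambda>X. pow_jet n X vs) has_derivative (\<lambda>u. pow_jet n X (u # vs))) (at X)"
proof (induction n arbitrary: vs)
  case (Suc n)
  have "((\<lambda>X. (X o\<^sub>L pow_jet n X vs) + (\<Sum>i<length vs. (vs ! i) o\<^sub>L pow_jet n X (remove_at i vs)))
     has_derivative (\<lambda>u. ((X o\<^sub>L pow_jet n X (u # vs)) + (u o\<^sub>L pow_jet n X vs))
        + (\<Sum>i<length vs. (vs ! i) o\<^sub>L pow_jet n X (u # remove_at i vs)))) (at X)"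
    by (intro has_derivative_add has_derivative_sum oL.FDERIV has_derivative_ident Suc
        bounded_linear.has_derivative[OF oL.bounded_linear_right])
  then show ?case
    by (simp add: sum.lessThan_Suc_shift add_ac del: sum.lessThan_Suc)
qed simp

text \<open>Scaling the directions by a free parameter \<open>s\<close> makes the sum of all words with \<open>k\<close> directions at
most \<open>(\<parallel>X\<parallel> + k s)\<^sup>n\<close>.  This avoids the factor \<open>n (n - 1) \<dots> (n - k + 1)\<close> and keeps the bound
summable against coefficients that are summable for a slightly larger radius.\<close>

lemma pow_jet_bound:
  fixes s :: real
  assumes "s \<ge> 0"
  shows "norm (pow_jet n X vs) * s ^ length vs \<le> (norm X + length vs * s) ^ n * norm_prod vs"
proof (induction n arbitrary: vs)
  case 0
  then show ?case by (auto simp: norm_blinfun_id_le)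
next
  case (Suc n)
  let ?k = "length vs" and ?A = "norm X + length vs * s"
  have 1: "norm (X o\<^sub>L pow_jet n X vs) * s ^ ?k \<le> norm X * (?A ^ n * norm_prod vs)"
  proof -
    have "norm (X o\<^sub>L pow_jet n X vs) * s ^ ?k \<le> norm X * norm (pow_jet n X vs) * s ^ ?k"
      using assms by (intro mult_right_mono norm_blinfun_compose) auto
    also have "\<dots> = norm X * (norm (pow_jet n X vs) * s ^ ?k)" by simp
    also have "\<dots> \<le> norm X * (?A ^ n * norm_prod vs)"
      by (intro mult_left_mono Suc.IH) auto
    finally show ?thesis .
  qed
  have 2: "norm ((vs ! i) o\<^sub>L pow_jet n X (remove_at i vs)) * s ^ ?k \<le> s * (?A ^ n * norm_prod vs)"
    if i: "i < ?k" for i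
  proof -
    let ?r = "remove_at i vs"
    have k: "?k = Suc (length ?r)" using i by (simp add: length_remove_at)
    have "norm ((vs ! i) o\<^sub>L pow_jet n X ?r) * s ^ ?k \<le> norm (vs ! i) * norm (pow_jet n X ?r) * s ^ ?k"
      using assms by (intro mult_right_mono norm_blinfun_compose) auto
    also have "\<dots> = s * norm (vs ! i) * (norm (pow_jet n X ?r) * s ^ length ?r)"
      unfolding k by simp
    also have "\<dots> \<le> s * norm (vs ! i) * ((norm X + length ?r * s) ^ n * norm_prod ?r)"
      using assms by (intro mult_left_mono Suc.IH) auto
    also have "\<dots> \<le> s * norm (vs ! i) * (?A ^ n * norm_prod ?r)"
      using assms k by (intro mult_left_mono mult_right_mono power_mono add_left_mono) auto
    also have "\<dots> = s * (?A ^ n * (norm (vs ! i) * norm_prod ?r))" by (simp add: mult_ac)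
    also have "norm (vs ! i) * norm_prod ?r = norm_prod vs" by (rule norm_prod_remove_at[OF i])
    finally show ?thesis .
  qed
  have "norm (pow_jet (Suc n) X vs) \<le> norm (X o\<^sub>L pow_jet n X vs)
      + (\<Sum>i<?k. norm ((vs ! i) o\<^sub>L pow_jet n X (remove_at i vs)))"
    by (simp, intro norm_triangle_le add_mono norm_sum order_refl)
  then have "norm (pow_jet (Suc n) X vs) * s ^ ?k \<le> (norm (X o\<^sub>L pow_jet n X vs)
      + (\<Sum>i<?k. norm ((vs ! i) o\<^sub>L pow_jet n X (remove_at i vs)))) * s ^ ?k"
    using assms by (intro mult_right_mono) auto
  also have "\<dots> = norm (X o\<^sub>L pow_jet n X vs) * s ^ ?k
      + (\<Sum>i<?k. norm ((vs ! i) o\<^sub>L pow_jet n X (remove_at i vs)) * s ^ ?k)"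
    by (simp add: distrib_right sum_distrib_right)
  also have "\<dots> \<le> norm X * (?A ^ n * norm_prod vs) + (\<Sum>i<?k. s * (?A ^ n * norm_prod vs))"
    using 1 2 by (intro add_mono sum_mono) auto
  also have "\<dots> = ?A ^ Suc n * norm_prod vs" by (simp add: algebra_simps)
  finally show ?case .
qed

lemma norm_pow_le: "norm (pow_jet n X []) \<le> norm X ^ n"
  using pow_jet_bound[where s = 0 and n = n and X = X and vs = "[]"] by simp

definition series_jet :: "(nat \<Rightarrow> real) \<Rightarrow> ('a::banach \<Rightarrow>\<^sub>L 'a) \<Rightarrow> ('a \<Rightarrow>\<^sub>L 'a) list \<Rightarrow> ('a \<Rightarrow>\<^sub>L 'a)" where
  "series_jet a X vs = (\<Sum>n. a n *\<^sub>R pow_jet n X vs)"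

definition op_series :: "(nat \<Rightarrow> real) \<Rightarrow> ('a::banach \<Rightarrow>\<^sub>L 'a) \<Rightarrow> ('a \<Rightarrow>\<^sub>L 'a)" where
  "op_series a X = series_jet a X []"

text \<open>The points strictly inside the ball of absolute convergence.  Asking for convergence at some
larger radius covers finite and infinite radii alike and leaves room for the parameter of
\<open>pow_jet_bound\<close>.\<close>

definition conv_dom :: "(nat \<Rightarrow> real) \<Rightarrow> ('a::banach \<Rightarrow>\<^sub>L 'a) set" where
  "conv_dom a = {X. \<exists>\<rho>>norm X. summable (\<lambda>n. \<bar>a n\<bar> * \<rho> ^ n)}"

lemma series_jet_term_bound:
  assumes s: "s > 0" and le: "norm Y + k * s \<le> \<rho>" and vs: "length vs = k"
  shows "norm (a n *\<^sub>R pow_jet n Y vs) \<le> (norm_prod vs / s ^ k) * (\<bar>a n\<bar> * \<rho> ^ n)"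
proof -
  have "norm (pow_jet n Y vs) * s ^ k \<le> (norm Y + k * s) ^ n * norm_prod vs"
    using pow_jet_bound[where s = s and n = n and X = Y and vs = vs] s vs by simp
  also have "\<dots> \<le> \<rho> ^ n * norm_prod vs"
    using le s by (intro mult_right_mono power_mono) auto
  finally have "norm (pow_jet n Y vs) \<le> \<rho> ^ n * norm_prod vs / s ^ k"
    using s by (simp add: pos_le_divide_eq)
  then have "\<bar>a n\<bar> * norm (pow_jet n Y vs) \<le> \<bar>a n\<bar> * (\<rho> ^ n * norm_prod vs / s ^ k)"
    by (intro mult_left_mono) auto
  then show ?thesis by (simp add: mult_ac)
qed

lemma series_jet_summable:
  assumes "X \<in> conv_dom a"
  shows "summable (\<lambda>n. a n *\<^sub>R pow_jet n X vs)"
proof -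
  obtain \<rho> where \<rho>: "\<rho> > norm X" "summable (\<lambda>n. \<bar>a n\<bar> * \<rho> ^ n)"
    using assms by (auto simp: conv_dom_def)
  define s where "s = (\<rho> - norm X) / (length vs + 1)"
  have s: "s > 0" "norm X + length vs * s \<le> \<rho>"
    using \<rho>(1) by (auto simp: s_def field_simps)
  show ?thesis
    by (rule summable_comparison_test'[OF summable_mult[OF \<rho>(2)]])
      (use series_jet_term_bound[OF s refl] in blast)
qed

lemma norm_suminf_tail_le:
  fixes f :: "nat \<Rightarrow> 'b::banach"
  assumes b: "summable b" and f: "\<And>n. norm (f n) \<le> c * b n"
  shows "norm (sum f {..<n} - suminf f) \<le> c * (suminf b - sum b {..<n})"
proof -
  have sf: "summable f" by (rule summable_comparison_test'[OF summable_mult[OF b] f])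
  have "norm (\<Sum>i. f (i + n)) \<le> (\<Sum>i. c * b (i + n))"
    by (rule norm_suminf_le, rule f) (intro summable_mult summable_ignore_initial_segment b)
  also have "\<dots> = c * (\<Sum>i. b (i + n))"
    using b by (intro suminf_mult summable_ignore_initial_segment)
  finally show ?thesis
    using suminf_minus_initial_segment[OF sf, of n] suminf_minus_initial_segment[OF b, of n]
    by (simp add: norm_minus_commute)
qed

text \<open>Both the bounds and the termwise differentiation rest on \<open>series_jet_term_bound\<close>, with \<open>s\<close> chosen
such that \<open>\<parallel>Y\<parallel> + k s\<close> stays below \<open>\<rho>\<close> for all \<open>Y\<close> near \<open>X\<close>.\<close>

lemma jet_series_jet: "jet (conv_dom a) (series_jet a)"
  unfolding jet_def
proof (intro conjI ballI allI)
  show "open (conv_dom a :: ('a \<Rightarrow>\<^sub>L 'a) set)"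
    unfolding open_contains_ball
  proof (intro ballI)
    fix X :: "'a \<Rightarrow>\<^sub>L 'a" assume "X \<in> conv_dom a"
    then obtain \<rho> where \<rho>: "\<rho> > norm X" "summable (\<lambda>n. \<bar>a n\<bar> * \<rho> ^ n)" by (auto simp: conv_dom_def)
    have "ball X (\<rho> - norm X) \<subseteq> conv_dom a"
    proof
      fix Y assume "Y \<in> ball X (\<rho> - norm X)"
      then have "norm Y < \<rho>"
        using norm_triangle_ineq2[of Y X] by (simp add: dist_norm norm_minus_commute)
      then show "Y \<in> conv_dom a" using \<rho>(2) by (auto simp: conv_dom_def)
    qed
    then show "\<exists>e>0. ball X e \<subseteq> conv_dom a"
      using \<rho>(1) by (intro exI[of _ "\<rho> - norm X"]) auto
  qed
next
  fix X :: "'a \<Rightarrow>\<^sub>L 'a" and k :: nat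
  assume "X \<in> conv_dom a"
  then obtain \<rho> where \<rho>: "\<rho> > norm X" "summable (\<lambda>n. \<bar>a n\<bar> * \<rho> ^ n)" by (auto simp: conv_dom_def)
  define s where "s = (\<rho> - norm X) / (k + 1)"
  have s: "s > 0" "norm X + (k + 1) * s = \<rho>" using \<rho>(1) by (auto simp: s_def field_simps)
  have "norm (series_jet a Y vs) \<le> ((\<Sum>n. \<bar>a n\<bar> * \<rho> ^ n) / s ^ k) * norm_prod vs"
    if Y: "dist Y X < s" and vs: "length vs = k" for Y vs
  proof -
    have "norm Y \<le> norm X + s"
      using Y norm_triangle_ineq2[of Y X] by (simp add: dist_norm)
    then have le: "norm Y + k * s \<le> \<rho>" using s(2) by (simp add: algebra_simps)
    note tb = series_jet_term_bound[OF s(1) le vs]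
    have "norm (series_jet a Y vs) \<le> (\<Sum>n. (norm_prod vs / s ^ k) * (\<bar>a n\<bar> * \<rho> ^ n))"
      unfolding series_jet_def by (rule norm_suminf_le, rule tb) (intro summable_mult \<rho>(2))
    also have "\<dots> = (norm_prod vs / s ^ k) * (\<Sum>n. \<bar>a n\<bar> * \<rho> ^ n)"
      by (rule suminf_mult[OF \<rho>(2)])
    finally show ?thesis by (simp add: mult_ac)
  qed
  then show "\<exists>C. \<forall>\<^sub>F y in nhds X. \<forall>vs. length vs = k \<longrightarrow> norm (series_jet a y vs) \<le> C * norm_prod vs"
    unfolding eventually_nhds_metric using s(1) by blast
next
  fix X :: "'a \<Rightarrow>\<^sub>L 'a" and vs :: "('a \<Rightarrow>\<^sub>L 'a) list"
  assume X: "X \<in> conv_dom a"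
  then obtain \<rho> where \<rho>: "\<rho> > norm X" "summable (\<lambda>n. \<bar>a n\<bar> * \<rho> ^ n)" by (auto simp: conv_dom_def)
  define k where "k = length vs"
  define s where "s = (\<rho> - norm X) / (k + 2)"
  have s: "s > 0" "norm X + (k + 2) * s = \<rho>" using \<rho>(1) by (auto simp: s_def field_simps)
  define b where "b = (\<lambda>n. \<bar>a n\<bar> * \<rho> ^ n)"
  have b: "summable b" using \<rho>(2) by (simp add: b_def)
  have le: "norm Y + (k + 1) * s \<le> \<rho>" if "Y \<in> ball X s" for Y
  proof -
    have Y: "norm Y \<le> norm X + s"
      using that norm_triangle_ineq2[of Y X] by (simp add: dist_norm norm_minus_commute)
    then show ?thesis using s(2) by (simp add: algebra_simps)
  qed
  have "\<exists>g. \<forall>Y\<in>ball X s. (\<lambda>n. a n *\<^sub>R pow_jet n Y vs) sums g Y \<and>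
      (g has_derivative (\<lambda>u. series_jet a Y (u # vs))) (at Y within ball X s)"
  proof (rule has_derivative_series[where f' = "\<lambda>n Y u. a n *\<^sub>R pow_jet n Y (u # vs)" and x = X])
    show "((\<lambda>Y. a n *\<^sub>R pow_jet n Y vs) has_derivative (\<lambda>u. a n *\<^sub>R pow_jet n Y (u # vs))) (at Y within ball X s)" for n Y
      by (rule has_derivative_at_withinI[OF has_derivative_scaleR_right[OF pow_jet_has_derivative]])
    show "(\<lambda>n. a n *\<^sub>R pow_jet n X vs) sums series_jet a X vs"
      unfolding series_jet_def by (rule summable_sums[OF series_jet_summable[OF X]])
    fix e :: real assume e: "e > 0"
    let ?c = "norm_prod vs / s ^ Suc k"
    have "(\<lambda>n. ?c * (suminf b - sum b {..<n})) \<longlonglongrightarrow> ?c * (suminf b - suminf b)"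
      by (rule tendsto_mult[OF tendsto_const tendsto_diff[OF tendsto_const summable_LIMSEQ[OF b]]])
    from order_tendstoD(2)[OF this, of e] e
    have "\<forall>\<^sub>F n in sequentially. ?c * (suminf b - sum b {..<n}) < e" by simp
    then show "\<forall>\<^sub>F n in sequentially. \<forall>Y\<in>ball X s. \<forall>h.
        norm ((\<Sum>i<n. a i *\<^sub>R pow_jet i Y (h # vs)) - series_jet a Y (h # vs)) \<le> e * norm h"
    proof eventually_elim
      case (elim n)
      show ?case
      proof (intro ballI allI)
        fix Y h assume Y: "Y \<in> ball X s"
        have "norm (a n *\<^sub>R pow_jet n Y (h # vs)) \<le> (norm h * ?c) * b n" for n
        proof -
          have "norm Y + real (Suc k) * s \<le> \<rho>" using le[OF Y] by simp
          then have "norm (a n *\<^sub>R pow_jet n Y (h # vs)) \<le> (norm_prod (h # vs) / s ^ Suc k) * (\<bar>a n\<bar> * \<rho> ^ n)"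
            by (rule series_jet_term_bound[OF s(1)]) (simp add: k_def)
          then show ?thesis unfolding b_def by simp
        qed
        from norm_suminf_tail_le[OF b this, of n]
        have "norm ((\<Sum>i<n. a i *\<^sub>R pow_jet i Y (h # vs)) - series_jet a Y (h # vs))
          \<le> (norm h * ?c) * (suminf b - sum b {..<n})"
          unfolding series_jet_def .
        also have "\<dots> = norm h * (?c * (suminf b - sum b {..<n}))" by simp
        also have "\<dots> \<le> norm h * e" using elim by (intro mult_left_mono) auto
        finally show "norm ((\<Sum>i<n. a i *\<^sub>R pow_jet i Y (h # vs)) - series_jet a Y (h # vs)) \<le> e * norm h"
          by (simp add: mult.commute)
      qed
    qed
  qed (use s(1) in auto)
  then obtain g where g: "\<And>Y. Y \<in> ball X s \<Longrightarrow> (\<lambda>n. a n *\<^sub>R pow_jet n Y vs) sums g Y"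
    "\<And>Y. Y \<in> ball X s \<Longrightarrow> (g has_derivative (\<lambda>u. series_jet a Y (u # vs))) (at Y within ball X s)"
    by blast
  have XB: "X \<in> ball X s" using s(1) by simp
  have "(g has_derivative (\<lambda>u. series_jet a X (u # vs))) (at X)"
    using g(2)[OF XB] at_within_open[OF XB open_ball] by metis
  then show "((\<lambda>y. series_jet a y vs) has_derivative (\<lambda>u. series_jet a X (u # vs))) (at X)"
    by (rule has_derivative_transform_within_open[OF _ open_ball XB])
      (use g(1) in \<open>simp add: series_jet_def sums_unique\<close>)
qed

lemma smooth_on_op_series: "smooth_on (conv_dom a) (op_series a)"
  by (rule jet_imp_smooth_on[OF jet_series_jet]) (simp add: op_series_def)

lemma op_series_has_derivative:
  "X \<in> conv_dom a \<Longrightarrow> (op_series a has_derivative (\<lambda>u. series_jet a X [u])) (at X)"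
  using jet_has_derivative[OF jet_series_jet, of X a "[]"] by (simp add: op_series_def[abs_def])

lemma pow_commute:
  "S o\<^sub>L X = X o\<^sub>L S \<Longrightarrow> S o\<^sub>L pow_jet n X [] = pow_jet n X [] o\<^sub>L S"
proof (induction n)
  case (Suc n)
  then show ?case by simp (metis oL_assoc)
qed simp

lemma op_series_commute:
  assumes X: "X \<in> conv_dom a" and c: "S o\<^sub>L X = X o\<^sub>L S"
  shows "S o\<^sub>L op_series a X = op_series a X o\<^sub>L S"
proof -
  note sm = series_jet_summable[OF X, of "[]"]
  have "S o\<^sub>L op_series a X = (\<Sum>n. S o\<^sub>L (a n *\<^sub>R pow_jet n X []))"
    unfolding op_series_def series_jet_def by (rule bounded_linear.suminf[OF oL.bounded_linear_right sm])
  also have "\<dots> = (\<Sum>n. (a n *\<^sub>R pow_jet n X []) o\<^sub>L S)"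
    by (simp add: oL.scaleR_left oL.scaleR_right pow_commute[OF c] del: pow_jet.simps)
  also have "\<dots> = op_series a X o\<^sub>L S"
    unfolding op_series_def series_jet_def
    by (rule bounded_linear.suminf[OF oL.bounded_linear_left sm, symmetric])
  finally show ?thesis .
qed

lemma pow_jet_commuting:
  assumes "v o\<^sub>L X = X o\<^sub>L v"
  shows "pow_jet (Suc n) X [v] = real (Suc n) *\<^sub>R (pow_jet n X [] o\<^sub>L v)"
proof (induction n)
  case 0
  then show ?case by simp
next
  case (Suc n)
  have "pow_jet (Suc (Suc n)) X [v] = (X o\<^sub>L pow_jet (Suc n) X [v]) + (v o\<^sub>L pow_jet (Suc n) X [])"
    by simp
  also have "X o\<^sub>L pow_jet (Suc n) X [v] = real (Suc n) *\<^sub>R (pow_jet (Suc n) X [] o\<^sub>L v)"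
    unfolding Suc by (simp add: oL.scaleR_right oL_assoc)
  also have "v o\<^sub>L pow_jet (Suc n) X [] = pow_jet (Suc n) X [] o\<^sub>L v"
    by (rule pow_commute[OF assms])
  finally show ?case by (simp add: scaleR_add_left scaleR_2)
qed

text \<open>In a direction that commutes with \<open>X\<close> all words with one direction agree, and a power series is
differentiated as for scalars.\<close>

lemma series_jet_commuting:
  assumes X: "X \<in> conv_dom a" "X \<in> conv_dom (\<lambda>n. real (Suc n) * a (Suc n))"
    and v: "v o\<^sub>L X = X o\<^sub>L v"
  shows "series_jet a X [v] = op_series (\<lambda>n. real (Suc n) * a (Suc n)) X o\<^sub>L v"
proof -
  have "series_jet a X [v] = (\<Sum>n. a (Suc n) *\<^sub>R pow_jet (Suc n) X [v])"
    unfolding series_jet_def using suminf_split_head[OF series_jet_summable[OF X(1), of "[v]"]] by simp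
  also have "\<dots> = (\<Sum>n. ((real (Suc n) * a (Suc n)) *\<^sub>R pow_jet n X []) o\<^sub>L v)"
    unfolding pow_jet_commuting[OF v] by (simp add: oL.scaleR_left mult.commute)
  also have "\<dots> = op_series (\<lambda>n. real (Suc n) * a (Suc n)) X o\<^sub>L v"
    unfolding op_series_def series_jet_def
    by (rule bounded_linear.suminf[OF oL.bounded_linear_left series_jet_summable[OF X(2)], symmetric])
  finally show ?thesis .
qed

text \<open>Symmetry of the second derivative, which is visible in the recursion of \<open>pow_jet\<close>.\<close>

lemma series_jet_sym: "series_jet a X [u, v] = series_jet a X [v, u]"
proof -
  have "pow_jet n X [u, v] = pow_jet n X [v, u]" for n
  proof (induction n)
    case (Suc n)
    have "\<And>w z :: 'a \<Rightarrow>\<^sub>L 'a. (\<Sum>i<length [w,z]. ([w,z] ! i) o\<^sub>L pow_jet n X (remove_at i [w,z]))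
      = (w o\<^sub>L pow_jet n X [z]) + (z o\<^sub>L pow_jet n X [w])"
      by (simp add: numeral_2_eq_2)
    then show ?case using Suc by (simp add: add.commute)
  qed simp
  then show ?thesis by (simp add: series_jet_def)
qed

section \<open>Exponential and logarithm of bounded operators\<close>

definition op_exp :: "('a::banach \<Rightarrow>\<^sub>L 'a) \<Rightarrow> ('a \<Rightarrow>\<^sub>L 'a)" where
  "op_exp = op_series (\<lambda>n. 1 / fact n)"

text \<open>The coefficients of \<open>log (1 + z)\<close>, which is why \<open>op_log\<close> below subtracts the identity.\<close>

definition log_coeff :: "nat \<Rightarrow> real" where
  "log_coeff n = (if n = 0 then 0 else - ((-1) ^ n) / n)"

definition op_log :: "('a::banach \<Rightarrow>\<^sub>L 'a) \<Rightarrow> ('a \<Rightarrow>\<^sub>L 'a)" where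
  "op_log Y = op_series log_coeff (Y - id_blinfun)"

text \<open>The inverse of \<open>id + Z\<close>; it gives the derivative of the logarithm there in commuting directions.\<close>

abbreviation op_geom :: "('a::banach \<Rightarrow>\<^sub>L 'a) \<Rightarrow> ('a \<Rightarrow>\<^sub>L 'a)" where
  "op_geom \<equiv> op_series (\<lambda>n. (-1) ^ n)"

lemma exp_dom: "conv_dom (\<lambda>n. 1 / fact n) = UNIV"
proof -
  have "summable (\<lambda>n. \<bar>1 / fact n\<bar> * \<rho> ^ n)" for \<rho> :: real
    using summable_exp[of \<rho>] by (simp add: divide_inverse)
  then show ?thesis unfolding conv_dom_def using gt_ex by blast
qed

lemma bounded_coeff_dom:
  assumes "\<And>n. \<bar>a n\<bar> \<le> 1" and Z: "norm Z < 1"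
  shows "Z \<in> conv_dom a"
proof -
  obtain \<rho> where \<rho>: "norm Z < \<rho>" "\<rho> < 1" using Z dense by blast
  then have "0 \<le> \<rho>" using norm_ge_zero[of Z] by linarith
  have "summable (\<lambda>n. \<bar>a n\<bar> * \<rho> ^ n)"
  proof (rule summable_comparison_test')
    show "summable (\<lambda>n. \<rho> ^ n)" using \<rho> \<open>0 \<le> \<rho>\<close> by (intro summable_geometric) auto
    show "norm (\<bar>a n\<bar> * \<rho> ^ n) \<le> \<rho> ^ n" for n
      using assms(1)[of n] \<open>0 \<le> \<rho>\<close> by (simp add: abs_mult mult_left_le_one_le)
  qed
  then show ?thesis using \<rho>(1) by (auto simp: conv_dom_def)
qed

lemma log_coeff_le: "\<bar>log_coeff n\<bar> \<le> 1"
  by (auto simp: log_coeff_def abs_divide divide_le_eq)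

lemma log_dom: "norm Z < 1 \<Longrightarrow> Z \<in> conv_dom log_coeff"
  by (rule bounded_coeff_dom) (rule log_coeff_le)

lemma geom_dom: "norm Z < 1 \<Longrightarrow> Z \<in> conv_dom (\<lambda>n. (-1) ^ n)"
  by (rule bounded_coeff_dom) (simp_all add: power_abs)

lemma smooth_on_op_exp: "smooth_on UNIV op_exp"
  using smooth_on_op_series[of "\<lambda>n. 1 / fact n"] by (simp add: exp_dom op_exp_def)

lemma smooth_on_op_log: "smooth_on {Y. norm (Y - id_blinfun) < 1} op_log"
proof -
  let ?U = "{Y::'a \<Rightarrow>\<^sub>L 'a. norm (Y - id_blinfun) < 1}"
  have "open ?U" by (intro open_Collect_less continuous_intros)
  have p: "smooth_on UNIV (\<lambda>Y::'a \<Rightarrow>\<^sub>L 'a. (Y, - id_blinfun :: 'a \<Rightarrow>\<^sub>L 'a))"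
    by (intro smooth_on_Pair smooth_on_const smooth_on_linear open_UNIV bounded_linear_ident)
  have "smooth_on UNIV (\<lambda>p::('a \<Rightarrow>\<^sub>L 'a) \<times> ('a \<Rightarrow>\<^sub>L 'a). fst p + snd p)"
    by (intro smooth_on_linear open_UNIV bounded_linear_add bounded_linear_fst bounded_linear_snd)
  from smooth_on_compose[OF this p]
  have "smooth_on ?U (\<lambda>Y. Y - id_blinfun)"
    by (rule smooth_on_subset_cong[OF _ \<open>open ?U\<close>]) auto
  then have "smooth_on ?U (\<lambda>Y. op_series log_coeff (Y - id_blinfun))"
    by (rule smooth_on_compose[OF smooth_on_op_series]) (auto intro: log_dom)
  then show ?thesis by (simp add: op_log_def[abs_def])
qed

lemma op_series_zero: "op_series a 0 = a 0 *\<^sub>R id_blinfun"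
proof -
  have "(\<Sum>n. a n *\<^sub>R pow_jet n (0::'a \<Rightarrow>\<^sub>L 'a) []) = (\<Sum>n\<in>{0}. a n *\<^sub>R pow_jet n 0 [])"
  proof (rule suminf_finite)
    fix n :: nat assume "n \<notin> {0}"
    then obtain m where "n = Suc m" by (cases n) auto
    then show "a n *\<^sub>R pow_jet n (0::'a \<Rightarrow>\<^sub>L 'a) [] = 0" by simp
  qed simp
  then show ?thesis by (simp add: op_series_def series_jet_def)
qed

lemma op_exp_zero [simp]: "op_exp 0 = id_blinfun"
  by (simp add: op_exp_def op_series_zero)

lemma op_log_id [simp]: "op_log id_blinfun = 0"
  by (simp add: op_log_def op_series_zero log_coeff_def)

lemma op_exp_jet: "series_jet (\<lambda>n. 1 / fact n) X [v] = op_exp X o\<^sub>L v" if "v o\<^sub>L X = X o\<^sub>L v"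
proof -
  have "(\<lambda>n. real (Suc n) * (1 / fact (Suc n))) = (\<lambda>n. 1 / fact n)"
    by (auto simp: field_simps simp del: of_nat_Suc)
  from series_jet_commuting[of X "\<lambda>n. 1 / fact n" v, unfolded this] show ?thesis
    using that by (simp add: exp_dom op_exp_def)
qed

lemma op_exp_commute: "S o\<^sub>L X = X o\<^sub>L S \<Longrightarrow> S o\<^sub>L op_exp X = op_exp X o\<^sub>L S"
  unfolding op_exp_def by (rule op_series_commute) (simp add: exp_dom)

lemma op_log_commute:
  "norm (Y - id_blinfun) < 1 \<Longrightarrow> S o\<^sub>L Y = Y o\<^sub>L S \<Longrightarrow> S o\<^sub>L op_log Y = op_log Y o\<^sub>L S"
  unfolding op_log_def
  by (rule op_series_commute[OF log_dom]) (auto simp: oL.diff_left oL.diff_right)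

lemma op_exp_vector_derivative:
  assumes "(u has_vector_derivative u') (at t within S)" "u' o\<^sub>L u t = u t o\<^sub>L u'"
  shows "((\<lambda>s. op_exp (u s)) has_vector_derivative (op_exp (u t) o\<^sub>L u')) (at t within S)"
proof -
  have d: "(op_exp has_derivative (\<lambda>v. series_jet (\<lambda>n. 1 / fact n) (u t) [v])) (at (u t))"
    unfolding op_exp_def by (rule op_series_has_derivative) (simp add: exp_dom)
  have lin: "series_jet (\<lambda>n. 1 / fact n) (u t) [r *\<^sub>R u'] = r *\<^sub>R (op_exp (u t) o\<^sub>L u')" for r
    using linear_scale[OF has_derivative_linear[OF d]] op_exp_jet[OF assms(2)] by simp
  show ?thesis
    using has_derivative_compose[OF assms(1)[unfolded has_vector_derivative_def] d]
    unfolding has_vector_derivative_def lin .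
qed

lemma op_log_jet:
  assumes "norm (Y - id_blinfun) < 1" "v o\<^sub>L Y = Y o\<^sub>L v"
  shows "series_jet log_coeff (Y - id_blinfun) [v] = op_geom (Y - id_blinfun) o\<^sub>L v"
proof -
  have "(\<lambda>n. real (Suc n) * log_coeff (Suc n)) = (\<lambda>n. (-1) ^ n)"
    by (auto simp: log_coeff_def simp del: of_nat_Suc)
  from series_jet_commuting[of "Y - id_blinfun" log_coeff v, unfolded this] show ?thesis
    using assms log_dom[OF assms(1)] geom_dom[OF assms(1)] by (simp add: oL.diff_left oL.diff_right)
qed

lemma op_log_vector_derivative:
  assumes u: "(u has_vector_derivative u') (at t within S)" and c: "u' o\<^sub>L u t = u t o\<^sub>L u'"
    and n: "norm (u t - id_blinfun) < 1"
  shows "((\<lambda>s. op_log (u s)) has_vector_derivative (op_geom (u t - id_blinfun) o\<^sub>L u')) (at t within S)"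
proof -
  let ?Z = "u t - id_blinfun"
  have d: "(op_series log_coeff has_derivative (\<lambda>v. series_jet log_coeff ?Z [v])) (at ?Z)"
    by (rule op_series_has_derivative[OF log_dom[OF n]])
  have lin: "series_jet log_coeff ?Z [r *\<^sub>R u'] = r *\<^sub>R (op_geom ?Z o\<^sub>L u')" for r
    using linear_scale[OF has_derivative_linear[OF d]] op_log_jet[OF n c] by simp
  have "((\<lambda>s. u s - id_blinfun) has_derivative (\<lambda>r. r *\<^sub>R u')) (at t within S)"
    using u unfolding has_vector_derivative_def by (auto intro!: derivative_eq_intros)
  from has_derivative_compose[OF this d]
  show ?thesis
    unfolding has_vector_derivative_def op_log_def lin .
qed

lemma op_geom_inverse:
  assumes "norm Z < 1"
  shows "op_geom Z o\<^sub>L (id_blinfun + Z) = id_blinfun"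
proof -
  note sm = series_jet_summable[OF geom_dom[OF assms], of "[]"]
  have "op_geom Z = id_blinfun + (\<Sum>n. (-1) ^ Suc n *\<^sub>R pow_jet (Suc n) Z [])"
    unfolding op_series_def series_jet_def using suminf_split_head[OF sm] by simp
  also have "(\<lambda>n. (-1) ^ Suc n *\<^sub>R pow_jet (Suc n) Z []) = (\<lambda>n. - (Z o\<^sub>L ((-1) ^ n *\<^sub>R pow_jet n Z [])))"
    by (auto simp: oL.scaleR_right)
  also have "(\<Sum>n. - (Z o\<^sub>L ((-1) ^ n *\<^sub>R pow_jet n Z []))) = - (Z o\<^sub>L op_geom Z)"
    unfolding op_series_def series_jet_def
    by (subst suminf_minus) (use bounded_linear.summable[OF oL.bounded_linear_right[of Z] sm]
        bounded_linear.suminf[OF oL.bounded_linear_right[of Z] sm] in auto)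
  finally have e: "op_geom Z = id_blinfun + - (Z o\<^sub>L op_geom Z)" .
  have "op_geom Z o\<^sub>L Z = Z o\<^sub>L op_geom Z"
    by (rule op_series_commute[OF geom_dom[OF assms] refl, symmetric])
  then have "op_geom Z o\<^sub>L (id_blinfun + Z) = op_geom Z + (Z o\<^sub>L op_geom Z)"
    unfolding oL.add_right by (simp only: oL_id)
  also have "\<dots> = id_blinfun" by (subst e) simp
  finally show ?thesis .
qed

lemma zero_vector_derivative_eq:
  assumes "\<And>t. t \<in> {0..1} \<Longrightarrow> (f has_vector_derivative 0) (at t within {0..1::real})"
  shows "f 1 = f 0"
proof -
  obtain c where "\<And>x. x \<in> {0..1} \<Longrightarrow> f x = c"
    using has_vector_derivative_zero_constant[OF convex_closed_interval assms] by (metis)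
  then show ?thesis by simp
qed

lemma op_exp_line_derivative:
  "((\<lambda>s. op_exp (s *\<^sub>R X)) has_vector_derivative (X o\<^sub>L op_exp (t *\<^sub>R X))) (at t within S)"
proof -
  have "((\<lambda>s. s *\<^sub>R X) has_vector_derivative X) (at t within S)"
    unfolding has_vector_derivative_def by (auto intro!: derivative_eq_intros)
  then have "((\<lambda>s. op_exp (s *\<^sub>R X)) has_vector_derivative (op_exp (t *\<^sub>R X) o\<^sub>L X)) (at t within S)"
    by (rule op_exp_vector_derivative) (simp add: oL.scaleR_left oL.scaleR_right)
  moreover have "op_exp (t *\<^sub>R X) o\<^sub>L X = X o\<^sub>L op_exp (t *\<^sub>R X)"
    by (rule op_exp_commute[symmetric]) (simp add: oL.scaleR_left oL.scaleR_right)
  ultimately show ?thesis by simp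
qed

lemma oL_scaleR_commute: "(r *\<^sub>R X) o\<^sub>L (q *\<^sub>R X) = (q *\<^sub>R X) o\<^sub>L (r *\<^sub>R X)"
  by (simp add: oL.scaleR_left oL.scaleR_right mult.commute)

lemma oL_scaleR_commute1: "X o\<^sub>L (q *\<^sub>R X) = (q *\<^sub>R X) o\<^sub>L X"
  by (simp add: oL.scaleR_left oL.scaleR_right)

lemma scaled_line_derivative:
  "((\<lambda>t. (r + t * q) *\<^sub>R X) has_vector_derivative q *\<^sub>R X) (at t within S)"
  unfolding has_vector_derivative_def by (auto intro!: derivative_eq_intros simp: algebra_simps)

text \<open>The left-hand side, with \<open>t q\<close> in place of \<open>q\<close>, has derivative zero in \<open>t\<close>.  The identities that
relate \<open>op_exp\<close> and \<open>op_log\<close> below are obtained in the same way, by differentiating along a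
segment on which all operators commute.\<close>

lemma op_exp_add_scaled: "op_exp ((r + q) *\<^sub>R X) o\<^sub>L op_exp (- q *\<^sub>R X) = op_exp (r *\<^sub>R X)"
proof -
  define f where "f = (\<lambda>t. op_exp ((r + t * q) *\<^sub>R X) o\<^sub>L op_exp ((- (t * q)) *\<^sub>R X))"
  have "f 1 = f 0"
  proof (rule zero_vector_derivative_eq)
    fix t :: real
    let ?A = "op_exp ((r + t * q) *\<^sub>R X)" and ?B = "op_exp ((- (t * q)) *\<^sub>R X)"
    have 1: "((\<lambda>t. op_exp ((r + t * q) *\<^sub>R X)) has_vector_derivative (?A o\<^sub>L (q *\<^sub>R X))) (at t within {0..1})"
      by (rule op_exp_vector_derivative[OF scaled_line_derivative oL_scaleR_commute])
    have 2: "((\<lambda>t. op_exp ((- (t * q)) *\<^sub>R X)) has_vector_derivative (?B o\<^sub>L ((- q) *\<^sub>R X))) (at t within {0..1})"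
    proof (rule op_exp_vector_derivative)
      show "((\<lambda>t. (- (t * q)) *\<^sub>R X) has_vector_derivative (- q) *\<^sub>R X) (at t within {0..1})"
        using scaled_line_derivative[of 0 "- q" X t "{0..1}"] by simp
    qed (rule oL_scaleR_commute)
    have c: "?B o\<^sub>L X = X o\<^sub>L ?B"
      by (rule op_exp_commute[OF oL_scaleR_commute1, symmetric])
    have "(f has_vector_derivative (?A o\<^sub>L (?B o\<^sub>L ((- q) *\<^sub>R X))) + ((?A o\<^sub>L (q *\<^sub>R X)) o\<^sub>L ?B)) (at t within {0..1})"
      unfolding f_def by (rule bounded_bilinear.has_vector_derivative[OF bounded_bilinear_blinfun_compose 1 2])
    moreover have "(?A o\<^sub>L (?B o\<^sub>L ((- q) *\<^sub>R X))) + ((?A o\<^sub>L (q *\<^sub>R X)) o\<^sub>L ?B) = 0"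
      unfolding scaleR_minus_left oL.minus_right oL.scaleR_left oL.scaleR_right oL_assoc c[unfolded scaleR_minus_left]
      by (rule add.left_inverse)
    ultimately show "(f has_vector_derivative 0) (at t within {0..1})" by (simp only:)
  qed
  then show ?thesis by (simp add: f_def)
qed

lemma op_exp_minus_right: "op_exp X o\<^sub>L op_exp (- X) = id_blinfun"
  using op_exp_add_scaled[of 0 1 X] by simp

lemma op_exp_minus_left: "op_exp (- X) o\<^sub>L op_exp X = id_blinfun"
  using op_exp_minus_right[of "- X"] by simp

lemma op_exp_half: "op_exp X = op_exp ((1/2) *\<^sub>R X) o\<^sub>L op_exp ((1/2) *\<^sub>R X)"
proof -
  let ?H = "op_exp ((1/2) *\<^sub>R X)"
  have "op_exp X o\<^sub>L op_exp (- ((1/2) *\<^sub>R X)) = ?H"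
    using op_exp_add_scaled[of "1/2" "1/2" X] by simp
  then have "op_exp X o\<^sub>L (op_exp (- ((1/2) *\<^sub>R X)) o\<^sub>L ?H) = ?H o\<^sub>L ?H"
    by (simp add: oL_assoc[symmetric])
  then show ?thesis by (simp add: op_exp_minus_left)
qed

text \<open>This estimate fixes the size of all later balls: the exponential of an operator of norm at most
\<open>1/4\<close> has distance at most \<open>1/2\<close> from the identity.\<close>

lemma norm_op_exp_minus_id:
  assumes "norm X \<le> 1/2"
  shows "norm (op_exp X - id_blinfun) \<le> 2 * norm X"
proof -
  have "X \<in> conv_dom (\<lambda>n. 1 / fact n)" by (simp add: exp_dom)
  note sm = series_jet_summable[OF this, of "[]"]
  have s2: "summable (\<lambda>n. norm X ^ n /\<^sub>R fact n)" using summable_exp_generic[of "norm X"] by simp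
  have "op_exp X - id_blinfun = (\<Sum>n. (1 / fact (Suc n)) *\<^sub>R pow_jet (Suc n) X [])"
    unfolding op_exp_def op_series_def series_jet_def using suminf_split_head[OF sm] by simp
  also have "norm \<dots> \<le> (\<Sum>n. norm X ^ Suc n /\<^sub>R fact (Suc n))"
  proof (rule norm_suminf_le)
    show "norm ((1 / fact (Suc n)) *\<^sub>R pow_jet (Suc n) X []) \<le> norm X ^ Suc n /\<^sub>R fact (Suc n)" for n
      using mult_left_mono[OF norm_pow_le[of "Suc n" X], of "1 / fact (Suc n)"]
      by (simp add: divide_inverse del: pow_jet.simps fact_Suc)
    show "summable (\<lambda>n. norm X ^ Suc n /\<^sub>R fact (Suc n))" using s2 by (subst summable_Suc_iff)
  qed
  also have "\<dots> = exp (norm X) - 1"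
    unfolding exp_def using suminf_split_head[OF s2] by simp
  also have "\<dots> \<le> 2 * norm X"
    using real_exp_bound_lemma[of "norm X"] assms by (simp add: inverse_eq_divide)
  finally show ?thesis .
qed

lemma op_exp_log:
  assumes "norm (Y - id_blinfun) < 1"
  shows "op_exp (op_log Y) = Y"
proof -
  define Z where "Z = Y - id_blinfun"
  define c where "c = (\<lambda>t. id_blinfun + t *\<^sub>R Z)"
  define f where "f = (\<lambda>t. op_exp (- op_log (c t)) o\<^sub>L c t)"
  have n: "norm (t *\<^sub>R Z) < 1" if "t \<in> {0..1}" for t
    using that assms mult_left_le_one_le[of "norm Z" t] by (auto simp: Z_def)
  have "f 1 = f 0"
  proof (rule zero_vector_derivative_eq)
    fix t :: real assume t: "t \<in> {0..1}"
    let ?G = "op_geom (t *\<^sub>R Z)" and ?L = "op_log (c t)"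
    have cd: "(c has_vector_derivative Z) (at t within {0..1})"
      unfolding c_def has_vector_derivative_def by (auto intro!: derivative_eq_intros)
    have comm: "Z o\<^sub>L c t = c t o\<^sub>L Z"
      by (simp add: c_def oL.add_left oL.add_right oL.scaleR_left oL.scaleR_right)
    have nc: "norm (c t - id_blinfun) < 1" using n[OF t] by (simp add: c_def)
    have ld: "((\<lambda>s. op_log (c s)) has_vector_derivative (?G o\<^sub>L Z)) (at t within {0..1})"
      using op_log_vector_derivative[OF cd comm nc] by (simp add: c_def)
    have GZ: "Z o\<^sub>L ?G = ?G o\<^sub>L Z"
      by (rule op_series_commute[OF geom_dom[OF n[OF t]]]) (simp add: oL.scaleR_left oL.scaleR_right)
    have Gc: "?G o\<^sub>L c t = c t o\<^sub>L ?G"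
      using GZ by (simp add: c_def oL.add_left oL.add_right oL.scaleR_left oL.scaleR_right)
    have "(?G o\<^sub>L Z) o\<^sub>L c t = c t o\<^sub>L (?G o\<^sub>L Z)"
      by (metis Gc comm oL_assoc)
    then have "(?G o\<^sub>L Z) o\<^sub>L ?L = ?L o\<^sub>L (?G o\<^sub>L Z)"
      by (intro op_log_commute nc)
    then have ed: "((\<lambda>s. op_exp (- op_log (c s))) has_vector_derivative (op_exp (- ?L) o\<^sub>L - (?G o\<^sub>L Z))) (at t within {0..1})"
      by (intro op_exp_vector_derivative has_vector_derivative_minus ld) (simp add: oL.minus_left oL.minus_right)
    have "(f has_vector_derivative (op_exp (- ?L) o\<^sub>L Z) + ((op_exp (- ?L) o\<^sub>L - (?G o\<^sub>L Z)) o\<^sub>L c t)) (at t within {0..1})"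
      unfolding f_def by (rule bounded_bilinear.has_vector_derivative[OF bounded_bilinear_blinfun_compose ed cd])
    moreover have GZc: "(?G o\<^sub>L Z) o\<^sub>L c t = Z"
    proof -
      have "(?G o\<^sub>L Z) o\<^sub>L c t = Z o\<^sub>L (?G o\<^sub>L c t)" by (metis GZ oL_assoc)
      also have "?G o\<^sub>L c t = id_blinfun" unfolding c_def by (rule op_geom_inverse[OF n[OF t]])
      finally show ?thesis by simp
    qed
    have "(op_exp (- ?L) o\<^sub>L Z) + ((op_exp (- ?L) o\<^sub>L - (?G o\<^sub>L Z)) o\<^sub>L c t) = 0"
      unfolding oL_assoc[of "op_exp (- ?L)"] oL.minus_left GZc by (simp add: oL.minus_right)
    ultimately show "(f has_vector_derivative 0) (at t within {0..1})" by (simp only:)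
  qed
  then have "op_exp (- op_log Y) o\<^sub>L Y = id_blinfun" by (simp add: f_def c_def Z_def)
  then have "op_exp (op_log Y) o\<^sub>L (op_exp (- op_log Y) o\<^sub>L Y) = op_exp (op_log Y)" by simp
  then show ?thesis by (simp add: oL_assoc[symmetric] op_exp_minus_right)
qed

lemma op_log_exp:
  assumes "norm X \<le> 1/4"
  shows "op_log (op_exp X) = X"
proof -
  define f where "f = (\<lambda>t. op_log (op_exp (t *\<^sub>R X)) - t *\<^sub>R X)"
  have "f 1 = f 0"
  proof (rule zero_vector_derivative_eq)
    fix t :: real assume t: "t \<in> {0..1}"
    let ?E = "op_exp (t *\<^sub>R X)"
    have "norm (t *\<^sub>R X) \<le> 1/4"
    proof -
      have "t * norm X \<le> norm X" using t by (intro mult_left_le_one_le) auto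
      then show ?thesis using t assms by simp
    qed
    then have n: "norm (?E - id_blinfun) < 1" using norm_op_exp_minus_id[of "t *\<^sub>R X"] by linarith
    have cX: "X o\<^sub>L ?E = ?E o\<^sub>L X"
      by (rule op_exp_commute) (simp add: oL.scaleR_left oL.scaleR_right)
    have "((\<lambda>s. op_log (op_exp (s *\<^sub>R X))) has_vector_derivative
        (op_geom (?E - id_blinfun) o\<^sub>L (X o\<^sub>L ?E))) (at t within {0..1})"
      by (rule op_log_vector_derivative[OF op_exp_line_derivative _ n]) (simp only: cX oL_assoc)
    moreover have "op_geom (?E - id_blinfun) o\<^sub>L (X o\<^sub>L ?E) = X"
      using op_geom_inverse[OF n] unfolding cX oL_assoc[symmetric] by simp
    ultimately have "((\<lambda>s. op_log (op_exp (s *\<^sub>R X))) has_vector_derivative X) (at t within {0..1})"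
      by (simp only:)
    moreover have "((\<lambda>s. s *\<^sub>R X) has_vector_derivative X) (at t within {0..1})"
      unfolding has_vector_derivative_def by (auto intro!: derivative_eq_intros)
    ultimately have "(f has_vector_derivative X - X) (at t within {0..1})"
      unfolding f_def by (rule has_vector_derivative_diff)
    then show "(f has_vector_derivative 0) (at t within {0..1})" by simp
  qed
  then show ?thesis by (simp add: f_def)
qed

section \<open>The bounded inverse theorem\<close>

text \<open>By Baire's theorem the closure of the image of some ball has interior points.  Hence every \<open>z\<close>
can be approximated, up to an error of half its norm, by \<open>f x\<close> with \<open>\<parallel>x\<parallel> \<le> K \<parallel>z\<parallel>\<close>; correcting the
error repeatedly gives a preimage as the sum of a geometrically convergent series.\<close>

lemma bounded_inverse:
  fixes f :: "'a::banach \<Rightarrow>\<^sub>L 'b::banach"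
  assumes "bij (blinfun_apply f)"
  shows "bounded_linear (inv_into UNIV (blinfun_apply f))"
proof -
  let ?f = "blinfun_apply f"
  have inj: "inj ?f" and surj: "surj ?f" using assms by (auto simp: bij_def)
  define A where "A = (\<lambda>n::nat. closure (?f ` cball 0 (real n)))"
  have "\<exists>n. interior (A n) \<noteq> {}"
  proof (rule ccontr)
    assume "\<not> ?thesis"
    then have "euclidean interior_of \<Union>(range A) = {}"
      by (intro Baire_category_alt) (auto simp: A_def completely_metrizable_space_euclidean)
    moreover have "y \<in> \<Union>(range A)" for y
    proof -
      obtain x where "y = f x" using surj by blast
      moreover obtain n :: nat where "norm x \<le> n" using real_arch_simple by blast
      ultimately have "y \<in> A n" unfolding A_def using closure_subset by fastforce
      then show ?thesis by blast
    qed
    then have "\<Union>(range A) = UNIV" by blast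
    ultimately show False by simp
  qed
  then obtain n y where "y \<in> interior (A n)" by blast
  then obtain \<epsilon> where \<epsilon>: "\<epsilon> > 0" "ball y \<epsilon> \<subseteq> A n" unfolding mem_interior by blast
  have near: "\<exists>x. norm x \<le> 2 * real n \<and> norm (f x - z) < \<eta>" if z: "norm z < \<epsilon>" and \<eta>: "\<eta> > 0" for z \<eta>
  proof -
    have "y + z \<in> A n" "y \<in> A n" using \<epsilon> z by (auto simp: dist_norm subset_iff)
    moreover have approx: "\<exists>a. norm a \<le> n \<and> norm (f a - v) < \<eta>/2" if v: "v \<in> A n" for v
    proof -
      have "\<eta>/2 > 0" using \<eta> by simp
      then obtain u where "u \<in> ?f ` cball 0 n" "dist u v < \<eta>/2"
        using v unfolding A_def closure_approachable by blast
      then show ?thesis by (auto simp: dist_norm)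
    qed
    ultimately obtain a b where ab: "norm a \<le> n" "norm (f a - (y + z)) < \<eta>/2"
      "norm b \<le> n" "norm (f b - y) < \<eta>/2" by meson
    have "norm (a - b) \<le> 2 * real n" using ab norm_triangle_ineq4[of a b] by linarith
    moreover have eq: "f (a - b) - z = (f a - (y + z)) - (f b - y)" by (simp add: blinfun.diff_right)
    have "norm (f (a - b) - z) < \<eta>"
      unfolding eq using ab norm_triangle_ineq4[of "f a - (y + z)" "f b - y"] by linarith
    ultimately show ?thesis by blast
  qed
  \<comment> \<open>\<open>z\<close> is rescaled to norm \<open>\<epsilon> / 2\<close>, where a vector of norm at most \<open>2 n\<close> serves.\<close>
  define K where "K = 4 * real n / \<epsilon>"
  have K: "K \<ge> 0" using \<epsilon> by (simp add: K_def)
  have "\<exists>x. norm x \<le> K * norm z \<and> norm (z - f x) \<le> norm z / 2" for z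
  proof (cases "z = 0")
    case True
    then show ?thesis by (intro exI[of _ 0]) simp
  next
    case False
    define c where "c = \<epsilon> / (2 * norm z)"
    have c: "c > 0" using False \<epsilon> by (simp add: c_def)
    have "norm (c *\<^sub>R z) < \<epsilon>" using False \<epsilon> c by (simp add: c_def)
    from near[OF this, of "c * norm z / 2"] c False
    obtain x where x: "norm x \<le> 2 * real n" "norm (f x - c *\<^sub>R z) < c * norm z / 2" by auto
    have eq: "f (x /\<^sub>R c) - z = (f x - c *\<^sub>R z) /\<^sub>R c"
      using c by (simp add: blinfun.scaleR_right scaleR_diff_right)
    have "norm (f (x /\<^sub>R c) - z) = norm (f x - c *\<^sub>R z) / c"
      unfolding eq using c by (simp add: divide_inverse mult.commute)
    then have "norm (z - f (x /\<^sub>R c)) \<le> norm z / 2"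
      using x(2) c by (simp add: norm_minus_commute pos_divide_le_eq mult.commute)
    moreover have "norm (x /\<^sub>R c) \<le> K * norm z"
      using x(1) c False \<epsilon> by (simp add: K_def c_def field_simps)
    ultimately show ?thesis by blast
  qed
  then obtain h where h: "\<And>z. norm (h z) \<le> K * norm z" "\<And>z. norm (z - f (h z)) \<le> norm z / 2"
    by metis
  have inv_bound: "norm (inv_into UNIV ?f z) \<le> norm z * (2 * K)" for z
  proof -
    define w where "w = (\<lambda>k. ((\<lambda>z. z - f (h z)) ^^ k) z)"
    have w_Suc: "w (Suc k) = w k - f (h (w k))" for k by (simp add: w_def)
    have w: "norm (w k) \<le> norm z * (1/2) ^ k" for k
    proof (induction k)
      case (Suc k)
      then show ?case using h(2)[of "w k"] by (simp add: w_Suc)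
    qed (simp add: w_def)
    have hw: "norm (h (w k)) \<le> (K * norm z) * (1/2) ^ k" for k
      using order_trans[OF h(1) mult_left_mono[OF w K]] by (simp add: mult.assoc)
    have geo: "summable (\<lambda>k. (K * norm z) * (1/2::real) ^ k)"
      by (intro summable_mult summable_geometric) simp
    have sm: "summable (\<lambda>k. h (w k))" by (rule summable_comparison_test'[OF geo hw])
    define x where "x = (\<Sum>k. h (w k))"
    have "norm x \<le> (\<Sum>k. (K * norm z) * (1/2::real) ^ k)"
      unfolding x_def by (rule norm_suminf_le[OF hw geo])
    also have "\<dots> = (K * norm z) * 2"
      using suminf_geometric[of "1/2::real"] suminf_mult[OF summable_geometric[of "1/2::real"], of "K * norm z"] by simp
    finally have xb: "norm x \<le> norm z * (2 * K)" by (simp add: mult_ac)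
    have "w \<longlonglongrightarrow> 0"
    proof (rule Lim_null_comparison)
      show "\<forall>\<^sub>F k in sequentially. norm (w k) \<le> norm z * (1/2) ^ k" using w by simp
      have "(\<lambda>k. norm z * (1/2::real) ^ k) \<longlonglongrightarrow> norm z * 0"
        by (intro tendsto_mult_left LIMSEQ_power_zero) simp
      then show "(\<lambda>k. norm z * (1/2::real) ^ k) \<longlonglongrightarrow> 0" by simp
    qed
    then have "(\<lambda>k. w k - w (Suc k)) sums (w 0 - 0)" by (rule telescope_sums')
    then have "(\<lambda>k. f (h (w k))) sums z" by (simp add: w_Suc) (simp add: w_def)
    moreover have "(\<lambda>k. f (h (w k))) sums f x"
      unfolding x_def by (rule bounded_linear.sums[OF blinfun.bounded_linear_right summable_sums[OF sm]])
    ultimately have "f x = z" by (metis sums_unique2)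
    then show ?thesis using xb inj by (metis inv_f_f)
  qed
  show ?thesis
  proof (rule bounded_linear_intro[where K = "2 * K"])
    show "inv_into UNIV ?f (a + b) = inv_into UNIV ?f a + inv_into UNIV ?f b" for a b
      by (rule inv_f_eq[OF inj]) (simp add: blinfun.add_right surj_f_inv_f[OF surj])
    show "inv_into UNIV ?f (r *\<^sub>R a) = r *\<^sub>R inv_into UNIV ?f a" for r a
      by (rule inv_f_eq[OF inj]) (simp add: blinfun.scaleR_right surj_f_inv_f[OF surj])
  qed (rule inv_bound)
qed

section \<open>Automorphisms and derivations\<close>

definition scaleC_op :: "complex \<Rightarrow> ('a::cstar_algebra \<Rightarrow>\<^sub>L 'a)" where
  "scaleC_op c = Blinfun ((*\<^sub>C) c)"

definition adj_op :: "'a::cstar_algebra \<Rightarrow>\<^sub>L 'a" where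
  "adj_op = Blinfun adj"

lemma scaleC_op_apply [simp]: "scaleC_op c x = c *\<^sub>C x"
  by (simp add: scaleC_op_def bounded_linear_Blinfun_apply bounded_linear_scaleC)

lemma adj_op_apply [simp]: "adj_op x = adj x"
  by (simp add: adj_op_def bounded_linear_Blinfun_apply bounded_linear_adj)

definition multiplicative :: "('a::real_normed_algebra \<Rightarrow>\<^sub>L 'a) \<Rightarrow> bool" where
  "multiplicative T \<longleftrightarrow> (\<forall>x y. T (x * y) = T x * T y)"

text \<open>In this form all conditions but bijectivity and multiplicativity say that \<open>T\<close> commutes with a
fixed operator, which power series in \<open>T\<close> inherit.  The operators on both sides are real-linear,
so that conjugate-linear \<open>adj_op\<close> is admitted.\<close>

lemma mem_Aut_iff:
  "T \<in> carrier Aut \<longleftrightarrow> bij (blinfun_apply T) \<and> multiplicative T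
     \<and> (\<forall>c. scaleC_op c o\<^sub>L T = T o\<^sub>L scaleC_op c) \<and> adj_op o\<^sub>L T = T o\<^sub>L adj_op"
  unfolding Aut_def star_automorphism_def multiplicative_def
  by (auto simp: blinfun.add_right fun_eq_iff simp flip: blinfun_apply_inject)

lemma mem_symmetric_derivations_iff:
  "\<delta> \<in> symmetric_derivations \<longleftrightarrow> (\<forall>x y. \<delta> (x * y) = \<delta> x * y + x * \<delta> y)
     \<and> (\<forall>c. scaleC_op c o\<^sub>L \<delta> = \<delta> o\<^sub>L scaleC_op c) \<and> adj_op o\<^sub>L \<delta> = \<delta> o\<^sub>L adj_op"
  unfolding symmetric_derivations_def
  by (auto simp: fun_eq_iff simp flip: blinfun_apply_inject)

lemma apply_vector_derivative:
  fixes T :: "real \<Rightarrow> ('a::real_normed_vector \<Rightarrow>\<^sub>L 'b::real_normed_vector)"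
  assumes "(T has_vector_derivative T') (at t within S)"
  shows "((\<lambda>s. T s x) has_vector_derivative T' x) (at t within S)"
  by (rule bounded_linear.has_vector_derivative[OF blinfun.bounded_linear_left assms])

text \<open>The derivation rule makes \<open>t \<mapsto> exp (- t \<delta>) (exp (t \<delta>) x * exp (t \<delta>) y)\<close> constant.\<close>

lemma op_exp_multiplicative:
  fixes \<delta> :: "'a::{real_normed_algebra, banach} \<Rightarrow>\<^sub>L 'a"
  assumes d: "\<And>x y. \<delta> (x * y) = \<delta> x * y + x * \<delta> y"
  shows "multiplicative (op_exp \<delta>)"
  unfolding multiplicative_def
proof (intro allI)
  fix x y
  define E where "E = (\<lambda>t. op_exp (t *\<^sub>R \<delta>))"
  define g where "g = (\<lambda>t. E t x * E t y)"
  define f where "f = (\<lambda>t. E (- t) (g t))"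
  have Ed: "(E has_vector_derivative (\<delta> o\<^sub>L E t)) (at t within S)" for t S
    unfolding E_def by (rule op_exp_line_derivative)
  have "f 1 = f 0"
  proof (rule zero_vector_derivative_eq)
    fix t :: real
    have gd: "(g has_vector_derivative \<delta> (g t)) (at t within {0..1})"
    proof -
      have "(g has_vector_derivative E t x * (\<delta> o\<^sub>L E t) y + (\<delta> o\<^sub>L E t) x * E t y) (at t within {0..1})"
        unfolding g_def
        by (rule bounded_bilinear.has_vector_derivative[OF bounded_bilinear_mult
              apply_vector_derivative[OF Ed] apply_vector_derivative[OF Ed]])
      then show ?thesis by (simp add: g_def d add.commute)
    qed
    have "((\<lambda>t. E (- t)) has_vector_derivative (- \<delta> o\<^sub>L E (- t))) (at t within {0..1})"
      unfolding E_def using op_exp_line_derivative[of "- \<delta>" t "{0..1}"] by simp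
    from bounded_bilinear.has_vector_derivative[OF bounded_bilinear_blinfun_apply this gd]
    have "(f has_vector_derivative E (- t) (\<delta> (g t)) + (- \<delta> o\<^sub>L E (- t)) (g t)) (at t within {0..1})"
      unfolding f_def .
    moreover have "\<delta> o\<^sub>L E (- t) = E (- t) o\<^sub>L \<delta>"
      unfolding E_def by (rule op_exp_commute[OF oL_scaleR_commute1])
    then have "E (- t) (\<delta> (g t)) + (- \<delta> o\<^sub>L E (- t)) (g t) = 0"
      by (metis blinfun_apply_blinfun_compose blinfun.minus_left add.right_inverse)
    ultimately show "(f has_vector_derivative 0) (at t within {0..1})" by (simp only:)
  qed
  then have "op_exp (- \<delta>) (op_exp \<delta> x * op_exp \<delta> y) = x * y"
    by (simp add: f_def g_def E_def)
  then have "op_exp \<delta> (op_exp (- \<delta>) (op_exp \<delta> x * op_exp \<delta> y)) = op_exp \<delta> (x * y)" by simp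
  then show "op_exp \<delta> (x * y) = op_exp \<delta> x * op_exp \<delta> y"
    by (metis op_exp_minus_right blinfun_apply_blinfun_compose blinfun_apply_id_blinfun)
qed

lemma bij_op_exp: "bij (blinfun_apply (op_exp X))"
proof (rule bij_betw_byWitness[where f' = "blinfun_apply (op_exp (- X))"])
  show "\<forall>x\<in>UNIV. op_exp (- X) (op_exp X x) = x"
    by (metis op_exp_minus_left blinfun_apply_blinfun_compose blinfun_apply_id_blinfun)
  show "\<forall>x\<in>UNIV. op_exp X (op_exp (- X) x) = x"
    by (metis op_exp_minus_right blinfun_apply_blinfun_compose blinfun_apply_id_blinfun)
qed auto

lemma op_exp_in_Aut:
  assumes "\<delta> \<in> symmetric_derivations"
  shows "op_exp \<delta> \<in> carrier Aut"
  using assms unfolding mem_Aut_iff mem_symmetric_derivations_iff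
  by (auto intro!: bij_op_exp op_exp_multiplicative op_exp_commute)

text \<open>The defect \<open>d x y = R (x * y) - R x * R y\<close> satisfies \<open>R (d x y) = - d (R x) (R y)\<close> as \<open>R\<^sup>2\<close> is
multiplicative.  With \<open>R\<close> near the identity, \<open>d\<close> is therefore nearly equal to \<open>- d\<close>; this improves any
bound of \<open>d\<close> by a constant factor, so that \<open>d\<close> vanishes.\<close>

lemma multiplicative_sqrt:
  fixes R :: "'a::real_normed_algebra \<Rightarrow>\<^sub>L 'a"
  assumes T: "multiplicative (R o\<^sub>L R)" and R: "norm (R - id_blinfun) \<le> 1/2"
  shows "multiplicative R"
  unfolding multiplicative_def
proof (intro allI)
  fix x0 y0 :: 'a
  define d where "d = (\<lambda>x y. R (x * y) - R x * R y)"
  define K where "K = norm R + norm R * norm R"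
  have R1: "norm (R x - x) \<le> norm x / 2" for x
    using order_trans[OF norm_blinfun[of "R - id_blinfun" x] mult_right_mono[OF R norm_ge_zero]]
    by (simp add: blinfun.diff_left)
  have R2: "norm (R x) \<le> 3/2 * norm x" for x
    using R1[of x] norm_triangle_ineq2[of "R x" x] by linarith
  have flip: "R (d x y) = - d (R x) (R y)" for x y
  proof -
    have "R (R (x * y)) = R (R x) * R (R y)" using T by (simp add: multiplicative_def)
    then show ?thesis by (simp add: d_def blinfun.diff_right)
  qed
  have bound: "norm (d x y) \<le> K * (7/8) ^ n * (norm x * norm y)" for n x y
  proof (induction n arbitrary: x y)
    case 0
    have "norm (R (x * y)) \<le> norm R * (norm x * norm y)"
      by (rule order_trans[OF norm_blinfun mult_left_mono[OF norm_mult_ineq]]) simp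
    moreover have "norm (R x * R y) \<le> (norm R * norm x) * (norm R * norm y)"
      by (rule order_trans[OF norm_mult_ineq mult_mono]) (auto intro: norm_blinfun)
    ultimately show ?case
      using norm_triangle_ineq4[of "R (x * y)" "R x * R y"] by (simp add: d_def K_def algebra_simps)
  next
    case (Suc n)
    let ?k = "K * (7/8) ^ n"
    have k: "?k \<ge> 0" by (simp add: K_def)
    have lin: "d x y - d (R x) (R y) = d (x - R x) y + d (R x) (y - R y)"
      by (simp add: d_def blinfun.diff_right algebra_simps)
    have 1: "norm (d (x - R x) y) \<le> ?k * (norm x / 2 * norm y)"
    proof (rule order_trans[OF Suc.IH mult_left_mono[OF _ k]])
      show "norm (x - R x) * norm y \<le> norm x / 2 * norm y"
        using R1[of x] by (intro mult_right_mono) (simp_all add: norm_minus_commute)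
    qed
    have 2: "norm (d (R x) (y - R y)) \<le> ?k * ((3/2 * norm x) * (norm y / 2))"
    proof (rule order_trans[OF Suc.IH mult_left_mono[OF _ k]])
      show "norm (R x) * norm (y - R y) \<le> (3/2 * norm x) * (norm y / 2)"
        using R1[of y] R2[of x] by (intro mult_mono) (simp_all add: norm_minus_commute)
    qed
    have 3: "norm (d x y - R (d x y)) \<le> ?k * (norm x * norm y) / 2"
      using R1[of "d x y"] Suc.IH[of x y] by (simp add: norm_minus_commute)
    \<comment> \<open>The three estimates add up to \<open>1/2 + 3/4 + 1/2 = 7/4\<close> times the old bound.\<close>
    have "2 *\<^sub>R d x y = (d (x - R x) y + d (R x) (y - R y)) + (d x y - R (d x y))"
      unfolding lin[symmetric] flip by (simp add: scaleR_2)
    then have "norm (2 *\<^sub>R d x y) \<le> norm (d (x - R x) y) + norm (d (R x) (y - R y)) + norm (d x y - R (d x y))"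
      by (metis norm_triangle_le norm_triangle_ineq add_mono order_refl)
    then have "2 * norm (d x y) \<le> ?k * (7/4) * (norm x * norm y)"
      using 1 2 3 by (simp add: algebra_simps)
    then show ?case by (simp add: algebra_simps)
  qed
  have "(\<lambda>n. K * (7/8) ^ n * (norm x0 * norm y0)) \<longlonglongrightarrow> K * 0 * (norm x0 * norm y0)"
    by (intro tendsto_mult_left tendsto_mult_right LIMSEQ_power_zero) simp
  then have "norm (d x0 y0) \<le> K * 0 * (norm x0 * norm y0)"
    by (rule LIMSEQ_le_const) (use bound in blast)
  then show "R (x0 * y0) = R x0 * R y0" by (simp add: d_def)
qed

lemma difference_quotient:
  fixes g :: "real \<Rightarrow> 'b::real_normed_vector"
  assumes "(g has_vector_derivative g') (at 0)"
  shows "((\<lambda>t. (g t - g 0) /\<^sub>R t) \<longlongrightarrow> g') (at 0)"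
proof -
  have "((\<lambda>y. norm (g y - g 0 - (y - 0) *\<^sub>R g') / norm (y - 0)) \<longlongrightarrow> 0) (at 0)"
    using assms unfolding has_vector_derivative_def has_derivative_iff_norm by simp
  moreover have "\<forall>\<^sub>F t in at 0. norm (g t - g 0 - (t - 0) *\<^sub>R g') / norm (t - 0) = norm ((g t - g 0) /\<^sub>R t - g')"
  proof -
    have "norm (g t - g 0 - (t - 0) *\<^sub>R g') / norm (t - 0) = norm ((g t - g 0) /\<^sub>R t - g')" if "t \<noteq> 0" for t
    proof -
      have "(g t - g 0) /\<^sub>R t - g' = (g t - g 0 - (t - 0) *\<^sub>R g') /\<^sub>R t"
        using that by (simp add: scaleR_diff_right)
      then show ?thesis by (simp add: divide_inverse mult.commute)
    qed
    then show ?thesis by (simp add: eventually_at_filter)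
  qed
  ultimately have "((\<lambda>t. norm ((g t - g 0) /\<^sub>R t - g')) \<longlongrightarrow> 0) (at 0)"
    by (rule Lim_transform_eventually)
  then have "((\<lambda>t. (g t - g 0) /\<^sub>R t - g') \<longlongrightarrow> 0) (at 0)" by (simp only: tendsto_norm_zero_iff)
  then show ?thesis by (simp only: LIM_zero_iff)
qed

lemma has_vector_derivative_zero_seq:
  fixes g :: "real \<Rightarrow> 'b::real_normed_vector"
  assumes g: "(g has_vector_derivative g') (at 0)" and s: "s \<longlonglongrightarrow> 0" "\<And>n. s n \<noteq> 0"
    and z: "\<And>n. g (s n) = 0" "g 0 = 0"
  shows "g' = 0"
proof -
  have "filterlim s (at 0) sequentially"
    using s by (simp add: filterlim_at)
  from filterlim_compose[OF difference_quotient[OF g] this]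
  have "(\<lambda>n::nat. 0) \<longlonglongrightarrow> g'" by (simp add: z)
  then show ?thesis by (simp add: LIMSEQ_const_iff)
qed

text \<open>By repeated square roots the operators \<open>exp (D / 2\<^sup>n)\<close> are all multiplicative.  So the curve
\<open>exp (t D) (x * y) - exp (t D) x * exp (t D) y\<close> vanishes along a sequence that tends to \<open>0\<close>, and its
derivative at \<open>0\<close> is zero.\<close>

lemma op_exp_multiplicative_imp_derivation:
  fixes D :: "'a::{real_normed_algebra, banach} \<Rightarrow>\<^sub>L 'a"
  assumes D: "norm D \<le> 1/4" and m: "multiplicative (op_exp D)"
  shows "D (x * y) = D x * y + x * D y"
proof -
  define s where "s = (\<lambda>n::nat. (1/2::real) ^ n)"
  have mult: "multiplicative (op_exp (s n *\<^sub>R D))" for n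
  proof (induction n)
    case 0
    then show ?case using m by (simp add: s_def)
  next
    case (Suc n)
    let ?R = "op_exp (s (Suc n) *\<^sub>R D)"
    have "(1/2) *\<^sub>R s n *\<^sub>R D = s (Suc n) *\<^sub>R D" by (simp add: s_def)
    then have "op_exp (s n *\<^sub>R D) = ?R o\<^sub>L ?R" using op_exp_half[of "s n *\<^sub>R D"] by metis
    moreover have "norm (?R - id_blinfun) \<le> 1/2"
    proof -
      have "s (Suc n) \<le> 1" "s (Suc n) \<ge> 0" by (auto simp: s_def power_le_one simp del: power_Suc)
      then have "norm (s (Suc n) *\<^sub>R D) \<le> norm D" by (simp add: mult_left_le_one_le)
      with D have "norm (s (Suc n) *\<^sub>R D) \<le> 1/4" by linarith
      then show ?thesis using norm_op_exp_minus_id[of "s (Suc n) *\<^sub>R D"] by linarith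
    qed
    ultimately show ?case using multiplicative_sqrt Suc by metis
  qed
  define E where "E = (\<lambda>t. op_exp (t *\<^sub>R D))"
  have Ed: "(E has_vector_derivative D) (at 0)"
    unfolding E_def using op_exp_line_derivative[of D 0] by simp
  define g where "g = (\<lambda>t. E t (x * y) - E t x * E t y)"
  have "(g has_vector_derivative D (x * y) - (E 0 x * D y + D x * E 0 y)) (at 0)"
    unfolding g_def
    by (intro has_vector_derivative_diff has_vector_derivative_mult apply_vector_derivative Ed)
  moreover have "s \<longlonglongrightarrow> 0" unfolding s_def by (intro LIMSEQ_power_zero) simp
  moreover have "s n \<noteq> 0" for n by (simp add: s_def)
  moreover have "g (s n) = 0" for n
    using mult[of n] by (simp add: g_def E_def multiplicative_def)
  moreover have "g 0 = 0" by (simp add: g_def E_def)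
  ultimately have "D (x * y) - (E 0 x * D y + D x * E 0 y) = 0"
    by (rule has_vector_derivative_zero_seq)
  then show ?thesis by (simp add: E_def add.commute)
qed

lemma op_log_symmetric_derivation:
  assumes T: "T \<in> carrier Aut" and n: "norm (T - id_blinfun) < 1" and l: "norm (op_log T) \<le> 1/4"
  shows "op_log T \<in> symmetric_derivations"
proof -
  have "multiplicative (op_exp (op_log T))" using T by (simp add: op_exp_log[OF n] mem_Aut_iff)
  then show ?thesis
    unfolding mem_symmetric_derivations_iff
    using op_exp_multiplicative_imp_derivation[OF l] T op_log_commute[OF n]
    by (simp add: mem_Aut_iff)
qed

lemma Aut_simps [simp]: "mult Aut S T = S o\<^sub>L T" "one Aut = id_blinfun"
  by (simp_all add: Aut_def)

lemma Aut_group: "group (Aut :: ('a::cstar_algebra \<Rightarrow>\<^sub>L 'a) monoid)"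
proof (rule groupI)
  fix S T :: "'a \<Rightarrow>\<^sub>L 'a" assume S: "S \<in> carrier Aut" and T: "T \<in> carrier Aut"
  have "bij (blinfun_apply (S o\<^sub>L T))"
    using bij_comp[of "blinfun_apply T" "blinfun_apply S"] S T
    by (simp add: mem_Aut_iff blinfun_compose.rep_eq)
  moreover have "multiplicative (S o\<^sub>L T)" using S T by (simp add: mem_Aut_iff multiplicative_def)
  ultimately show "S \<otimes>\<^bsub>Aut\<^esub> T \<in> carrier Aut"
    using S T by (simp add: mem_Aut_iff) (metis oL_assoc)
next
  show "\<one>\<^bsub>Aut\<^esub> \<in> carrier (Aut :: ('a \<Rightarrow>\<^sub>L 'a) monoid)"
    by (simp add: mem_Aut_iff multiplicative_def id_def[symmetric])
next
  fix T :: "'a \<Rightarrow>\<^sub>L 'a" assume T: "T \<in> carrier Aut"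
  then have b: "bij (blinfun_apply T)" by (simp add: mem_Aut_iff)
  define S where "S = Blinfun (inv_into UNIV (blinfun_apply T))"
  have S: "blinfun_apply S = inv_into UNIV (blinfun_apply T)"
    unfolding S_def by (rule bounded_linear_Blinfun_apply[OF bounded_inverse[OF b]])
  have ST: "S o\<^sub>L T = id_blinfun" and TS: "T o\<^sub>L S = id_blinfun"
    using b by (auto intro!: blinfun_eqI simp: S bij_is_inj bij_is_surj surj_f_inv_f)
  have comm: "X o\<^sub>L S = S o\<^sub>L X" if "X o\<^sub>L T = T o\<^sub>L X" for X
  proof -
    have "S o\<^sub>L (X o\<^sub>L T) o\<^sub>L S = S o\<^sub>L (T o\<^sub>L X) o\<^sub>L S" using that by simp
    then show ?thesis using ST TS by (metis oL_assoc oL_id)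
  qed
  have inj: "T x = T y \<Longrightarrow> x = y" for x y using b by (auto simp: bij_def inj_def)
  have TSx: "T (S x) = x" for x using b by (simp add: S bij_is_surj surj_f_inv_f)
  have "multiplicative S" unfolding multiplicative_def
  proof (intro allI)
    fix x y
    have "T (S (x * y)) = T (S x * S y)" using T by (simp add: TSx mem_Aut_iff multiplicative_def)
    then show "S (x * y) = S x * S y" by (rule inj)
  qed
  then have "S \<in> carrier Aut"
    using T comm b by (simp add: mem_Aut_iff S bij_imp_bij_inv)
  then show "\<exists>S\<in>carrier Aut. S \<otimes>\<^bsub>Aut\<^esub> T = \<one>\<^bsub>Aut\<^esub>" using ST by auto
qed (auto simp: oL_assoc)

section \<open>Smooth maps into the symmetric derivations\<close>

lemma bounded_linear_of_sym_deriv: "bounded_linear of_sym_deriv"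
  by (rule bounded_linear_intro[where K = 1]) (simp_all add: of_sym_deriv_simps norm_sym_deriv_def)

lemma line_vector_derivative:
  assumes "(f has_derivative f') (at x)"
  shows "((\<lambda>t::real. f (x + t *\<^sub>R v)) has_vector_derivative f' v) (at 0)"
proof -
  have "((\<lambda>t::real. x + t *\<^sub>R v) has_derivative (\<lambda>t. t *\<^sub>R v)) (at 0)"
    by (auto intro!: derivative_eq_intros)
  moreover have "(f has_derivative f') (at (x + 0 *\<^sub>R v))" using assms by simp
  ultimately have "((\<lambda>t. f (x + t *\<^sub>R v)) has_derivative (\<lambda>t. f' (t *\<^sub>R v))) (at 0)"
    by (rule has_derivative_compose)
  then show ?thesis
    unfolding has_vector_derivative_def linear_scale[OF has_derivative_linear[OF assms]] .
qed

lemma derivative_in_closed_subspace: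
  assumes f: "(f has_derivative f') (at x)" and U: "open U" "x \<in> U"
    and S: "closed S" "subspace S" and fS: "\<And>y. y \<in> U \<Longrightarrow> f y \<in> S"
  shows "f' v \<in> S"
proof (rule Lim_in_closed_set[OF S(1) _ _ difference_quotient[OF line_vector_derivative[OF f]]])
  have "((\<lambda>t::real. x + t *\<^sub>R v) \<longlongrightarrow> x + 0 *\<^sub>R v) (at 0)" by (intro tendsto_intros)
  then have "\<forall>\<^sub>F t::real in at 0. x + t *\<^sub>R v \<in> U" using U by (auto dest: topological_tendstoD)
  then show "\<forall>\<^sub>F t in at 0. (f (x + t *\<^sub>R v) - f (x + 0 *\<^sub>R v)) /\<^sub>R t \<in> S"
  proof eventually_elim
    case (elim t)
    then show ?case using fS U(2) by (intro subspace_scale subspace_diff S(2)) auto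
  qed
qed simp

text \<open>The inclusion is isometric, so it reflects differentiability.\<close>

lemma has_derivative_of_sym_deriv:
  assumes "((\<lambda>y. of_sym_deriv (g y)) has_derivative (\<lambda>u. of_sym_deriv (g' u))) (at x)"
  shows "(g has_derivative g') (at x)"
proof -
  have bl: "bounded_linear (\<lambda>u. of_sym_deriv (g' u))"
    using assms by (rule has_derivative_bounded_linear)
  obtain K where "\<And>u. norm (of_sym_deriv (g' u)) \<le> norm u * K"
    using bounded_linear.bounded[OF bl] by blast
  moreover have "g' (a + b) = g' a + g' b" for a b
    using linear_add[OF bounded_linear.linear[OF bl]] by (simp add: of_sym_deriv_inject flip: of_sym_deriv_simps)
  moreover have "g' (r *\<^sub>R a) = r *\<^sub>R g' a" for r a
    using linear_scale[OF bounded_linear.linear[OF bl]] by (simp add: of_sym_deriv_inject flip: of_sym_deriv_simps)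
  ultimately have "bounded_linear g'"
    by (intro bounded_linear_intro[where K = K]) (auto simp: norm_sym_deriv_def)
  then show ?thesis
    using assms unfolding has_derivative_at_alt by (simp add: norm_sym_deriv_def of_sym_deriv_simps)
qed

text \<open>All derivatives are limits of difference quotients and thus stay in the closed subspace of
symmetric derivations.\<close>

lemma smooth_on_Sym_Deriv:
  assumes f: "smooth_on U f" and S: "\<And>x. x \<in> U \<Longrightarrow> f x \<in> symmetric_derivations"
  shows "smooth_on U (\<lambda>x. Sym_Deriv (f x))"
proof -
  obtain D where D: "jet U D" "\<And>x. x \<in> U \<Longrightarrow> D x [] = f x"
    using smooth_on_imp_jet[OF f] by blast
  have U: "open U" using f by (rule smooth_on_open)
  have DS: "x \<in> U \<Longrightarrow> D x vs \<in> symmetric_derivations" for x vs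
  proof (induction vs arbitrary: x)
    case Nil
    then show ?case using D(2) S by simp
  next
    case (Cons v vs)
    show ?case
      by (rule derivative_in_closed_subspace[OF jet_has_derivative[OF D(1) Cons.prems] U Cons.prems
            closed_symmetric_derivations subspace_symmetric_derivations Cons.IH])
  qed
  have "jet U (\<lambda>x vs. Sym_Deriv (D x vs))" unfolding jet_def
  proof (intro conjI ballI allI U)
    fix x vs assume x: "x \<in> U"
    show "((\<lambda>y. Sym_Deriv (D y vs)) has_derivative (\<lambda>u. Sym_Deriv (D x (u # vs)))) (at x)"
    proof (rule has_derivative_of_sym_deriv)
      have eq: "(\<lambda>u. of_sym_deriv (Sym_Deriv (D x (u # vs)))) = (\<lambda>u. D x (u # vs))"
        using DS[OF x] by (simp add: Sym_Deriv_inverse)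
      show "((\<lambda>y. of_sym_deriv (Sym_Deriv (D y vs))) has_derivative
          (\<lambda>u. of_sym_deriv (Sym_Deriv (D x (u # vs))))) (at x)"
        unfolding eq
        by (rule has_derivative_transform_within_open[OF jet_has_derivative[OF D(1) x] U x])
          (simp add: Sym_Deriv_inverse DS)
    qed
  next
    fix x k assume x: "x \<in> U"
    obtain C where C: "\<forall>\<^sub>F y in nhds x. \<forall>vs. length vs = k \<longrightarrow> norm (D y vs) \<le> C * norm_prod vs"
      using D(1) x unfolding jet_def by blast
    have "\<forall>\<^sub>F y in nhds x. y \<in> U" using U x by (auto simp: eventually_nhds)
    with C have "\<forall>\<^sub>F y in nhds x. \<forall>vs. length vs = k \<longrightarrow> norm (Sym_Deriv (D y vs)) \<le> C * norm_prod vs"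
      by eventually_elim (simp add: norm_sym_deriv_def Sym_Deriv_inverse DS)
    then show "\<exists>C. \<forall>\<^sub>F y in nhds x. \<forall>vs. length vs = k \<longrightarrow> norm (Sym_Deriv (D y vs)) \<le> C * norm_prod vs"
      by blast
  qed
  then show ?thesis by (rule jet_imp_smooth_on) (simp add: D)
qed

lemma smooth_on_oL:
  assumes "smooth_on U f" "smooth_on U g"
  shows "smooth_on U (\<lambda>x. f x o\<^sub>L g x)"
  using smooth_on_compose[OF smooth_on_bilinear[OF bounded_bilinear_blinfun_compose] smooth_on_Pair[OF assms]]
  by simp

section \<open>Exponential coordinates\<close>

definition exp_aut :: "'a::cstar_algebra sym_deriv \<Rightarrow> ('a \<Rightarrow>\<^sub>L 'a)" where
  "exp_aut x = op_exp (of_sym_deriv x)"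

definition log_aut :: "('a::cstar_algebra \<Rightarrow>\<^sub>L 'a) \<Rightarrow> 'a sym_deriv" where
  "log_aut Y = Sym_Deriv (op_log Y)"

text \<open>On the automorphisms in this open set, \<open>op_log\<close> inverts the exponential map of the ball of radius
\<open>1/4\<close>.  The bound on the logarithm makes its image exactly this ball, which is open.\<close>

definition near_id :: "('a::banach \<Rightarrow>\<^sub>L 'a) set" where
  "near_id = {Y. norm (Y - id_blinfun) < 1 \<and> norm (op_log Y) < 1/4}"

abbreviation coord_ball :: "'a::cstar_algebra sym_deriv set" where
  "coord_ball \<equiv> ball 0 (1/4)"

lemma open_near_id: "open (near_id :: ('a::banach \<Rightarrow>\<^sub>L 'a) set)"
proof -
  let ?U = "{Y::'a \<Rightarrow>\<^sub>L 'a. norm (Y - id_blinfun) < 1}"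
  have U: "open ?U" by (intro open_Collect_less continuous_intros)
  have "open (?U \<inter> op_log -` ball 0 (1/4))"
    by (rule continuous_open_preimage[OF smooth_on_continuous_on[OF smooth_on_op_log] U open_ball])
  moreover have "?U \<inter> op_log -` ball 0 (1/4) = near_id" by (auto simp: near_id_def)
  ultimately show ?thesis by simp
qed

lemma id_near_id [simp]: "id_blinfun \<in> near_id"
  by (simp add: near_id_def)

lemma exp_aut_zero [simp]: "exp_aut 0 = id_blinfun"
  by (simp add: exp_aut_def of_sym_deriv_simps)

lemma exp_aut_in_Aut [simp]: "exp_aut x \<in> carrier Aut"
  unfolding exp_aut_def by (rule op_exp_in_Aut[OF of_sym_deriv])

lemma smooth_on_exp_aut: "smooth_on UNIV exp_aut"
  unfolding exp_aut_def[abs_def]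
  by (rule smooth_on_compose[OF smooth_on_op_exp smooth_on_linear[OF open_UNIV bounded_linear_of_sym_deriv]]) simp

lemma exp_aut_near_id:
  assumes "x \<in> coord_ball"
  shows "exp_aut x \<in> near_id" "log_aut (exp_aut x) = x"
proof -
  have x: "norm (of_sym_deriv x) < 1/4" using assms by (simp add: norm_sym_deriv_def)
  have "op_log (exp_aut x) = of_sym_deriv x"
    unfolding exp_aut_def using x by (intro op_log_exp) simp
  moreover have "norm (exp_aut x - id_blinfun) < 1"
    unfolding exp_aut_def using norm_op_exp_minus_id[of "of_sym_deriv x"] x by linarith
  ultimately show "exp_aut x \<in> near_id" "log_aut (exp_aut x) = x"
    using x by (simp_all add: near_id_def log_aut_def of_sym_deriv_inverse)
qed

lemma log_aut_near_id:
  assumes "Y \<in> carrier Aut" "Y \<in> near_id"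
  shows "of_sym_deriv (log_aut Y) = op_log Y" "log_aut Y \<in> coord_ball" "exp_aut (log_aut Y) = Y"
proof -
  show 1: "of_sym_deriv (log_aut Y) = op_log Y"
    unfolding log_aut_def using assms
    by (intro Sym_Deriv_inverse op_log_symmetric_derivation) (auto simp: near_id_def)
  show "log_aut Y \<in> coord_ball" using assms 1 by (simp add: norm_sym_deriv_def near_id_def)
  show "exp_aut (log_aut Y) = Y"
    unfolding exp_aut_def 1 using assms by (intro op_exp_log) (simp add: near_id_def)
qed

lemma smooth_on_log_aut:
  assumes F: "smooth_on W F" and A: "\<And>x. x \<in> W \<Longrightarrow> F x \<in> carrier Aut"
  shows "smooth_on {x \<in> W. F x \<in> near_id} (\<lambda>x. log_aut (F x))"
proof -
  let ?T = "{x \<in> W. F x \<in> near_id}"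
  have "open (W \<inter> F -` near_id)"
    by (rule continuous_open_preimage[OF smooth_on_continuous_on[OF F] smooth_on_open[OF F] open_near_id])
  moreover have "W \<inter> F -` near_id = ?T" by auto
  ultimately have T: "open ?T" by simp
  have "smooth_on ?T F" by (rule smooth_on_subset_cong[OF F T]) auto
  then have "smooth_on ?T (\<lambda>x. op_log (F x))"
    by (rule smooth_on_compose[OF smooth_on_op_log]) (auto simp: near_id_def)
  then show ?thesis
    unfolding log_aut_def
  proof (rule smooth_on_Sym_Deriv)
    fix x assume "x \<in> ?T"
    then show "op_log (F x) \<in> symmetric_derivations"
      using A by (intro op_log_symmetric_derivation) (auto simp: near_id_def)
  qed
qed

interpretation Aut: group "Aut :: ('a::cstar_algebra \<Rightarrow>\<^sub>L 'a) monoid"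
  by (rule Aut_group)

abbreviation aut_inv :: "('a::cstar_algebra \<Rightarrow>\<^sub>L 'a) \<Rightarrow> ('a \<Rightarrow>\<^sub>L 'a)" where
  "aut_inv g \<equiv> m_inv Aut g"

lemma aut_closed [simp]: "g \<in> carrier Aut \<Longrightarrow> h \<in> carrier Aut \<Longrightarrow> g o\<^sub>L h \<in> carrier Aut"
  using Aut.m_closed by simp

lemma aut_id [simp]: "id_blinfun \<in> carrier Aut"
  using Aut.one_closed by simp

lemma aut_inv_simps [simp]:
  assumes "g \<in> carrier Aut"
  shows "aut_inv g o\<^sub>L g = id_blinfun" "g o\<^sub>L aut_inv g = id_blinfun"
    "aut_inv g o\<^sub>L (g o\<^sub>L T) = T" "g o\<^sub>L (aut_inv g o\<^sub>L T) = T"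
proof -
  show 1: "aut_inv g o\<^sub>L g = id_blinfun" "g o\<^sub>L aut_inv g = id_blinfun"
    using Aut.l_inv[OF assms] Aut.r_inv[OF assms] by simp_all
  show "aut_inv g o\<^sub>L (g o\<^sub>L T) = T" "g o\<^sub>L (aut_inv g o\<^sub>L T) = T"
    by (simp_all add: 1 oL_assoc[symmetric])
qed

lemma aut_inv_exp:
  assumes "g \<in> carrier Aut"
  shows "aut_inv (g o\<^sub>L exp_aut x) = exp_aut (- x) o\<^sub>L aut_inv g"
proof -
  have "exp_aut (- x) o\<^sub>L exp_aut x = id_blinfun"
    by (simp add: exp_aut_def of_sym_deriv_simps op_exp_minus_left)
  then have "(exp_aut (- x) o\<^sub>L aut_inv g) \<otimes>\<^bsub>Aut\<^esub> (g o\<^sub>L exp_aut x) = \<one>\<^bsub>Aut\<^esub>"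
    using assms by (simp add: oL_assoc)
  then show ?thesis
    by (rule Aut.inv_equality) (use assms in auto)
qed

section \<open>The atlas\<close>

text \<open>The logarithm, translated from the identity to \<open>g\<close>.\<close>

definition aut_chart :: "('a::cstar_algebra \<Rightarrow>\<^sub>L 'a) \<Rightarrow> ('a \<Rightarrow>\<^sub>L 'a, 'a sym_deriv) chart" where
  "aut_chart g = ({T \<in> carrier Aut. aut_inv g o\<^sub>L T \<in> near_id}, \<lambda>T. log_aut (aut_inv g o\<^sub>L T))"

definition aut_atlas :: "('a::cstar_algebra \<Rightarrow>\<^sub>L 'a, 'a sym_deriv) chart set" where
  "aut_atlas = aut_chart ` carrier Aut"

text \<open>An explicit inverse of a chart, which replaces the \<open>inv_into\<close> of \<open>local_rep\<close>.\<close>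

definition parametrises :: "('e \<Rightarrow> 'm) \<Rightarrow> 'e set \<Rightarrow> ('m, 'e) chart \<Rightarrow> bool" where
  "parametrises p V c \<longleftrightarrow> (\<forall>x\<in>V. p x \<in> fst c \<and> snd c (p x) = x)
     \<and> (\<forall>T\<in>fst c. snd c T \<in> V \<and> p (snd c T) = T)"

lemma parametrises_image:
  assumes "parametrises p V c"
  shows "snd c ` (fst c \<inter> f -` S) = {x \<in> V. f (p x) \<in> S}"
proof -
  have "x \<in> snd c ` (fst c \<inter> f -` S)" if "x \<in> V" "f (p x) \<in> S" for x
    using assms that by (intro image_eqI[of _ _ "p x"]) (simp_all add: parametrises_def)
  then show ?thesis using assms by (auto simp: parametrises_def)
qed

lemma parametrises_inv_into:
  assumes "parametrises p V c" "x \<in> V"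
  shows "inv_into (fst c) (snd c) x = p x"
proof (rule inv_into_f_eq)
  show "inj_on (snd c) (fst c)" using assms(1) unfolding parametrises_def by (metis inj_onI)
qed (use assms in \<open>auto simp: parametrises_def\<close>)

lemma parametrises_local_rep:
  "parametrises p V c \<Longrightarrow> x \<in> V \<Longrightarrow> local_rep c f d x = snd d (f (p x))"
  by (simp add: local_rep_def parametrises_inv_into)

lemma parametrises_prod:
  assumes "parametrises p V c" "parametrises q W d"
  shows "parametrises (map_prod p q) (V \<times> W) (fst c \<times> fst d, map_prod (snd c) (snd d))"
  using assms unfolding parametrises_def by auto

lemma aut_chart_parametrised:
  assumes g: "g \<in> carrier Aut"
  shows "parametrises (\<lambda>x. g o\<^sub>L exp_aut x) coord_ball (aut_chart g)"
  unfolding parametrises_def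
proof (intro conjI ballI)
  fix x :: "'a sym_deriv" assume x: "x \<in> coord_ball"
  show "g o\<^sub>L exp_aut x \<in> fst (aut_chart g)" "snd (aut_chart g) (g o\<^sub>L exp_aut x) = x"
    using g exp_aut_near_id[OF x] by (auto simp: aut_chart_def exp_aut_in_Aut)
next
  fix T assume T: "T \<in> fst (aut_chart g)"
  then show "snd (aut_chart g) T \<in> coord_ball" "g o\<^sub>L exp_aut (snd (aut_chart g) T) = T"
    using g log_aut_near_id[of "aut_inv g o\<^sub>L T"] by (auto simp: aut_chart_def)
qed

lemma aut_chart_image:
  assumes "g \<in> carrier Aut"
  shows "snd (aut_chart g) ` fst (aut_chart g) = coord_ball"
  using parametrises_image[OF aut_chart_parametrised[OF assms], of id UNIV] by auto

text \<open>Changes of charts, multiplication and inversion are all instances: a map into \<open>Aut\<close> that is smooth as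
an operator-valued function of coordinates is smooth in the charts.\<close>

lemma smooth_on_local_rep:
  assumes p: "parametrises p V c" and h: "h \<in> carrier Aut"
    and s: "smooth_on V (\<lambda>x. f (p x))" and A: "\<And>x. x \<in> V \<Longrightarrow> f (p x) \<in> carrier Aut"
  shows "smooth_on (snd c ` (fst c \<inter> f -` fst (aut_chart h))) (local_rep c f (aut_chart h))"
proof -
  let ?T = "{x \<in> V. aut_inv h o\<^sub>L f (p x) \<in> near_id}"
  have "smooth_on V (\<lambda>x. aut_inv h o\<^sub>L f (p x))"
    by (rule smooth_on_oL[OF smooth_on_const[OF smooth_on_open[OF s]] s])
  then have T: "smooth_on ?T (\<lambda>x. log_aut (aut_inv h o\<^sub>L f (p x)))"
    by (rule smooth_on_log_aut) (use A h in auto)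
  have img: "snd c ` (fst c \<inter> f -` fst (aut_chart h)) = ?T"
    unfolding parametrises_image[OF p] using A by (auto simp: aut_chart_def)
  show ?thesis
    unfolding img
    by (rule smooth_on_subset_cong[OF T smooth_on_open[OF T]])
      (simp_all add: parametrises_local_rep[OF p] aut_chart_def)
qed

lemma smooth_on_translated_exp: "open V \<Longrightarrow> smooth_on V (\<lambda>x. g o\<^sub>L exp_aut x)"
  using smooth_on_oL[OF smooth_on_const smooth_on_subset_cong[OF smooth_on_exp_aut]] by blast

lemma smooth_on_left_translation:
  assumes "k \<in> carrier Aut" "c \<in> aut_atlas" "d \<in> aut_atlas"
  shows "smooth_on (snd c ` (fst c \<inter> (\<lambda>T. k o\<^sub>L T) -` fst d)) (local_rep c (\<lambda>T. k o\<^sub>L T) d)"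
proof -
  obtain g h where g: "g \<in> carrier Aut" "c = aut_chart g" and h: "h \<in> carrier Aut" "d = aut_chart h"
    using assms(2,3) by (auto simp: aut_atlas_def)
  have "smooth_on coord_ball (\<lambda>x. k o\<^sub>L (g o\<^sub>L exp_aut x))"
    by (intro smooth_on_oL[OF smooth_on_const] smooth_on_translated_exp) auto
  then show ?thesis
    unfolding g(2) h(2)
    by (intro smooth_on_local_rep[OF aut_chart_parametrised[OF g(1)] h(1)])
      (use assms(1) g(1) in auto)
qed

lemma continuous_on_log_aut: "continuous_on (carrier Aut \<inter> near_id) log_aut"
proof -
  have "carrier Aut \<inter> near_id \<subseteq> {Y::'a \<Rightarrow>\<^sub>L 'a. norm (Y - id_blinfun) < 1}"
    unfolding near_id_def by blast
  then have c: "continuous_on (carrier Aut \<inter> near_id) (op_log :: ('a \<Rightarrow>\<^sub>L 'a) \<Rightarrow> _)"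
    by (rule continuous_on_subset[OF smooth_on_continuous_on[OF smooth_on_op_log]])
  have "dist (log_aut Y) (log_aut Z) = dist (op_log Y) (op_log Z)"
    if "Y \<in> carrier Aut \<inter> near_id" "Z \<in> carrier Aut \<inter> near_id" for Y Z :: "'a \<Rightarrow>\<^sub>L 'a"
    using that by (simp add: dist_norm norm_sym_deriv_def of_sym_deriv_simps log_aut_near_id(1))
  then show ?thesis using c unfolding continuous_on_iff by metis
qed

lemma aut_chart_homeomorphic:
  assumes g: "g \<in> carrier Aut"
  shows "homeomorphic_map (subtopology (top_of_set (carrier Aut)) (fst (aut_chart g)))
    (top_of_set (coord_ball)) (snd (aut_chart g))"
proof -
  let ?U = "fst (aut_chart g)" and ?p = "\<lambda>x. g o\<^sub>L exp_aut x"
  note p = aut_chart_parametrised[OF g, unfolded parametrises_def]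
  have sub: "subtopology (top_of_set (carrier Aut)) ?U = top_of_set ?U"
  proof -
    have "carrier Aut \<inter> ?U = ?U" by (auto simp: aut_chart_def)
    then show ?thesis by (simp only: subtopology_subtopology)
  qed
  have "continuous_on ?U (snd (aut_chart g))"
    unfolding aut_chart_def snd_conv fst_conv
    by (rule continuous_on_compose2[OF continuous_on_log_aut])
      (use g in \<open>auto intro!: continuous_intros\<close>)
  moreover have "continuous_on coord_ball ?p"
    by (rule smooth_on_continuous_on[OF smooth_on_translated_exp]) simp
  ultimately have "homeomorphic_maps (top_of_set ?U) (top_of_set coord_ball) (snd (aut_chart g)) ?p"
    unfolding homeomorphic_maps_def using p by (auto simp: continuous_map_subtopology_eu)
  then show ?thesis unfolding sub by (auto simp: homeomorphic_map_maps)
qed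

lemma aut_chart_openin:
  "openin (top_of_set (carrier Aut)) (fst (aut_chart g))"
proof -
  have "open ((\<lambda>T. aut_inv g o\<^sub>L T) -` near_id)"
    by (intro open_vimage open_near_id continuous_intros)
  then show ?thesis unfolding openin_open aut_chart_def by auto
qed

lemma aut_chart_centre: "g \<in> carrier Aut \<Longrightarrow> g \<in> fst (aut_chart g)"
  by (simp add: aut_chart_def)

lemma aut_manifold: "banach_manifold (top_of_set (carrier Aut)) aut_atlas"
  unfolding banach_manifold_def
proof (intro conjI ballI)
  show "Hausdorff_space (top_of_set (carrier (Aut :: ('a \<Rightarrow>\<^sub>L 'a) monoid)))"
    by (intro Hausdorff_space_subtopology Hausdorff_space_euclidean)
  show "\<Union>(fst ` aut_atlas) = topspace (top_of_set (carrier (Aut :: ('a \<Rightarrow>\<^sub>L 'a) monoid)))"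
    using aut_chart_centre by (auto simp: aut_atlas_def) (auto simp: aut_chart_def)
next
  fix c :: "('a \<Rightarrow>\<^sub>L 'a, 'a sym_deriv) chart" assume "c \<in> aut_atlas"
  then obtain g where g: "g \<in> carrier Aut" "c = aut_chart g" by (auto simp: aut_atlas_def)
  show "case c of (U, \<phi>) \<Rightarrow> openin (top_of_set (carrier Aut)) U \<and> open (\<phi> ` U)
      \<and> homeomorphic_map (subtopology (top_of_set (carrier Aut)) U) (top_of_set (\<phi> ` U)) \<phi>"
    using aut_chart_openin[of g] aut_chart_homeomorphic[OF g(1)] aut_chart_image[OF g(1)]
    unfolding g(2) by (cases "aut_chart g") simp
next
  fix c d :: "('a \<Rightarrow>\<^sub>L 'a, 'a sym_deriv) chart" assume "c \<in> aut_atlas" "d \<in> aut_atlas"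
  from smooth_on_left_translation[OF aut_id this]
  show "smooth_on (snd c ` (fst c \<inter> fst d)) (local_rep c id d)"
    by (simp add: id_def)
qed

lemma aut_mult_smooth:
  "smooth_map (prod_topology (top_of_set (carrier Aut)) (top_of_set (carrier Aut)))
     (prod_atlas aut_atlas aut_atlas) (top_of_set (carrier Aut)) aut_atlas (\<lambda>(g, h). g \<otimes>\<^bsub>Aut\<^esub> h)"
  unfolding smooth_map_def
proof (intro conjI ballI)
  have "continuous_on (carrier Aut \<times> carrier Aut) (\<lambda>z. fst z o\<^sub>L snd z :: 'a \<Rightarrow>\<^sub>L 'a)"
    by (intro continuous_intros)
  then show "continuous_map (prod_topology (top_of_set (carrier Aut)) (top_of_set (carrier Aut)))
      (top_of_set (carrier Aut)) (\<lambda>(g, h). g \<otimes>\<^bsub>Aut\<^esub> h :: 'a \<Rightarrow>\<^sub>L 'a)"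
    by (auto simp: continuous_map_subtopology_eu case_prod_unfold euclidean_product_topology
        simp flip: subtopology_Times)
next
  fix c :: "(('a \<Rightarrow>\<^sub>L 'a) \<times> ('a \<Rightarrow>\<^sub>L 'a), 'a sym_deriv \<times> 'a sym_deriv) chart"
    and d :: "('a \<Rightarrow>\<^sub>L 'a, 'a sym_deriv) chart"
  assume "c \<in> prod_atlas aut_atlas aut_atlas" "d \<in> aut_atlas"
  then obtain g1 g2 h where g1: "g1 \<in> carrier Aut" and g2: "g2 \<in> carrier Aut" and h: "h \<in> carrier Aut"
    and c: "c = (fst (aut_chart g1) \<times> fst (aut_chart g2), map_prod (snd (aut_chart g1)) (snd (aut_chart g2)))"
    and d: "d = aut_chart h"
    unfolding prod_atlas_def aut_atlas_def by blast
  let ?p = "map_prod (\<lambda>x. g1 o\<^sub>L exp_aut x) (\<lambda>x. g2 o\<^sub>L exp_aut x)"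
  let ?V = "coord_ball \<times> coord_ball :: ('a sym_deriv \<times> 'a sym_deriv) set"
  have V: "open ?V" by (intro open_Times open_ball)
  have s: "smooth_on ?V (\<lambda>z. g o\<^sub>L exp_aut (L z))"
    if "bounded_linear L" for g and L :: "'a sym_deriv \<times> 'a sym_deriv \<Rightarrow> 'a sym_deriv"
    by (rule smooth_on_compose[OF smooth_on_translated_exp[OF open_UNIV] smooth_on_linear[OF V that]]) simp
  have "smooth_on ?V (\<lambda>z. (g1 o\<^sub>L exp_aut (fst z)) o\<^sub>L (g2 o\<^sub>L exp_aut (snd z)))"
    by (intro smooth_on_oL s bounded_linear_fst bounded_linear_snd)
  then have "smooth_on ?V (\<lambda>z. (\<lambda>(g, h). g \<otimes>\<^bsub>Aut\<^esub> h) (?p z))"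
    by (simp add: case_prod_unfold map_prod_def)
  then show "smooth_on (snd c ` (fst c \<inter> (\<lambda>(g, h). g \<otimes>\<^bsub>Aut\<^esub> h) -` fst d)) (local_rep c (\<lambda>(g, h). g \<otimes>\<^bsub>Aut\<^esub> h) d)"
    unfolding c d
    by (intro smooth_on_local_rep[OF parametrises_prod[OF aut_chart_parametrised[OF g1] aut_chart_parametrised[OF g2]] h])
      (use g1 g2 in auto)
qed

text \<open>Near \<open>g\<close> the inverse of \<open>T = g exp x\<close> is \<open>exp (- x) g\<^sup>-\<^sup>1\<close>, where \<open>x\<close> is the logarithm of
\<open>g\<^sup>-\<^sup>1 T\<close> and depends continuously on \<open>T\<close>.\<close>

lemma aut_inv_continuous: "continuous_on (carrier Aut) aut_inv"
  unfolding continuous_on_eq_continuous_within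
proof
  fix g :: "'a \<Rightarrow>\<^sub>L 'a" assume g: "g \<in> carrier Aut"
  let ?f = "\<lambda>T. op_exp (- op_log (aut_inv g o\<^sub>L T)) o\<^sub>L aut_inv g"
  have "isCont op_log (aut_inv g o\<^sub>L g)"
    using g smooth_on_differentiable[OF smooth_on_op_log, of id_blinfun]
    by (auto intro: differentiable_imp_continuous_within)
  moreover have "isCont (\<lambda>T. aut_inv g o\<^sub>L T) g" by (intro continuous_intros)
  ultimately have "isCont (\<lambda>T. op_log (aut_inv g o\<^sub>L T)) g" by (rule isCont_o2[rotated])
  then have "isCont (\<lambda>T. - op_log (aut_inv g o\<^sub>L T)) g" by (intro continuous_intros)
  moreover have "isCont op_exp X" for X :: "'a \<Rightarrow>\<^sub>L 'a"
    using smooth_on_differentiable[OF smooth_on_op_exp, of X]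
    by (auto intro: differentiable_imp_continuous_within)
  ultimately have "isCont (\<lambda>T. op_exp (- op_log (aut_inv g o\<^sub>L T))) g" by (rule isCont_o2)
  then have "isCont ?f g" by (intro continuous_intros)
  then have f: "continuous (at g within carrier Aut) ?f" by (rule continuous_at_imp_continuous_at_within)
  show "continuous (at g within carrier Aut) aut_inv"
  proof (rule continuous_transform_within_openin[OF f aut_chart_openin aut_chart_centre[OF g]])
    fix T assume "T \<in> fst (aut_chart g)"
    then have T: "T \<in> carrier Aut" "aut_inv g o\<^sub>L T \<in> near_id" by (auto simp: aut_chart_def)
    let ?x = "log_aut (aut_inv g o\<^sub>L T)"
    have x: "of_sym_deriv ?x = op_log (aut_inv g o\<^sub>L T)" "exp_aut ?x = aut_inv g o\<^sub>L T"
      using log_aut_near_id[of "aut_inv g o\<^sub>L T"] T g by auto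
    have "T = g o\<^sub>L exp_aut ?x" using g by (simp add: x(2))
    then have "aut_inv T = exp_aut (- ?x) o\<^sub>L aut_inv g" using aut_inv_exp[OF g, of ?x] by simp
    then show "?f T = aut_inv T" by (simp add: exp_aut_def of_sym_deriv_simps x(1))
  qed
qed

lemma aut_inv_smooth:
  "smooth_map (top_of_set (carrier Aut)) aut_atlas (top_of_set (carrier Aut)) aut_atlas aut_inv"
  unfolding smooth_map_def
proof (intro conjI ballI)
  show "continuous_map (top_of_set (carrier Aut)) (top_of_set (carrier Aut)) (aut_inv :: _ \<Rightarrow> 'a \<Rightarrow>\<^sub>L 'a)"
    using aut_inv_continuous by (auto simp: continuous_map_subtopology_eu)
next
  fix c d :: "('a \<Rightarrow>\<^sub>L 'a, 'a sym_deriv) chart" assume "c \<in> aut_atlas" "d \<in> aut_atlas"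
  then obtain g h where g: "g \<in> carrier Aut" "c = aut_chart g" and h: "h \<in> carrier Aut" "d = aut_chart h"
    by (auto simp: aut_atlas_def)
  have "smooth_on coord_ball (\<lambda>x::'a sym_deriv. exp_aut (- x))"
    by (rule smooth_on_compose[OF smooth_on_exp_aut smooth_on_linear[OF open_ball bounded_linear_minus[OF bounded_linear_ident]]]) simp
  then have "smooth_on coord_ball (\<lambda>x. aut_inv (g o\<^sub>L exp_aut x))"
    unfolding aut_inv_exp[OF g(1)] by (intro smooth_on_oL smooth_on_const) auto
  then show "smooth_on (snd c ` (fst c \<inter> aut_inv -` fst d)) (local_rep c aut_inv d)"
    unfolding g(2) h(2)
    by (intro smooth_on_local_rep[OF aut_chart_parametrised[OF g(1)] h(1)])
      (use g(1) in auto)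
qed

lemma aut_banach_lie_group: "banach_lie_group Aut (top_of_set (carrier Aut)) aut_atlas"
  unfolding banach_lie_group_def
  by (intro conjI Aut_group aut_manifold aut_mult_smooth aut_inv_smooth) simp

section \<open>Left-invariant vector fields in exponential coordinates\<close>

abbreviation exp_coeff :: "nat \<Rightarrow> real" where
  "exp_coeff \<equiv> \<lambda>n. 1 / fact n"

text \<open>The multiplication near the identity in exponential coordinates.\<close>

definition coord_mult :: "'a::cstar_algebra sym_deriv \<times> 'a sym_deriv \<Rightarrow> 'a sym_deriv" where
  "coord_mult z = log_aut (exp_aut (fst z) o\<^sub>L exp_aut (snd z))"

text \<open>The coordinate expression, in every chart, of the left-invariant field with value \<open>\<delta>\<close> at the
identity: the velocity at \<open>t = 0\<close> of \<open>log (exp x exp (t \<delta>))\<close>.  As a partial derivative of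
\<open>coord_mult\<close> it is visibly smooth in \<open>x\<close>.\<close>

definition left_coord :: "'a::cstar_algebra sym_deriv \<Rightarrow> 'a sym_deriv \<Rightarrow> 'a sym_deriv" where
  "left_coord \<delta> x = frechet_derivative coord_mult (at (x, 0)) (0, \<delta>)"

lemma smooth_on_coord_mult:
  "smooth_on {z. exp_aut (fst z) o\<^sub>L exp_aut (snd z) \<in> near_id} coord_mult"
proof -
  have "smooth_on UNIV (\<lambda>z. exp_aut (fst z) o\<^sub>L exp_aut (snd z) :: 'a \<Rightarrow>\<^sub>L 'a)"
    by (intro smooth_on_oL smooth_on_compose[OF smooth_on_exp_aut] smooth_on_linear open_UNIV
        bounded_linear_fst bounded_linear_snd subset_UNIV)
  from smooth_on_log_aut[OF this] show ?thesis
    by (simp add: coord_mult_def[abs_def])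
qed

lemma smooth_on_left_coord: "smooth_on coord_ball (left_coord \<delta>)"
proof -
  have "smooth_on coord_ball (\<lambda>x::'a sym_deriv. (x, 0 :: 'a sym_deriv))"
    by (intro smooth_on_Pair smooth_on_linear smooth_on_const open_ball bounded_linear_ident)
  moreover have "(\<lambda>x::'a sym_deriv. (x, 0 :: 'a sym_deriv)) ` coord_ball
      \<subseteq> {z. exp_aut (fst z) o\<^sub>L exp_aut (snd z) \<in> near_id}"
    by (auto simp: exp_aut_near_id)
  ultimately show ?thesis
    unfolding left_coord_def[abs_def]
    by (rule smooth_on_compose[OF smooth_on_directional[OF smooth_on_coord_mult]])
qed

lemma left_coord_line:
  assumes x: "x \<in> coord_ball"
  shows "((\<lambda>t. log_aut (exp_aut x o\<^sub>L exp_aut (t *\<^sub>R \<delta>))) has_vector_derivative left_coord \<delta> x) (at 0)"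
proof -
  have "(coord_mult has_derivative frechet_derivative coord_mult (at (x, 0))) (at (x, 0))"
    by (rule smooth_on_has_derivative[OF smooth_on_coord_mult]) (simp add: exp_aut_near_id[OF x])
  from line_vector_derivative[OF this, of "(0, \<delta>)"] show ?thesis
    by (simp add: left_coord_def coord_mult_def)
qed

lemma exp_aut_line:
  "((\<lambda>t. exp_aut (t *\<^sub>R \<delta>)) has_vector_derivative of_sym_deriv \<delta>) (at 0)"
  unfolding exp_aut_def of_sym_deriv_simps
  using op_exp_line_derivative[of "of_sym_deriv \<delta>" 0 UNIV] by simp

lemma open_exp_line_near_id:
  "open {t::real. h o\<^sub>L exp_aut (t *\<^sub>R \<delta>) \<in> near_id}"
proof -
  have "continuous_on UNIV (\<lambda>t::real. exp_aut (t *\<^sub>R \<delta>))"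
    by (rule continuous_on_compose2[OF smooth_on_continuous_on[OF smooth_on_exp_aut]])
      (auto intro!: continuous_intros)
  then have "continuous_on UNIV (\<lambda>t::real. h o\<^sub>L exp_aut (t *\<^sub>R \<delta>))"
    by (intro continuous_intros)
  from open_vimage[OF open_near_id this] show ?thesis by (simp add: vimage_def)
qed

lemma left_coord_zero: "left_coord \<delta> 0 = \<delta>"
proof -
  let ?S = "{t::real. t *\<^sub>R \<delta> \<in> coord_ball}"
  have "open ((\<lambda>t::real. t *\<^sub>R \<delta>) -` coord_ball)" by (intro open_vimage open_ball continuous_intros)
  then have S: "open ?S" by (simp only: vimage_def)
  have "((\<lambda>t::real. t *\<^sub>R \<delta>) has_vector_derivative \<delta>) (at 0)"
    unfolding has_vector_derivative_def by (auto intro!: derivative_eq_intros)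
  then have "((\<lambda>t. log_aut (exp_aut 0 o\<^sub>L exp_aut (t *\<^sub>R \<delta>))) has_vector_derivative \<delta>) (at 0)"
    by (rule has_vector_derivative_transform_within_open[OF _ S]) (auto simp: exp_aut_near_id)
  moreover have "((\<lambda>t. log_aut (exp_aut 0 o\<^sub>L exp_aut (t *\<^sub>R \<delta>))) has_vector_derivative left_coord \<delta> 0) (at 0)"
    by (rule left_coord_line) simp
  ultimately show ?thesis by (metis vector_derivative_unique_at)
qed

lemma exp_aut_has_derivative:
  "(exp_aut has_derivative (\<lambda>u. series_jet exp_coeff (of_sym_deriv x) [of_sym_deriv u])) (at x)"
proof -
  have "(op_exp has_derivative (\<lambda>v. series_jet exp_coeff (of_sym_deriv x) [v])) (at (of_sym_deriv x))"
    unfolding op_exp_def by (rule op_series_has_derivative) (simp add: exp_dom)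
  from has_derivative_compose[OF bounded_linear_imp_has_derivative[OF bounded_linear_of_sym_deriv] this]
  show ?thesis by (simp add: exp_aut_def[abs_def])
qed

text \<open>The derivative of the exponential map has a left inverse, the derivative of the logarithm.\<close>

lemma exp_aut_derivative_inj:
  assumes x: "x \<in> coord_ball"
    and eq: "series_jet exp_coeff (of_sym_deriv x) [of_sym_deriv u] = series_jet exp_coeff (of_sym_deriv x) [of_sym_deriv v]"
  shows "u = v"
proof -
  let ?L = "frechet_derivative op_log (at (exp_aut x))"
  have L: "(op_log has_derivative ?L) (at (exp_aut x))"
    by (rule smooth_on_has_derivative[OF smooth_on_op_log])
      (use exp_aut_near_id(1)[OF x] in \<open>simp add: near_id_def\<close>)
  have "(of_sym_deriv has_derivative (\<lambda>u. ?L (series_jet exp_coeff (of_sym_deriv x) [of_sym_deriv u]))) (at x)"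
  proof (rule has_derivative_transform_within_open[OF has_derivative_compose[OF exp_aut_has_derivative L] open_ball x])
    fix y :: "'a sym_deriv" assume "y \<in> coord_ball"
    then show "op_log (exp_aut y) = of_sym_deriv y"
      using exp_aut_near_id[of y] log_aut_near_id(1)[of "exp_aut y"] by simp
  qed
  from has_derivative_unique[OF this bounded_linear_imp_has_derivative[OF bounded_linear_of_sym_deriv]]
  have L_left_inverse: "?L (series_jet exp_coeff (of_sym_deriv x) [of_sym_deriv w]) = of_sym_deriv w" for w
    by (rule fun_cong)
  have "of_sym_deriv u = of_sym_deriv v"
    by (rule trans[OF trans[OF L_left_inverse[of u, symmetric] arg_cong[where f = ?L, OF eq]] L_left_inverse[of v]])
  then show ?thesis by (simp add: of_sym_deriv_inject)
qed

text \<open>In terms of operators the left-invariant field is \<open>T \<mapsto> T \<delta>\<close>; both sides are the velocity of the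
curve \<open>exp x exp (t \<delta>)\<close>.\<close>

lemma exp_aut_left_coord:
  assumes x: "x \<in> coord_ball"
  shows "series_jet exp_coeff (of_sym_deriv x) [of_sym_deriv (left_coord \<delta> x)] = exp_aut x o\<^sub>L of_sym_deriv \<delta>"
proof -
  let ?c = "\<lambda>t. log_aut (exp_aut x o\<^sub>L exp_aut (t *\<^sub>R \<delta>))"
  let ?S = "{t::real. exp_aut x o\<^sub>L exp_aut (t *\<^sub>R \<delta>) \<in> near_id}"
  have lin: "series_jet exp_coeff (of_sym_deriv x) [of_sym_deriv (r *\<^sub>R w)]
      = r *\<^sub>R series_jet exp_coeff (of_sym_deriv x) [of_sym_deriv w]" for r w
    using linear_scale[OF has_derivative_linear[OF exp_aut_has_derivative]] .
  have "?c 0 = x" using exp_aut_near_id(2)[OF x] by simp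
  then have "(exp_aut has_derivative (\<lambda>u. series_jet exp_coeff (of_sym_deriv x) [of_sym_deriv u])) (at (?c 0))"
    using exp_aut_has_derivative by metis
  from has_derivative_compose[OF left_coord_line[OF x, unfolded has_vector_derivative_def] this]
  have "((\<lambda>t. exp_aut (?c t)) has_vector_derivative
      series_jet exp_coeff (of_sym_deriv x) [of_sym_deriv (left_coord \<delta> x)]) (at 0)"
    unfolding has_vector_derivative_def lin .
  then have "((\<lambda>t. exp_aut x o\<^sub>L exp_aut (t *\<^sub>R \<delta>)) has_vector_derivative
      series_jet exp_coeff (of_sym_deriv x) [of_sym_deriv (left_coord \<delta> x)]) (at 0)"
    by (rule has_vector_derivative_transform_within_open[OF _ open_exp_line_near_id[of "exp_aut x" \<delta>]])
      (use exp_aut_near_id(1)[OF x] in \<open>auto simp: log_aut_near_id(3)\<close>)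
  moreover have "((\<lambda>t. exp_aut x o\<^sub>L exp_aut (t *\<^sub>R \<delta>)) has_vector_derivative exp_aut x o\<^sub>L of_sym_deriv \<delta>) (at 0)"
    by (rule bounded_linear.has_vector_derivative[OF oL.bounded_linear_right exp_aut_line])
  ultimately show ?thesis by (rule vector_derivative_unique_at)
qed

text \<open>The derivative of \<open>exp_aut_left_coord\<close> with respect to \<open>x\<close> in the direction \<open>w\<close>.\<close>

lemma exp_aut_left_coord_derivative:
  assumes x: "x \<in> coord_ball"
  shows "series_jet exp_coeff (of_sym_deriv x) [of_sym_deriv w, of_sym_deriv (left_coord \<delta> x)]
    + series_jet exp_coeff (of_sym_deriv x) [of_sym_deriv (frechet_derivative (left_coord \<delta>) (at x) w)]
    = series_jet exp_coeff (of_sym_deriv x) [of_sym_deriv w] o\<^sub>L of_sym_deriv \<delta>"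
proof -
  note of = bounded_linear_imp_has_derivative[OF bounded_linear_of_sym_deriv]
  let ?J = "series_jet exp_coeff :: ('a \<Rightarrow>\<^sub>L 'a) \<Rightarrow> _"
  have J: "jet UNIV ?J" using jet_series_jet[of exp_coeff] by (simp add: exp_dom)
  have h: "((\<lambda>y. of_sym_deriv (left_coord \<delta> y)) has_derivative
      (\<lambda>u. of_sym_deriv (frechet_derivative (left_coord \<delta>) (at x) u))) (at x)"
    by (rule has_derivative_compose[OF smooth_on_has_derivative[OF smooth_on_left_coord x] of])
  from jet_multilinear_chain[where h = "\<lambda>_ y. of_sym_deriv (left_coord \<delta> y)" and P = "[()]", OF J UNIV_I of h]
  have "((\<lambda>y. ?J (of_sym_deriv y) [of_sym_deriv (left_coord \<delta> y)]) has_derivative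
      (\<lambda>u. ?J (of_sym_deriv x) [of_sym_deriv u, of_sym_deriv (left_coord \<delta> x)]
        + ?J (of_sym_deriv x) [of_sym_deriv (frechet_derivative (left_coord \<delta>) (at x) u)])) (at x)"
    by simp
  then have "((\<lambda>y. exp_aut y o\<^sub>L of_sym_deriv \<delta>) has_derivative
      (\<lambda>u. ?J (of_sym_deriv x) [of_sym_deriv u, of_sym_deriv (left_coord \<delta> x)]
        + ?J (of_sym_deriv x) [of_sym_deriv (frechet_derivative (left_coord \<delta>) (at x) u)])) (at x)"
    by (rule has_derivative_transform_within_open[OF _ open_ball x]) (rule exp_aut_left_coord)
  moreover have "((\<lambda>y. exp_aut y o\<^sub>L of_sym_deriv \<delta>) has_derivative
      (\<lambda>u. ?J (of_sym_deriv x) [of_sym_deriv u] o\<^sub>L of_sym_deriv \<delta>)) (at x)"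
    by (rule bounded_linear.has_derivative[OF oL.bounded_linear_left exp_aut_has_derivative])
  ultimately have "(\<lambda>u. ?J (of_sym_deriv x) [of_sym_deriv u, of_sym_deriv (left_coord \<delta> x)]
        + ?J (of_sym_deriv x) [of_sym_deriv (frechet_derivative (left_coord \<delta>) (at x) u)])
      = (\<lambda>u. ?J (of_sym_deriv x) [of_sym_deriv u] o\<^sub>L of_sym_deriv \<delta>)"
    by (rule has_derivative_unique)
  then show ?thesis by (rule fun_cong)
qed

lemma commutator_symmetric_derivation:
  assumes "S \<in> symmetric_derivations" "T \<in> symmetric_derivations"
  shows "commutator S T \<in> symmetric_derivations"
proof -
  have "scaleC_op c o\<^sub>L (A o\<^sub>L B) = (A o\<^sub>L B) o\<^sub>L scaleC_op c"
    if "A \<in> symmetric_derivations" "B \<in> symmetric_derivations" for A B :: "'a \<Rightarrow>\<^sub>L 'a" and c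
    using that unfolding mem_symmetric_derivations_iff by (metis oL_assoc)
  moreover have "adj_op o\<^sub>L (A o\<^sub>L B) = (A o\<^sub>L B) o\<^sub>L adj_op"
    if "A \<in> symmetric_derivations" "B \<in> symmetric_derivations" for A B :: "'a \<Rightarrow>\<^sub>L 'a"
    using that unfolding mem_symmetric_derivations_iff by (metis oL_assoc)
  moreover have "commutator S T (x * y) = commutator S T x * y + x * commutator S T y" for x y
    using assms unfolding mem_symmetric_derivations_iff commutator_def
    by (simp add: blinfun.bilinear_simps algebra_simps)
  ultimately show ?thesis
    using assms unfolding mem_symmetric_derivations_iff[of "commutator S T"]
    by (simp add: commutator_def oL.diff_left oL.diff_right)
qed

definition sym_bracket :: "'a::cstar_algebra sym_deriv \<Rightarrow> 'a sym_deriv \<Rightarrow> 'a sym_deriv" where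
  "sym_bracket a b = Sym_Deriv (commutator (of_sym_deriv a) (of_sym_deriv b))"

lemma of_sym_bracket: "of_sym_deriv (sym_bracket a b) = commutator (of_sym_deriv a) (of_sym_deriv b)"
  unfolding sym_bracket_def
  by (rule Sym_Deriv_inverse[OF commutator_symmetric_derivation[OF of_sym_deriv of_sym_deriv]])

text \<open>Take \<open>exp_aut_left_coord_derivative\<close> for each of the two fields, in the direction of the other, and
subtract: the second derivatives of the exponential map cancel by symmetry, and the right-hand
sides leave \<open>exp x\<close> times the commutator.  As the derivative of the exponential map is injective,
the claim follows.\<close>

lemma left_coord_bracket:
  assumes x: "x \<in> coord_ball"
  shows "frechet_derivative (left_coord b) (at x) (left_coord a x)
    - frechet_derivative (left_coord a) (at x) (left_coord b x) = left_coord (sym_bracket a b) x"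
proof (rule exp_aut_derivative_inj[OF x])
  let ?J = "\<lambda>us. series_jet exp_coeff (of_sym_deriv x) (map of_sym_deriv us)"
  let ?a = "left_coord a x" and ?b = "left_coord b x"
  let ?Db = "frechet_derivative (left_coord b) (at x) ?a" and ?Da = "frechet_derivative (left_coord a) (at x) ?b"
  have 1: "?J [?a, ?b] + ?J [?Db] = exp_aut x o\<^sub>L (of_sym_deriv a o\<^sub>L of_sym_deriv b)"
    using exp_aut_left_coord_derivative[OF x, of ?a b] exp_aut_left_coord[OF x, of a] by (simp add: oL_assoc)
  have 2: "?J [?b, ?a] + ?J [?Da] = exp_aut x o\<^sub>L (of_sym_deriv b o\<^sub>L of_sym_deriv a)"
    using exp_aut_left_coord_derivative[OF x, of ?b a] exp_aut_left_coord[OF x, of b] by (simp add: oL_assoc)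
  have sym: "?J [?a, ?b] = ?J [?b, ?a]" by (simp add: series_jet_sym)
  have "?J [?Db - ?Da] = ?J [?Db] - ?J [?Da]"
    using linear_diff[OF has_derivative_linear[OF exp_aut_has_derivative]] by simp
  also have "\<dots> = (?J [?a, ?b] + ?J [?Db]) - (?J [?b, ?a] + ?J [?Da])" unfolding sym by simp
  also have "\<dots> = exp_aut x o\<^sub>L of_sym_deriv (sym_bracket a b)"
    unfolding 1 2 of_sym_bracket commutator_def by (simp add: oL.diff_right)
  also have "\<dots> = ?J [left_coord (sym_bracket a b) x]"
    using exp_aut_left_coord[OF x, of "sym_bracket a b"] by simp
  finally show "series_jet exp_coeff (of_sym_deriv x) [of_sym_deriv (?Db - ?Da)]
      = series_jet exp_coeff (of_sym_deriv x) [of_sym_deriv (left_coord (sym_bracket a b) x)]" by simp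
qed

section \<open>The Lie algebra\<close>

definition left_field :: "'a::cstar_algebra sym_deriv \<Rightarrow> ('a \<Rightarrow>\<^sub>L 'a, 'a sym_deriv) vfield" where
  "left_field \<delta> p c = (if c \<in> aut_atlas \<and> p \<in> fst c then left_coord \<delta> (snd c p) else 0)"

lemma aut_atlas_cases:
  assumes "c \<in> aut_atlas" "p \<in> fst c"
  obtains g where "g \<in> carrier Aut" "c = aut_chart g" "p \<in> carrier Aut" "snd c p \<in> coord_ball"
    "p = g o\<^sub>L exp_aut (snd c p)"
proof -
  obtain g where g: "g \<in> carrier Aut" "c = aut_chart g" using assms(1) by (auto simp: aut_atlas_def)
  have "p \<in> carrier Aut" using assms(2) by (simp add: g(2) aut_chart_def)
  moreover have "snd c p \<in> coord_ball" "g o\<^sub>L exp_aut (snd c p) = p"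
    using aut_chart_parametrised[OF g(1)] assms(2) unfolding parametrises_def g(2) by blast+
  ultimately show ?thesis by (intro that[OF g]) simp_all
qed

lemma aut_chart_curve:
  assumes c: "c \<in> aut_atlas" "p \<in> fst c"
  shows "((\<lambda>t. snd c (p o\<^sub>L exp_aut (t *\<^sub>R \<delta>))) has_vector_derivative left_coord \<delta> (snd c p)) (at 0)"
    and "open {t::real. p o\<^sub>L exp_aut (t *\<^sub>R \<delta>) \<in> fst c}"
proof -
  obtain g where g: "g \<in> carrier Aut" "c = aut_chart g" "p \<in> carrier Aut" "snd c p \<in> coord_ball"
    "p = g o\<^sub>L exp_aut (snd c p)" using aut_atlas_cases[OF c] .
  have "aut_inv g o\<^sub>L p = exp_aut (snd c p)" using g(1) by (subst g(5)) simp
  then have "snd c (p o\<^sub>L exp_aut (t *\<^sub>R \<delta>)) = log_aut (exp_aut (snd c p) o\<^sub>L exp_aut (t *\<^sub>R \<delta>))" for t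
    unfolding g(2) by (simp add: aut_chart_def oL_assoc[symmetric])
  then show "((\<lambda>t. snd c (p o\<^sub>L exp_aut (t *\<^sub>R \<delta>))) has_vector_derivative left_coord \<delta> (snd c p)) (at 0)"
    using left_coord_line[OF g(4)] by simp
  have "{t::real. p o\<^sub>L exp_aut (t *\<^sub>R \<delta>) \<in> fst c} = {t. (aut_inv g o\<^sub>L p) o\<^sub>L exp_aut (t *\<^sub>R \<delta>) \<in> near_id}"
    using g(1,3) unfolding g(2) by (simp add: aut_chart_def oL_assoc)
  then show "open {t::real. p o\<^sub>L exp_aut (t *\<^sub>R \<delta>) \<in> fst c}"
    using open_exp_line_near_id by metis
qed

lemma left_translation_derivative:
  assumes k: "k \<in> carrier Aut" and c: "c \<in> aut_atlas" "p \<in> fst c" and d: "d \<in> aut_atlas" "k o\<^sub>L p \<in> fst d"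
  shows "(local_rep c (\<lambda>T. k o\<^sub>L T) d has_derivative
      frechet_derivative (local_rep c (\<lambda>T. k o\<^sub>L T) d) (at (snd c p))) (at (snd c p))"
  by (rule smooth_on_has_derivative[OF smooth_on_left_translation[OF k c(1) d(1)]])
    (use c d in \<open>auto intro!: imageI\<close>)

text \<open>Both sides are the velocity of the curve \<open>k p exp (t \<delta>)\<close> in the chart \<open>d\<close>.\<close>

lemma left_coord_pushforward:
  assumes k: "k \<in> carrier Aut" and c: "c \<in> aut_atlas" "p \<in> fst c" and d: "d \<in> aut_atlas" "k o\<^sub>L p \<in> fst d"
  shows "left_coord \<delta> (snd d (k o\<^sub>L p))
    = frechet_derivative (local_rep c (\<lambda>T. k o\<^sub>L T) d) (at (snd c p)) (left_coord \<delta> (snd c p))"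
proof -
  let ?f = "local_rep c (\<lambda>T. k o\<^sub>L T) d" and ?\<gamma> = "\<lambda>t::real. p o\<^sub>L exp_aut (t *\<^sub>R \<delta>)"
  let ?D = "frechet_derivative ?f (at (snd c p))"
  have D: "(?f has_derivative ?D) (at (snd c (?\<gamma> 0)))"
    using left_translation_derivative[OF k c d] by simp
  from has_derivative_compose[OF aut_chart_curve(1)[OF c, unfolded has_vector_derivative_def] this]
  have "((\<lambda>t. ?f (snd c (?\<gamma> t))) has_vector_derivative ?D (left_coord \<delta> (snd c p))) (at 0)"
    unfolding has_vector_derivative_def linear_scale[OF has_derivative_linear[OF D]] .
  then have "((\<lambda>t. snd d ((k o\<^sub>L p) o\<^sub>L exp_aut (t *\<^sub>R \<delta>))) has_vector_derivative ?D (left_coord \<delta> (snd c p))) (at 0)"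
  proof (rule has_vector_derivative_transform_within_open[OF _ aut_chart_curve(2)[OF c, of \<delta>]])
    show "0 \<in> {t::real. ?\<gamma> t \<in> fst c}" using c by simp
    fix t assume "t \<in> {t::real. ?\<gamma> t \<in> fst c}"
    then have t: "?\<gamma> t \<in> fst c" by simp
    obtain g where "g \<in> carrier Aut" "c = aut_chart g" using c(1) by (auto simp: aut_atlas_def)
    then have p: "parametrises (\<lambda>x. g o\<^sub>L exp_aut x) coord_ball c" using aut_chart_parametrised by metis
    then have x: "snd c (?\<gamma> t) \<in> coord_ball" and "g o\<^sub>L exp_aut (snd c (?\<gamma> t)) = ?\<gamma> t"
      using t unfolding parametrises_def by blast+
    then show "?f (snd c (?\<gamma> t)) = snd d ((k o\<^sub>L p) o\<^sub>L exp_aut (t *\<^sub>R \<delta>))"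
      unfolding parametrises_local_rep[OF p x] by (simp add: oL_assoc)
  qed
  with aut_chart_curve(1)[OF d, of \<delta>] show ?thesis by (rule vector_derivative_unique_at)
qed

lemma left_translation_id: "(\<lambda>T. id_blinfun o\<^sub>L T) = id"
  by (simp add: fun_eq_iff)

lemma aut_mult_eq: "mult Aut = (o\<^sub>L)"
  by (simp add: Aut_def)

lemma aut_inv_id [simp]: "aut_inv id_blinfun = id_blinfun"
  using Aut.inv_one by simp

lemma left_field_related:
  assumes k: "k \<in> carrier Aut"
  shows "tangent_related aut_atlas aut_atlas (\<lambda>T. k o\<^sub>L T) p (left_field \<delta> p) (left_field \<delta> (k o\<^sub>L p))"
  unfolding tangent_related_def
proof (intro ballI impI)
  fix c d :: "('a \<Rightarrow>\<^sub>L 'a, 'a sym_deriv) chart"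
  assume c: "c \<in> aut_atlas" "p \<in> fst c" and d: "d \<in> aut_atlas" "k o\<^sub>L p \<in> fst d"
  then have "left_field \<delta> p c = left_coord \<delta> (snd c p)"
    "left_field \<delta> (k o\<^sub>L p) d = left_coord \<delta> (snd d (k o\<^sub>L p))"
    by (simp_all add: left_field_def)
  then show "left_field \<delta> (k o\<^sub>L p) d
      = frechet_derivative (local_rep c (\<lambda>T. k o\<^sub>L T) d) (at (snd c p)) (left_field \<delta> p c)"
    by (simp only: left_coord_pushforward[OF k c d])
qed

lemma vfield_rep_left_field:
  assumes "c \<in> aut_atlas" "x \<in> coord_ball"
  shows "vfield_rep c (left_field \<delta>) x = left_coord \<delta> x"
proof -
  obtain g where "g \<in> carrier Aut" "c = aut_chart g" using assms(1) by (auto simp: aut_atlas_def)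
  then have p: "parametrises (\<lambda>x. g o\<^sub>L exp_aut x) coord_ball c" using aut_chart_parametrised by metis
  then show ?thesis
    using assms parametrises_inv_into[OF p] by (simp add: vfield_rep_def left_field_def parametrises_def)
qed

lemma left_field_left_invariant: "left_field \<delta> \<in> left_invariant_vfields Aut aut_atlas"
  unfolding left_invariant_vfields_def smooth_vfields_def
proof (intro CollectI conjI allI ballI)
  show "left_field \<delta> p \<in> tangent_space aut_atlas p" for p
  proof -
    have "tangent_related aut_atlas aut_atlas id p (left_field \<delta> p) (left_field \<delta> p)"
      using left_field_related[OF aut_id, of p \<delta>] unfolding left_translation_id id_apply .
    then show ?thesis unfolding tangent_space_def by (auto simp: left_field_def)
  qed
  show "smooth_on (snd c ` fst c) (vfield_rep c (left_field \<delta>))" if c: "c \<in> aut_atlas" for c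
  proof -
    obtain g where "g \<in> carrier Aut" "c = aut_chart g" using c by (auto simp: aut_atlas_def)
    then have "snd c ` fst c = coord_ball" using aut_chart_image by metis
    then show ?thesis
      using smooth_on_subset_cong[OF smooth_on_left_coord open_ball subset_refl]
        vfield_rep_left_field[OF c] by metis
  qed
  show "tangent_related aut_atlas aut_atlas (\<lambda>x. g \<otimes>\<^bsub>Aut\<^esub> x) h (left_field \<delta> h) (left_field \<delta> (g \<otimes>\<^bsub>Aut\<^esub> h))"
    if "g \<in> carrier Aut" for g h
    using left_field_related[OF that] by simp
qed

abbreviation id_chart :: "('a::cstar_algebra \<Rightarrow>\<^sub>L 'a, 'a sym_deriv) chart" where
  "id_chart \<equiv> aut_chart id_blinfun"

lemma id_chart_in_atlas [simp]: "id_chart \<in> aut_atlas"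
  by (simp add: aut_atlas_def)

lemma id_in_id_chart [simp]: "id_blinfun \<in> fst id_chart"
  by (rule aut_chart_centre[OF aut_id])

lemma left_field_id: "left_field \<delta> id_blinfun id_chart = \<delta>"
proof -
  have "snd id_chart id_blinfun = (0 :: 'a sym_deriv)"
    using exp_aut_near_id(2)[of 0] by (simp add: aut_chart_def)
  then show ?thesis
    by (simp add: left_field_def left_coord_zero)
qed

text \<open>Left translation by \<open>p\<close> carries the value at the identity to the value at \<open>p\<close>, and
\<open>left_field\<close> takes every value at the identity.\<close>

lemma left_invariant_eq_left_field:
  assumes V: "V \<in> left_invariant_vfields Aut aut_atlas"
  shows "V = left_field (V id_blinfun id_chart)"
proof (intro ext)
  fix p c
  let ?\<delta> = "V id_blinfun id_chart"
  have related: "tangent_related aut_atlas aut_atlas (\<lambda>T. g o\<^sub>L T) h (V h) (V (g o\<^sub>L h))"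
    if "g \<in> carrier Aut" "h \<in> carrier Aut" for g h
    using V that unfolding left_invariant_vfields_def aut_mult_eq by blast
  show "V p c = left_field ?\<delta> p c"
  proof (cases "c \<in> aut_atlas \<and> p \<in> fst c")
    case True
    then have p: "p \<in> carrier Aut" using aut_atlas_cases by metis
    let ?D = "frechet_derivative (local_rep id_chart (\<lambda>T. p o\<^sub>L T) c) (at (snd id_chart id_blinfun))"
    have "V p c = ?D ?\<delta>"
      using related[OF p aut_id] True unfolding tangent_related_def by simp
    also have "\<dots> = ?D (left_field ?\<delta> id_blinfun id_chart)" by (simp only: left_field_id)
    also have "?D (left_field ?\<delta> id_blinfun id_chart) = left_field ?\<delta> p c"
    proof (rule sym)
      show "left_field ?\<delta> p c = ?D (left_field ?\<delta> id_blinfun id_chart)"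
        using left_field_related[OF p, of id_blinfun ?\<delta>] True id_chart_in_atlas id_in_id_chart
        unfolding tangent_related_def oL_id by blast
    qed
    finally show ?thesis .
  next
    case False
    have "V p \<in> tangent_space aut_atlas p"
      using V by (simp add: left_invariant_vfields_def smooth_vfields_def)
    then have "V p c = 0" using False unfolding tangent_space_def by blast
    then show ?thesis using False by (simp only: left_field_def if_False)
  qed
qed

lemma vfield_bracket_left_field:
  "vfield_bracket aut_atlas (left_field a) (left_field b) = left_field (sym_bracket a b)"
proof (intro ext)
  fix p c
  show "vfield_bracket aut_atlas (left_field a) (left_field b) p c = left_field (sym_bracket a b) p c"
  proof (cases "c \<in> aut_atlas \<and> p \<in> fst c")
    case True
    then have x: "snd c p \<in> coord_ball" using aut_atlas_cases by metis
    have D: "frechet_derivative (vfield_rep c (left_field \<delta>)) (at (snd c p))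
        = frechet_derivative (left_coord \<delta>) (at (snd c p))" for \<delta>
    proof -
      have "(vfield_rep c (left_field \<delta>) has_derivative frechet_derivative (left_coord \<delta>) (at (snd c p))) (at (snd c p))"
        by (rule has_derivative_transform_within_open[OF smooth_on_has_derivative[OF smooth_on_left_coord x] open_ball x])
          (use True vfield_rep_left_field in metis)
      then show ?thesis by (rule frechet_derivative_at[symmetric])
    qed
    show ?thesis
      using True left_coord_bracket[OF x, of b a] by (simp add: vfield_bracket_def D left_field_def)
  next
    case False
    then show ?thesis by (auto simp: vfield_bracket_def left_field_def)
  qed
qed

text \<open>The derivative of the change of charts at the identity is bounded.\<close>

lemma norm_change_of_chart:
  assumes c: "c \<in> aut_atlas" "id_blinfun \<in> fst c" and d: "d \<in> aut_atlas" "id_blinfun \<in> fst d"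
  shows "\<exists>K\<ge>0. \<forall>V\<in>left_invariant_vfields Aut aut_atlas. norm (V id_blinfun d) \<le> K * norm (V id_blinfun c)"
proof -
  let ?D = "frechet_derivative (local_rep c id d) (at (snd c id_blinfun))"
  have "id_blinfun o\<^sub>L id_blinfun \<in> fst d" using d(2) by simp
  from has_derivative_bounded_linear[OF left_translation_derivative[OF aut_id c d(1) this]]
  have "bounded_linear ?D" unfolding left_translation_id .
  then obtain K where K: "K > 0" "\<And>v. norm (?D v) \<le> norm v * K"
    using bounded_linear.pos_bounded by blast
  have "norm (V id_blinfun d) \<le> K * norm (V id_blinfun c)" if "V \<in> left_invariant_vfields Aut aut_atlas" for V
  proof -
    have "V id_blinfun \<in> tangent_space aut_atlas id_blinfun"
      using that by (simp add: left_invariant_vfields_def smooth_vfields_def)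
    then have "tangent_related aut_atlas aut_atlas id id_blinfun (V id_blinfun) (V id_blinfun)"
      unfolding tangent_space_def by blast
    then have "V id_blinfun d = ?D (V id_blinfun c)"
      using c d unfolding tangent_related_def id_apply by blast
    then show ?thesis using K(2)[of "V id_blinfun c"] by (simp only: mult.commute)
  qed
  then show ?thesis using K(1) by (intro exI[of _ K]) auto
qed

text \<open>The isomorphism evaluates a field at the identity, in exponential coordinates around it.\<close>

lemma aut_lie_algebra:
  "lie_algebra_iso Aut aut_atlas symmetric_derivations commutator
     (\<lambda>V. of_sym_deriv (V id_blinfun id_chart))"
  unfolding lie_algebra_iso_def
proof (intro conjI ballI allI impI)
  let ?\<Psi> = "\<lambda>V::('a \<Rightarrow>\<^sub>L 'a, 'a sym_deriv) vfield. of_sym_deriv (V id_blinfun id_chart)"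
  let ?L = "left_invariant_vfields Aut aut_atlas :: ('a \<Rightarrow>\<^sub>L 'a, 'a sym_deriv) vfield set"
  show "bij_betw ?\<Psi> ?L symmetric_derivations"
  proof (rule bij_betw_byWitness[where f' = "\<lambda>\<delta>. left_field (Sym_Deriv \<delta>)"])
    show "\<forall>V\<in>?L. left_field (Sym_Deriv (?\<Psi> V)) = V"
      unfolding of_sym_deriv_inverse using left_invariant_eq_left_field[symmetric] by blast
    show "\<forall>\<delta>\<in>symmetric_derivations. ?\<Psi> (left_field (Sym_Deriv \<delta>)) = \<delta>"
      by (simp add: left_field_id Sym_Deriv_inverse)
    show "?\<Psi> ` ?L \<subseteq> symmetric_derivations" using of_sym_deriv by blast
    show "(\<lambda>\<delta>. left_field (Sym_Deriv \<delta>)) ` symmetric_derivations \<subseteq> ?L"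
      using left_field_left_invariant by blast
  qed
  fix V assume V: "V \<in> ?L"
  show "?\<Psi> (\<lambda>p c. r *\<^sub>R V p c) = r *\<^sub>R ?\<Psi> V" for r by (simp add: of_sym_deriv_simps)
  fix W assume W: "W \<in> ?L"
  show "?\<Psi> (\<lambda>p c. V p c + W p c) = ?\<Psi> V + ?\<Psi> W" by (simp add: of_sym_deriv_simps)
  define a b where "a = V id_blinfun id_chart" and "b = W id_blinfun id_chart"
  have "V = left_field a" "W = left_field b"
    unfolding a_def b_def by (rule left_invariant_eq_left_field[OF V], rule left_invariant_eq_left_field[OF W])
  then have "vfield_bracket aut_atlas V W = left_field (sym_bracket a b)"
    by (simp only: vfield_bracket_left_field)
  then show "?\<Psi> (vfield_bracket aut_atlas V W) = commutator (?\<Psi> V) (?\<Psi> W)"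
    by (simp only: left_field_id of_sym_bracket a_def b_def)
next
  fix c :: "('a \<Rightarrow>\<^sub>L 'a, 'a sym_deriv) chart"
  assume c: "c \<in> aut_atlas" "\<one>\<^bsub>Aut\<^esub> \<in> fst c"
  let ?L = "left_invariant_vfields Aut aut_atlas :: ('a \<Rightarrow>\<^sub>L 'a, 'a sym_deriv) vfield set"
  have c1: "id_blinfun \<in> fst c" using c(2) by simp
  note i = id_chart_in_atlas id_in_id_chart
  obtain K where K: "K \<ge> 0" "\<forall>V\<in>?L. norm (V id_blinfun id_chart) \<le> K * norm (V id_blinfun c)"
    using norm_change_of_chart[OF c(1) c1 i] by blast
  obtain K' where K': "K' \<ge> 0" "\<forall>V\<in>?L. norm (V id_blinfun c) \<le> K' * norm (V id_blinfun id_chart)"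
    using norm_change_of_chart[OF i c(1) c1] by blast
  have mono: "K * x \<le> max K K' * x" "K' * x \<le> max K K' * x" if "x \<ge> 0" for x
    using that by (auto intro: mult_right_mono)
  have "norm (V id_blinfun id_chart) \<le> max K K' * norm (V id_blinfun c)
      \<and> norm (V id_blinfun c) \<le> max K K' * norm (V id_blinfun id_chart)" if V: "V \<in> ?L" for V
    using order_trans[OF K(2)[rule_format, OF V] mono(1)[OF norm_ge_zero]]
      order_trans[OF K'(2)[rule_format, OF V] mono(2)[OF norm_ge_zero]] by blast
  then show "\<exists>K. \<forall>V\<in>?L. norm (of_sym_deriv (V id_blinfun id_chart)) \<le> K * norm (V \<one>\<^bsub>Aut\<^esub> c)
      \<and> norm (V \<one>\<^bsub>Aut\<^esub> c) \<le> K * norm (of_sym_deriv (V id_blinfun id_chart))"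
    unfolding norm_sym_deriv_def[symmetric] Aut_simps by blast
qed

theorem proposition4p11:
  "\<exists>\<A> :: ('a::cstar_algebra \<Rightarrow>\<^sub>L 'a, 'a sym_deriv) chart set.
     banach_lie_group Aut (top_of_set (carrier Aut)) \<A> \<and>
     (\<exists>\<Psi>. lie_algebra_iso Aut \<A> (symmetric_derivations :: ('a \<Rightarrow>\<^sub>L 'a) set) commutator \<Psi>)"
  by (intro exI conjI) (rule aut_banach_lie_group, rule aut_lie_algebra)

end
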